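(* Let $(P,[\cdot_\lambda\cdot],\cdot_\lambda\cdot)$ be a Poisson conformal algebra and let $r\in P\otimes P$ be skew-symmetric, i.e. $\tau r=-r$. Then the maps $\delta,\Delta:P\to P\otimes P$ given by $$\delta(a)=(\mathfrak{ad}_P(a)_\lambda\otimes I+I\otimes\mathfrak{ad}_P(a)_\lambda)r\big|_{\lambda=-\partial^{\otimes^2}},\qquad \Delta(a)=(I\otimes\mathfrak L_P(a)_\lambda-\mathfrak L_P(a)_\lambda\otimes I)r\big|_{\lambda=-\partial^{\otimes^2}},\qquad a\in P,$$ define a Poisson conformal coalgebra $(P,\delta,\Delta)$ such that $(P,[\cdot_\lambda\cdot],\cdot_\lambda\cdot,\delta,\Delta)$ is a Poisson conformal bialgebra, if $$[[r,r]]\equiv0\ \bmod(\partial^{\otimes^3})\quad\text{and}\quad r\bullet r\equiv0\ \bmod(\partial^{\otimes^3}).$$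
   Context: Let $\mathbf k$ be a field of characteristic $0$. All $\mathbf k[\partial]$-modules are assumed finitely generated; $\otimes$ is over $\mathbf k$, $I$ is the identity, $\tau(u\otimes v)=v\otimes u$. An associative conformal algebra is a $\mathbf k[\partial]$-module $P$ with a $\mathbf k$-bilinear map $P\times P\to P[\lambda]$, $(a,b)\mapsto a_\lambda b$, with $(\partial a)_\lambda b=-\lambda a_\lambda b$, $a_\lambda(\partial b)=(\partial+\lambda)a_\lambda b$, $(a_\lambda b)_{\lambda+\mu}c=a_\lambda(b_\mu c)$; it is commutative if $a_\lambda b=b_{-\lambda-\partial}a$. (If $b_\nu a=\sum_k\nu^kc_k$, then $b_{-\lambda-\partial}a=\sum_k(-\lambda-\partial)^kc_k$.) A Lie conformal algebra is a $\mathbf k[\partial]$-module $P$ with a $\mathbf k$-bilinear map $[\cdot_\lambda\cdot]:P\times P\to P[\lambda]$ with $[(\partial a)_\lambda b]=-\lambda[a_\lambda b]$, $[a_\lambda(\partial b)]=(\partial+\lambda)[a_\lambda b]$, $[a_\lambda b]=-[b_{-\lambda-\partial}a]$, $[a_\lambda[b_\mu c]]=[[a_\lambda b]_{\lambda+\mu}c]+[b_\mu[a_\lambda c]]$. A Poisson conformal algebra $(P,[\cdot_\lambda\cdot],\cdot_\lambda\cdot)$ is both a Lie conformal algebra and a commutative associative conformal algebra such that $[a_\lambda(b_\mu c)]=[a_\lambda b]_{\lambda+\mu}c+b_\mu[a_\lambda c]$. Write $\mathfrak{ad}_P(a)_\lambda b=[a_\lambda b]$, $\mathfrak L_P(a)_\lambda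 b=a_\lambda b$. Put $\partial^{\otimes^2}=\partial\otimes I+I\otimes\partial$ and $\partial^{\otimes^3}=\partial\otimes I\otimes I+I\otimes\partial\otimes I+I\otimes I\otimes\partial$; these give the $\mathbf k[\partial]$-actions on $P\otimes P$, $P\otimes P\otimes P$. Substituting an operator (such as $-\lambda-\partial^{\otimes^2}$ or $-\partial^{\otimes^2}$) for the parameter means letting the resulting polynomial act on the tensor coefficients: if $T_\nu u=\sum_k\nu^kw_k$, then $(T_{-\lambda-\partial^{\otimes^2}}\otimes I)(u\otimes v)=\sum_k(-\lambda-\partial^{\otimes^2})^k(w_k\otimes v)$, etc. The notation "$\equiv0\bmod(\partial^{\otimes^3})$" means lying in $\partial^{\otimes^3}(P\otimes P\otimes P)$. For $r=\sum_ir_i\otimes l_i\in P\otimes P$: $[[r,r]]=\sum_{i,j}\big([{r_i}_\mu r_j]\otimes l_i\otimes l_j|_{\mu=I\otimes\partial\otimes I}-r_i\otimes[{r_j}_\mu l_i]\otimes l_j|_{\mu=I\otimes I\otimes\partial}-r_i\otimes r_j\otimes[{l_j}_\mu l_i]|_{\mu=I\otimes\partial\otimes I}\big)$, $r\bullet r=\sum_{i,j}\big(r_i\otimes r_j\otimes{l_i}_\mu l_j|_{\mu=\partial\otimes I\otimes I}-r_i\otimes{r_j}_\mu l_i\otimes l_j|_{\mu=-\partial^{\otimes^2}\otimes I}+{r_i}_\mu r_j\otimes l_i\otimes l_j|_{\mu=I\otimes\partial\otimes I}\big)$. Coproducts are $\mathbf k[\partial]$-module homomorphisms $P\to P\otimes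 P$. $(P,\Delta)$ is a cocommutative associative conformal coalgebra if $(I\otimes\Delta)\Delta=(\Delta\otimes I)\Delta$ and $\Delta=\tau\Delta$. $(P,\delta)$ is a Lie conformal coalgebra if $\delta=-\tau\delta$ and $(I\otimes\delta)\delta-(\tau\otimes I)(I\otimes\delta)\delta=(\delta\otimes I)\delta$. $(P,\delta,\Delta)$ is a Poisson conformal coalgebra if both hold and $(I\otimes\Delta)\delta=(\delta\otimes I)\Delta+(\tau\otimes I)(I\otimes\delta)\Delta$. A Poisson conformal bialgebra is a 5-tuple $(P,[\cdot_\lambda\cdot],\cdot_\lambda\cdot,\delta,\Delta)$ such that $(P,[\cdot_\lambda\cdot],\cdot_\lambda\cdot)$ is a Poisson conformal algebra, $(P,\delta,\Delta)$ is a Poisson conformal coalgebra, and for all $a,b\in P$: (i) $\delta([a_\lambda b])=(\mathfrak{ad}_P(a)_\lambda\otimes I+I\otimes\mathfrak{ad}_P(a)_\lambda)\delta(b)-(\mathfrak{ad}_P(b)_{-\lambda-\partial^{\otimes^2}}\otimes I+I\otimes\mathfrak{ad}_P(b)_{-\lambda-\partial^{\otimes^2}})\delta(a)$; (ii) $\Delta(a_\lambda b)=(I\otimes\mathfrak L_P(a)_\lambda)\Delta(b)+(\mathfrak L_P(b)_{-\lambda-\partial^{\otimes^2}}\otimes I)\Delta(a)$; (iii) $\delta(a_\lambda b)=(\mathfrak L_P(a)_\lambda\otimes I)\delta(b)+(\mathfrak L_P(b)_{-\lambda-\partial^{\otimes^2}}\otimes I)\delta(a)+(I\otimes\mathfrak{ad}_P(a)_\lambda)\Delta(b)+(I\otimes\mathfrak{ad}_P(b)_{-\lambda-\partial^{\otimes^2}})\Delta(a)$;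 (iv) $\Delta([a_\lambda b])=(\mathfrak{ad}_P(a)_\lambda\otimes I+I\otimes\mathfrak{ad}_P(a)_\lambda)\Delta(b)-(I\otimes\mathfrak L_P(b)_{-\lambda-\partial^{\otimes^2}})\delta(a)+(\mathfrak L_P(b)_{-\lambda-\partial^{\otimes^2}}\otimes I)\delta(a)$. *)

theory Defs
  imports
    "HOL-Computational_Algebra.Polynomial"
    "HOL-Library.Function_Algebras"
begin

section \<open>Modules over the polynomial ring in the derivation\<close>

text \<open>
  A \<open>k[\<partial>]\<close>-module is a library \<open>module\<close> whose scalars are \<open>'k poly\<close>; the underlying
  \<open>k\<close>-vector space and the operator \<open>\<partial>\<close> are read off from its action \<open>s\<close>.
\<close>

definition kscale :: "('k::field poly \<Rightarrow> 'p \<Rightarrow> 'p) \<Rightarrow> 'k \<Rightarrow> 'p \<Rightarrow> 'p"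
  where "kscale s c x = s [:c:] x"

definition der :: "('k::field poly \<Rightarrow> 'p \<Rightarrow> 'p) \<Rightarrow> 'p \<Rightarrow> 'p"
  where "der s x = s [:0, 1:] x"

locale fg_diff_module = module s
  for s :: "'k::field_char_0 poly \<Rightarrow> 'p::ab_group_add \<Rightarrow> 'p" +
  assumes finitely_generated: "\<exists>S. finite S \<and> span S = UNIV"

definition bilin ::
  "('k::field \<Rightarrow> 'a::ab_group_add \<Rightarrow> 'a) \<Rightarrow> ('k \<Rightarrow> 'b::ab_group_add \<Rightarrow> 'b)
   \<Rightarrow> ('k \<Rightarrow> 'c::ab_group_add \<Rightarrow> 'c) \<Rightarrow> ('a \<Rightarrow> 'b \<Rightarrow> 'c) \<Rightarrow> bool"
  where "bilin sa sb sc f \<longleftrightarrow>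
    (\<forall>v. Vector_Spaces.linear sa sc (\<lambda>u. f u v)) \<and> (\<forall>u. Vector_Spaces.linear sb sc (f u))"

definition trilin ::
  "('k::field \<Rightarrow> 'a::ab_group_add \<Rightarrow> 'a) \<Rightarrow> ('k \<Rightarrow> 'b::ab_group_add \<Rightarrow> 'b)
   \<Rightarrow> ('k \<Rightarrow> 'c::ab_group_add \<Rightarrow> 'c) \<Rightarrow> ('k \<Rightarrow> 'd::ab_group_add \<Rightarrow> 'd)
   \<Rightarrow> ('a \<Rightarrow> 'b \<Rightarrow> 'c \<Rightarrow> 'd) \<Rightarrow> bool"
  where "trilin sa sb sc sd f \<longleftrightarrow>
    (\<forall>v w. Vector_Spaces.linear sa sd (\<lambda>u. f u v w)) \<and>
    (\<forall>u w. Vector_Spaces.linear sb sd (\<lambda>v. f u v w)) \<and>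
    (\<forall>u v. Vector_Spaces.linear sc sd (f u v))"


section \<open>Polynomials with coefficients in a module\<close>

text \<open>
  \<open>W[\<lambda>]\<close> is \<open>'w poly\<close>, with multiplication by \<open>\<lambda>\<close> being \<open>pCons 0\<close>.
  \<open>psubst A p\<close> substitutes the operator \<open>A\<close> for the parameter: if \<open>p = \<Sum>\<^sub>k \<lambda>\<^sup>k w\<^sub>k\<close>,
  the result is \<open>\<Sum>\<^sub>k A\<^sup>k w\<^sub>k\<close>.
\<close>

definition psubst :: "('w::comm_monoid_add \<Rightarrow> 'w) \<Rightarrow> 'w poly \<Rightarrow> 'w"
  where "psubst A p = (\<Sum>k\<le>degree p. (A ^^ k) (coeff p k))"

text \<open>
  \<open>psubst_skew D p\<close> is \<open>\<Sum>\<^sub>k (-\<lambda> - D)\<^sup>k w\<^sub>k\<close> in \<open>W[\<lambda>]\<close>, where \<open>D\<close> acts on \<open>W[\<lambda>]\<close>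
  coefficientwise.
\<close>

definition psubst_skew :: "('w::ab_group_add \<Rightarrow> 'w) \<Rightarrow> 'w poly \<Rightarrow> 'w poly"
  where "psubst_skew D p =
    psubst (\<lambda>q. - pCons 0 q - map_poly D q) (map_poly (\<lambda>x. [:x:]) p)"

text \<open>
  \<open>W[\<lambda>,\<mu>]\<close> is \<open>'w poly poly\<close>; the inner variable is \<open>\<lambda>\<close>, the outer one is \<open>\<mu>\<close>.
\<close>

definition mult_lam :: "'w::ab_group_add poly poly \<Rightarrow> 'w poly poly"
  where "mult_lam q = map_poly (pCons 0) q"

definition mult_mu :: "'w::ab_group_add poly poly \<Rightarrow> 'w poly poly"
  where "mult_mu q = pCons 0 q"

definition mult_lam_mu :: "'w::ab_group_add poly poly \<Rightarrow> 'w poly poly"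
  where "mult_lam_mu q = mult_lam q + mult_mu q"

text \<open>
  For a \<open>\<lambda>\<close>-product \<open>m\<close>, \<open>prod_at m A a b\<close> is \<open>a\<^sub>A b\<close> in \<open>W[\<lambda>,\<mu>]\<close>, the parameter \<open>A\<close> being one of
  \<open>\<lambda>\<close>, \<open>\<mu>\<close>, \<open>\<lambda> + \<mu>\<close> viewed as a multiplication operator.  With this,
  \<open>nest_left m A m' B a b c\<close> is \<open>(a\<^sub>A b)\<^sub>B c\<close> with \<open>m\<close> the inner and \<open>m'\<close> the outer product, and
  \<open>nest_right m A m' B a b c\<close> is \<open>a\<^sub>A (b\<^sub>B c)\<close> with \<open>m\<close> the outer and \<open>m'\<close> the inner product.
\<close>

definition prod_at ::
  "('w::ab_group_add \<Rightarrow> 'w \<Rightarrow> 'w poly) \<Rightarrow> ('w poly poly \<Rightarrow> 'w poly poly) \<Rightarrow> 'w \<Rightarrow> 'w \<Rightarrow> 'w poly poly"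
  where "prod_at m A a b = psubst A (map_poly (\<lambda>x. [:[:x:]:]) (m a b))"

definition nest_left ::
  "('w::ab_group_add \<Rightarrow> 'w \<Rightarrow> 'w poly) \<Rightarrow> ('w poly poly \<Rightarrow> 'w poly poly) \<Rightarrow>
   ('w \<Rightarrow> 'w \<Rightarrow> 'w poly) \<Rightarrow> ('w poly poly \<Rightarrow> 'w poly poly) \<Rightarrow> 'w \<Rightarrow> 'w \<Rightarrow> 'w \<Rightarrow> 'w poly poly"
  where "nest_left m A m' B a b c = psubst A (map_poly (\<lambda>x. prod_at m' B x c) (m a b))"

definition nest_right ::
  "('w::ab_group_add \<Rightarrow> 'w \<Rightarrow> 'w poly) \<Rightarrow> ('w poly poly \<Rightarrow> 'w poly poly) \<Rightarrow>
   ('w \<Rightarrow> 'w \<Rightarrow> 'w poly) \<Rightarrow> ('w poly poly \<Rightarrow> 'w poly poly) \<Rightarrow> 'w \<Rightarrow> 'w \<Rightarrow> 'w \<Rightarrow> 'w poly poly"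
  where "nest_right m A m' B a b c = psubst B (map_poly (\<lambda>x. prod_at m A a x) (m' b c))"


section \<open>Conformal algebras\<close>

locale conformal_product = fg_diff_module s
  for s :: "'k::field_char_0 poly \<Rightarrow> 'p::ab_group_add \<Rightarrow> 'p"
  and m :: "'p \<Rightarrow> 'p \<Rightarrow> 'p poly" +
  assumes bilinear: "bilin (kscale s) (kscale s) (\<lambda>c. map_poly (kscale s c)) m"
    and der_left: "m (der s a) b = - pCons 0 (m a b)"
    and der_right: "m a (der s b) = map_poly (der s) (m a b) + pCons 0 (m a b)"

locale comm_assoc_conformal_algebra = conformal_product s mul
  for s :: "'k::field_char_0 poly \<Rightarrow> 'p::ab_group_add \<Rightarrow> 'p"
  and mul :: "'p \<Rightarrow> 'p \<Rightarrow> 'p poly" +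
  assumes assoc: "nest_left mul mult_lam mul mult_lam_mu a b c
                  = nest_right mul mult_lam mul mult_mu a b c"
    and commute: "mul a b = psubst_skew (der s) (mul b a)"

locale lie_conformal_algebra = conformal_product s br
  for s :: "'k::field_char_0 poly \<Rightarrow> 'p::ab_group_add \<Rightarrow> 'p"
  and br :: "'p \<Rightarrow> 'p \<Rightarrow> 'p poly" +
  assumes skew: "br a b = - psubst_skew (der s) (br b a)"
    and jacobi: "nest_right br mult_lam br mult_mu a b c
                 = nest_left br mult_lam br mult_lam_mu a b c
                   + nest_right br mult_mu br mult_lam b a c"

locale poisson_conformal_algebra =
  lie_conformal_algebra s br + comm_assoc_conformal_algebra s mul
  for s :: "'k::field_char_0 poly \<Rightarrow> 'p::ab_group_add \<Rightarrow> 'p"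
  and br mul :: "'p \<Rightarrow> 'p \<Rightarrow> 'p poly" +
  assumes leibniz: "nest_right br mult_lam mul mult_mu a b c
                    = nest_left br mult_lam mul mult_lam_mu a b c
                      + nest_right mul mult_mu br mult_lam b a c"


section \<open>Tensor powers\<close>

text \<open>
  The tensor power \<open>P \<otimes> P\<close> over \<open>k\<close> is realised inside the space of functionals on bilinear forms:
  \<open>u \<otimes> v\<close> is the evaluation of bilinear forms at \<open>(u, v)\<close>, and \<open>tensor_space2 s\<close> is the set of
  all finite sums of pure tensors.  \<open>P \<otimes> P \<otimes> P\<close> is treated in the same way with trilinear forms.
  The universal property with respect to arbitrary vector spaces is proved below
  (\<open>bilin_tensor2\<close> and \<open>tensor2_universal\<close>, \<open>trilin_tensor3\<close> and \<open>tensor3_universal\<close>).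
\<close>

type_synonym ('k, 'p) tens2 = "('p \<Rightarrow> 'p \<Rightarrow> 'k) \<Rightarrow> 'k"
type_synonym ('k, 'p) tens3 = "('p \<Rightarrow> 'p \<Rightarrow> 'p \<Rightarrow> 'k) \<Rightarrow> 'k"

definition tensor2 ::
  "('k::field poly \<Rightarrow> 'p::ab_group_add \<Rightarrow> 'p) \<Rightarrow> 'p \<Rightarrow> 'p \<Rightarrow> ('k, 'p) tens2"
  where "tensor2 s u v =
    (\<lambda>B. if bilin (kscale s) (kscale s) (*) B then B u v else 0)"

definition tensor3 ::
  "('k::field poly \<Rightarrow> 'p::ab_group_add \<Rightarrow> 'p) \<Rightarrow> 'p \<Rightarrow> 'p \<Rightarrow> 'p \<Rightarrow> ('k, 'p) tens3"
  where "tensor3 s u v w =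
    (\<lambda>B. if trilin (kscale s) (kscale s) (kscale s) (*) B then B u v w else 0)"

definition tensor_space2 ::
  "('k::field poly \<Rightarrow> 'p::ab_group_add \<Rightarrow> 'p) \<Rightarrow> ('k, 'p) tens2 set"
  where "tensor_space2 s = range (\<lambda>xs. \<Sum>(u, v)\<leftarrow>xs. tensor2 s u v)"

definition tensor_space3 ::
  "('k::field poly \<Rightarrow> 'p::ab_group_add \<Rightarrow> 'p) \<Rightarrow> ('k, 'p) tens3 set"
  where "tensor_space3 s = range (\<lambda>xs. \<Sum>(u, v, w)\<leftarrow>xs. tensor3 s u v w)"

definition tscale :: "'k::field \<Rightarrow> ('b \<Rightarrow> 'k) \<Rightarrow> 'b \<Rightarrow> 'k"
  where "tscale c t = (\<lambda>B. c * t B)"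

text \<open>
  \<open>tlift2 s f t\<close> is \<open>\<Sum>\<^sub>i f(r\<^sub>i, l\<^sub>i)\<close> for \<open>t = \<Sum>\<^sub>i r\<^sub>i \<otimes> l\<^sub>i\<close>.  For bilinear \<open>f\<close> the result does not
  depend on the chosen expression of \<open>t\<close>, see \<open>tlift2_sum\<close>.
\<close>

definition tlift2 ::
  "('k::field poly \<Rightarrow> 'p::ab_group_add \<Rightarrow> 'p) \<Rightarrow> ('p \<Rightarrow> 'p \<Rightarrow> 'w::ab_group_add)
   \<Rightarrow> ('k, 'p) tens2 \<Rightarrow> 'w"
  where "tlift2 s f t =
    (\<Sum>(u, v)\<leftarrow>(SOME xs. t = (\<Sum>(u, v)\<leftarrow>xs. tensor2 s u v)). f u v)"

definition tlift3 ::
  "('k::field poly \<Rightarrow> 'p::ab_group_add \<Rightarrow> 'p) \<Rightarrow> ('p \<Rightarrow> 'p \<Rightarrow> 'p \<Rightarrow> 'w::ab_group_add)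
   \<Rightarrow> ('k, 'p) tens3 \<Rightarrow> 'w"
  where "tlift3 s f t =
    (\<Sum>(u, v, w)\<leftarrow>(SOME xs. t = (\<Sum>(u, v, w)\<leftarrow>xs. tensor3 s u v w)). f u v w)"


subsection \<open>Universal property\<close>

lemma vector_space_kscale:
  assumes "module s"
  shows "vector_space (kscale s)"
proof -
  interpret module s by fact
  show ?thesis
    by unfold_locales
      (simp_all add: kscale_def scale_right_distrib scale_left_distrib [symmetric] mult.commute
        flip: one_pCons)
qed

lemma vector_space_field: "vector_space ((*) :: 'k::field \<Rightarrow> 'k \<Rightarrow> 'k)"
  by unfold_locales (simp_all add: algebra_simps)

lemma vector_space_tscale: "vector_space (tscale :: 'k::field \<Rightarrow> ('b \<Rightarrow> 'k) \<Rightarrow> 'b \<Rightarrow> 'k)"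
  by unfold_locales (simp_all add: tscale_def fun_eq_iff algebra_simps)

lemma linear_iff_add_scale:
  "Vector_Spaces.linear s1 s2 f \<longleftrightarrow> vector_space s1 \<and> vector_space s2 \<and>
     (\<forall>x y. f (x + y) = f x + f y) \<and> (\<forall>c x. f (s1 c x) = s2 c (f x))"
  unfolding Vector_Spaces.linear_def module_hom_def module_hom_axioms_def
  by (auto simp: module_iff_vector_space)

lemma sum_list_fun_apply: "(\<Sum>x\<leftarrow>xs. f x) B = (\<Sum>x\<leftarrow>xs. f x B)"
  for f :: "'a \<Rightarrow> 'b \<Rightarrow> 'c::ab_group_add"
  by (induction xs) auto

lemma ex_separating_functional:
  fixes sw :: "'k::field \<Rightarrow> 'w::ab_group_add \<Rightarrow> 'w"
  assumes "vector_space sw" and "d \<noteq> 0"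
  shows "\<exists>g. Vector_Spaces.linear sw (*) g \<and> g d = (1 :: 'k)"
proof -
  interpret vector_space_pair sw "(*) :: 'k \<Rightarrow> 'k \<Rightarrow> 'k"
    unfolding vector_space_pair_def using assms(1) vector_space_field by blast
  have "vs1.independent {d}"
    using assms(2) by (simp add: vs1.dependent_single)
  from linear_independent_extend [OF this, of "\<lambda>_. 1"] show ?thesis by auto
qed

lemma linear_sum_list:
  assumes "Vector_Spaces.linear s1 s2 g"
  shows "g (\<Sum>x\<leftarrow>xs. f x) = (\<Sum>x\<leftarrow>xs. g (f x))"
proof -
  interpret Vector_Spaces.linear s1 s2 g by fact
  show ?thesis by (induction xs) (auto simp: zero add)
qed

lemma bilin_tensor2:
  assumes "module s"
  shows "bilin (kscale s) (kscale s) tscale (tensor2 s)"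
  unfolding bilin_def linear_iff_add_scale
  using vector_space_kscale [OF assms] vector_space_tscale
  by (auto simp: tensor2_def tscale_def fun_eq_iff bilin_def linear_iff_add_scale)

lemma trilin_tensor3:
  assumes "module s"
  shows "trilin (kscale s) (kscale s) (kscale s) tscale (tensor3 s)"
  unfolding trilin_def linear_iff_add_scale
  using vector_space_kscale [OF assms] vector_space_tscale
  by (auto simp: tensor3_def tscale_def fun_eq_iff trilin_def linear_iff_add_scale)

lemma tensor2_sum_cong:
  fixes sw :: "'k::field \<Rightarrow> 'w::ab_group_add \<Rightarrow> 'w"
  assumes f: "bilin (kscale s) (kscale s) sw f"
    and eq: "(\<Sum>(u, v)\<leftarrow>xs. tensor2 s u v) = (\<Sum>(u, v)\<leftarrow>ys. tensor2 s u v)"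
  shows "(\<Sum>(u, v)\<leftarrow>xs. f u v) = (\<Sum>(u, v)\<leftarrow>ys. f u v)"
proof (rule ccontr)
  let ?d = "(\<Sum>(u, v)\<leftarrow>xs. f u v) - (\<Sum>(u, v)\<leftarrow>ys. f u v)"
  assume "\<not> ?thesis"
  then have "?d \<noteq> 0" by simp
  moreover have "vector_space sw"
    using f by (auto simp: bilin_def linear_iff_add_scale)
  ultimately obtain g :: "'w \<Rightarrow> 'k" where g: "Vector_Spaces.linear sw (*) g" "g ?d = 1"
    using ex_separating_functional by blast
  have B: "bilin (kscale s) (kscale s) (*) (\<lambda>u v. g (f u v))"
    using f g(1) by (auto simp: bilin_def linear_iff_add_scale)
  from eq have "(\<Sum>(u, v)\<leftarrow>xs. tensor2 s u v) (\<lambda>u v. g (f u v))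
    = (\<Sum>(u, v)\<leftarrow>ys. tensor2 s u v) (\<lambda>u v. g (f u v))" by simp
  then have "(\<Sum>(u, v)\<leftarrow>xs. g (f u v)) = (\<Sum>(u, v)\<leftarrow>ys. g (f u v))"
    using B by (simp add: sum_list_fun_apply tensor2_def case_prod_unfold)
  moreover have "g ?d = g (\<Sum>(u, v)\<leftarrow>xs. f u v) - g (\<Sum>(u, v)\<leftarrow>ys. f u v)"
    using g(1) by (intro module_hom.diff [of sw "(*)"]) (simp add: Vector_Spaces.linear_def)
  ultimately have "g ?d = 0"
    by (simp add: linear_sum_list [OF g(1)] case_prod_unfold)
  with g(2) show False by simp
qed

lemma tensor3_sum_cong:
  fixes sw :: "'k::field \<Rightarrow> 'w::ab_group_add \<Rightarrow> 'w"
  assumes f: "trilin (kscale s) (kscale s) (kscale s) sw f"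
    and eq: "(\<Sum>(u, v, w)\<leftarrow>xs. tensor3 s u v w) = (\<Sum>(u, v, w)\<leftarrow>ys. tensor3 s u v w)"
  shows "(\<Sum>(u, v, w)\<leftarrow>xs. f u v w) = (\<Sum>(u, v, w)\<leftarrow>ys. f u v w)"
proof (rule ccontr)
  let ?d = "(\<Sum>(u, v, w)\<leftarrow>xs. f u v w) - (\<Sum>(u, v, w)\<leftarrow>ys. f u v w)"
  assume "\<not> ?thesis"
  then have "?d \<noteq> 0" by simp
  moreover have "vector_space sw"
    using f by (auto simp: trilin_def linear_iff_add_scale)
  ultimately obtain g :: "'w \<Rightarrow> 'k" where g: "Vector_Spaces.linear sw (*) g" "g ?d = 1"
    using ex_separating_functional by blast
  have B: "trilin (kscale s) (kscale s) (kscale s) (*) (\<lambda>u v w. g (f u v w))"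
    using f g(1) by (auto simp: trilin_def linear_iff_add_scale)
  from eq have "(\<Sum>(u, v, w)\<leftarrow>xs. tensor3 s u v w) (\<lambda>u v w. g (f u v w))
    = (\<Sum>(u, v, w)\<leftarrow>ys. tensor3 s u v w) (\<lambda>u v w. g (f u v w))" by simp
  then have "(\<Sum>(u, v, w)\<leftarrow>xs. g (f u v w)) = (\<Sum>(u, v, w)\<leftarrow>ys. g (f u v w))"
    using B by (simp add: sum_list_fun_apply tensor3_def case_prod_unfold)
  moreover have "g ?d = g (\<Sum>(u, v, w)\<leftarrow>xs. f u v w) - g (\<Sum>(u, v, w)\<leftarrow>ys. f u v w)"
    using g(1) by (intro module_hom.diff [of sw "(*)"]) (simp add: Vector_Spaces.linear_def)
  ultimately have "g ?d = 0"
    by (simp add: linear_sum_list [OF g(1)] case_prod_unfold)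
  with g(2) show False by simp
qed

lemma tlift2_sum:
  assumes "bilin (kscale s) (kscale s) sw f"
  shows "tlift2 s f (\<Sum>(u, v)\<leftarrow>xs. tensor2 s u v) = (\<Sum>(u, v)\<leftarrow>xs. f u v)"
  unfolding tlift2_def
  by (rule someI2 [where a = xs]) (auto intro: tensor2_sum_cong [OF assms, symmetric])

lemma tlift3_sum:
  assumes "trilin (kscale s) (kscale s) (kscale s) sw f"
  shows "tlift3 s f (\<Sum>(u, v, w)\<leftarrow>xs. tensor3 s u v w) = (\<Sum>(u, v, w)\<leftarrow>xs. f u v w)"
  unfolding tlift3_def
  by (rule someI2 [where a = xs]) (auto intro: tensor3_sum_cong [OF assms, symmetric])

theorem tensor2_universal:
  fixes f :: "'p::ab_group_add \<Rightarrow> 'p \<Rightarrow> 'w::ab_group_add"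
  assumes f: "bilin (kscale s) (kscale s) sw f"
  shows "tlift2 s f (tensor2 s u v) = f u v"
    and "\<lbrakk>t \<in> tensor_space2 s; t' \<in> tensor_space2 s\<rbrakk> \<Longrightarrow>
           tlift2 s f (t + t') = tlift2 s f t + tlift2 s f t'"
    and "\<lbrakk>module s; t \<in> tensor_space2 s\<rbrakk> \<Longrightarrow>
           tscale c t \<in> tensor_space2 s \<and> tlift2 s f (tscale c t) = sw c (tlift2 s f t)"
    and "\<lbrakk>\<And>u v. g (tensor2 s u v) = f u v;
          \<And>t t'. \<lbrakk>t \<in> tensor_space2 s; t' \<in> tensor_space2 s\<rbrakk> \<Longrightarrow> g (t + t') = g t + g t';
          t \<in> tensor_space2 s\<rbrakk> \<Longrightarrow> g t = tlift2 s f t"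
proof -
  show "tlift2 s f (tensor2 s u v) = f u v"
    using tlift2_sum [OF f, of "[(u, v)]"] by simp
next
  assume "t \<in> tensor_space2 s" "t' \<in> tensor_space2 s"
  then obtain xs ys where "t = (\<Sum>(u, v)\<leftarrow>xs. tensor2 s u v)" "t' = (\<Sum>(u, v)\<leftarrow>ys. tensor2 s u v)"
    unfolding tensor_space2_def by auto
  then show "tlift2 s f (t + t') = tlift2 s f t + tlift2 s f t'"
    using tlift2_sum [OF f, of "xs @ ys"] tlift2_sum [OF f, of xs] tlift2_sum [OF f, of ys]
    by simp
next
  assume s: "module s" and "t \<in> tensor_space2 s"
  then obtain xs where t: "t = (\<Sum>(u, v)\<leftarrow>xs. tensor2 s u v)"
    unfolding tensor_space2_def by auto
  have ten: "tensor2 s (kscale s c u) v = tscale c (tensor2 s u v)" for u v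
    using bilin_tensor2 [OF s] by (simp add: bilin_def linear_iff_add_scale)
  have fsc: "f (kscale s c u) v = sw c (f u v)" for u v
    using f by (simp add: bilin_def linear_iff_add_scale)
  interpret vector_space sw
    using f by (simp add: bilin_def linear_iff_add_scale)
  let ?ys = "map (\<lambda>(u, v). (kscale s c u, v)) xs"
  have eq: "tscale c t = (\<Sum>(u, v)\<leftarrow>?ys. tensor2 s u v)"
    unfolding t by (induction xs) (auto simp: ten tscale_def fun_eq_iff algebra_simps)
  have "(\<Sum>(u, v)\<leftarrow>?ys. f u v) = sw c (\<Sum>(u, v)\<leftarrow>xs. f u v)"
    by (induction xs) (auto simp: fsc scale_right_distrib)
  then have "tlift2 s f (tscale c t) = sw c (tlift2 s f t)"
    unfolding eq tlift2_sum [OF f] by (simp only: t tlift2_sum [OF f])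
  moreover have "tscale c t \<in> tensor_space2 s"
    unfolding eq tensor_space2_def by blast
  ultimately show "tscale c t \<in> tensor_space2 s \<and> tlift2 s f (tscale c t) = sw c (tlift2 s f t)" by blast
next
  assume g: "\<And>u v. g (tensor2 s u v) = f u v"
    and add: "\<And>t t'. \<lbrakk>t \<in> tensor_space2 s; t' \<in> tensor_space2 s\<rbrakk> \<Longrightarrow> g (t + t') = g t + g t'"
    and "t \<in> tensor_space2 s"
  then obtain xs where t: "t = (\<Sum>(u, v)\<leftarrow>xs. tensor2 s u v)"
    unfolding tensor_space2_def by auto
  have mem: "(\<Sum>(u, v)\<leftarrow>zs. tensor2 s u v) \<in> tensor_space2 s" for zs
    unfolding tensor_space2_def by blast
  have mem1: "tensor2 s u v \<in> tensor_space2 s" for u v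
    using mem [of "[(u, v)]"] by simp
  have "0 \<in> tensor_space2 s"
    using mem [of "[]"] by simp
  then have "g 0 = 0"
    using add [of 0 0] by simp
  then have "g (\<Sum>(u, v)\<leftarrow>zs. tensor2 s u v) = (\<Sum>(u, v)\<leftarrow>zs. f u v)" for zs
    by (induction zs) (auto simp: g add mem mem1)
  then show "g t = tlift2 s f t"
    by (simp add: t tlift2_sum [OF f])
qed

theorem tensor3_universal:
  fixes f :: "'p::ab_group_add \<Rightarrow> 'p \<Rightarrow> 'p \<Rightarrow> 'w::ab_group_add"
  assumes f: "trilin (kscale s) (kscale s) (kscale s) sw f"
  shows "tlift3 s f (tensor3 s u v w) = f u v w"
    and "\<lbrakk>t \<in> tensor_space3 s; t' \<in> tensor_space3 s\<rbrakk> \<Longrightarrow>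
           tlift3 s f (t + t') = tlift3 s f t + tlift3 s f t'"
    and "\<lbrakk>module s; t \<in> tensor_space3 s\<rbrakk> \<Longrightarrow>
           tscale c t \<in> tensor_space3 s \<and> tlift3 s f (tscale c t) = sw c (tlift3 s f t)"
    and "\<lbrakk>\<And>u v w. g (tensor3 s u v w) = f u v w;
          \<And>t t'. \<lbrakk>t \<in> tensor_space3 s; t' \<in> tensor_space3 s\<rbrakk> \<Longrightarrow> g (t + t') = g t + g t';
          t \<in> tensor_space3 s\<rbrakk> \<Longrightarrow> g t = tlift3 s f t"
proof -
  show "tlift3 s f (tensor3 s u v w) = f u v w"
    using tlift3_sum [OF f, of "[(u, v, w)]"] by simp
next
  assume "t \<in> tensor_space3 s" "t' \<in> tensor_space3 s"
  then obtain xs ys where "t = (\<Sum>(u, v, w)\<leftarrow>xs. tensor3 s u v w)"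
      "t' = (\<Sum>(u, v, w)\<leftarrow>ys. tensor3 s u v w)"
    unfolding tensor_space3_def by auto
  then show "tlift3 s f (t + t') = tlift3 s f t + tlift3 s f t'"
    using tlift3_sum [OF f, of "xs @ ys"] tlift3_sum [OF f, of xs] tlift3_sum [OF f, of ys]
    by simp
next
  assume s: "module s" and "t \<in> tensor_space3 s"
  then obtain xs where t: "t = (\<Sum>(u, v, w)\<leftarrow>xs. tensor3 s u v w)"
    unfolding tensor_space3_def by auto
  have ten: "tensor3 s (kscale s c u) v w = tscale c (tensor3 s u v w)" for u v w
    using trilin_tensor3 [OF s] by (simp add: trilin_def linear_iff_add_scale)
  have fsc: "f (kscale s c u) v w = sw c (f u v w)" for u v w
    using f by (simp add: trilin_def linear_iff_add_scale)
  interpret vector_space sw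
    using f by (simp add: trilin_def linear_iff_add_scale)
  let ?ys = "map (\<lambda>(u, v, w). (kscale s c u, v, w)) xs"
  have eq: "tscale c t = (\<Sum>(u, v, w)\<leftarrow>?ys. tensor3 s u v w)"
    unfolding t by (induction xs) (auto simp: ten tscale_def fun_eq_iff algebra_simps)
  have "(\<Sum>(u, v, w)\<leftarrow>?ys. f u v w) = sw c (\<Sum>(u, v, w)\<leftarrow>xs. f u v w)"
    by (induction xs) (auto simp: fsc scale_right_distrib)
  then have "tlift3 s f (tscale c t) = sw c (tlift3 s f t)"
    unfolding eq tlift3_sum [OF f] by (simp only: t tlift3_sum [OF f])
  moreover have "tscale c t \<in> tensor_space3 s"
    unfolding eq tensor_space3_def by blast
  ultimately show "tscale c t \<in> tensor_space3 s \<and> tlift3 s f (tscale c t) = sw c (tlift3 s f t)" by blast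
next
  assume g: "\<And>u v w. g (tensor3 s u v w) = f u v w"
    and add: "\<And>t t'. \<lbrakk>t \<in> tensor_space3 s; t' \<in> tensor_space3 s\<rbrakk> \<Longrightarrow> g (t + t') = g t + g t'"
    and "t \<in> tensor_space3 s"
  then obtain xs where t: "t = (\<Sum>(u, v, w)\<leftarrow>xs. tensor3 s u v w)"
    unfolding tensor_space3_def by auto
  have mem: "(\<Sum>(u, v, w)\<leftarrow>zs. tensor3 s u v w) \<in> tensor_space3 s" for zs
    unfolding tensor_space3_def by blast
  have mem1: "tensor3 s u v w \<in> tensor_space3 s" for u v w
    using mem [of "[(u, v, w)]"] by simp
  have "0 \<in> tensor_space3 s"
    using mem [of "[]"] by simp
  then have "g 0 = 0"
    using add [of 0 0] by simp
  then have "g (\<Sum>(u, v, w)\<leftarrow>zs. tensor3 s u v w) = (\<Sum>(u, v, w)\<leftarrow>zs. f u v w)" for zs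
    by (induction zs) (auto simp: g add mem mem1)
  then show "g t = tlift3 s f t"
    by (simp add: t tlift3_sum [OF f])
qed


subsection \<open>Operators on tensor powers\<close>

definition swap2 ::
  "('k::field poly \<Rightarrow> 'p::ab_group_add \<Rightarrow> 'p) \<Rightarrow> ('k, 'p) tens2 \<Rightarrow> ('k, 'p) tens2"
  where "swap2 s = tlift2 s (\<lambda>u v. tensor2 s v u)"

definition swap12 ::
  "('k::field poly \<Rightarrow> 'p::ab_group_add \<Rightarrow> 'p) \<Rightarrow> ('k, 'p) tens3 \<Rightarrow> ('k, 'p) tens3"
  where "swap12 s = tlift3 s (\<lambda>u v w. tensor3 s v u w)"

definition der_tens2 ::
  "('k::field poly \<Rightarrow> 'p::ab_group_add \<Rightarrow> 'p) \<Rightarrow> ('k, 'p) tens2 \<Rightarrow> ('k, 'p) tens2"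
  where "der_tens2 s = tlift2 s (\<lambda>u v. tensor2 s (der s u) v + tensor2 s u (der s v))"

text \<open>\<open>\<partial>\<close> acting on a single factor of \<open>P \<otimes> P \<otimes> P\<close>, e.g. \<open>der3_2 s\<close> is \<open>I \<otimes> \<partial> \<otimes> I\<close>.\<close>

definition der3_1 ::
  "('k::field poly \<Rightarrow> 'p::ab_group_add \<Rightarrow> 'p) \<Rightarrow> ('k, 'p) tens3 \<Rightarrow> ('k, 'p) tens3"
  where "der3_1 s = tlift3 s (\<lambda>u v w. tensor3 s (der s u) v w)"

definition der3_2 ::
  "('k::field poly \<Rightarrow> 'p::ab_group_add \<Rightarrow> 'p) \<Rightarrow> ('k, 'p) tens3 \<Rightarrow> ('k, 'p) tens3"
  where "der3_2 s = tlift3 s (\<lambda>u v w. tensor3 s u (der s v) w)"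

definition der3_3 ::
  "('k::field poly \<Rightarrow> 'p::ab_group_add \<Rightarrow> 'p) \<Rightarrow> ('k, 'p) tens3 \<Rightarrow> ('k, 'p) tens3"
  where "der3_3 s = tlift3 s (\<lambda>u v w. tensor3 s u v (der s w))"

definition der_tens3 ::
  "('k::field poly \<Rightarrow> 'p::ab_group_add \<Rightarrow> 'p) \<Rightarrow> ('k, 'p) tens3 \<Rightarrow> ('k, 'p) tens3"
  where "der_tens3 s t = der3_1 s t + der3_2 s t + der3_3 s t"

text \<open>
  For a map \<open>f : P \<rightarrow> P \<otimes> P\<close>, the maps \<open>f \<otimes> I\<close> and \<open>I \<otimes> f\<close> from \<open>P \<otimes> P\<close> to \<open>P \<otimes> P \<otimes> P\<close>.
\<close>

definition cop_left ::
  "('k::field poly \<Rightarrow> 'p::ab_group_add \<Rightarrow> 'p) \<Rightarrow> ('p \<Rightarrow> ('k, 'p) tens2)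
   \<Rightarrow> ('k, 'p) tens2 \<Rightarrow> ('k, 'p) tens3"
  where "cop_left s f = tlift2 s (\<lambda>u v. tlift2 s (\<lambda>x y. tensor3 s x y v) (f u))"

definition cop_right ::
  "('k::field poly \<Rightarrow> 'p::ab_group_add \<Rightarrow> 'p) \<Rightarrow> ('p \<Rightarrow> ('k, 'p) tens2)
   \<Rightarrow> ('k, 'p) tens2 \<Rightarrow> ('k, 'p) tens3"
  where "cop_right s f = tlift2 s (\<lambda>u v. tlift2 s (\<lambda>x y. tensor3 s u x y) (f v))"

text \<open>
  For a map \<open>T\<^sub>\<lambda> : P \<rightarrow> P[\<lambda>]\<close>, the maps \<open>T\<^sub>\<lambda> \<otimes> I\<close> and \<open>I \<otimes> T\<^sub>\<lambda>\<close> from \<open>P \<otimes> P\<close> to \<open>(P \<otimes> P)[\<lambda>]\<close>.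
\<close>

definition lam_left ::
  "('k::field poly \<Rightarrow> 'p::ab_group_add \<Rightarrow> 'p) \<Rightarrow> ('p \<Rightarrow> 'p poly)
   \<Rightarrow> ('k, 'p) tens2 \<Rightarrow> ('k, 'p) tens2 poly"
  where "lam_left s T = tlift2 s (\<lambda>u v. map_poly (\<lambda>x. tensor2 s x v) (T u))"

definition lam_right ::
  "('k::field poly \<Rightarrow> 'p::ab_group_add \<Rightarrow> 'p) \<Rightarrow> ('p \<Rightarrow> 'p poly)
   \<Rightarrow> ('k, 'p) tens2 \<Rightarrow> ('k, 'p) tens2 poly"
  where "lam_right s T = tlift2 s (\<lambda>u v. map_poly (\<lambda>x. tensor2 s u x) (T v))"


section \<open>Conformal coalgebras and bialgebras\<close>

locale conformal_coproduct = fg_diff_module s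
  for s :: "'k::field_char_0 poly \<Rightarrow> 'p::ab_group_add \<Rightarrow> 'p"
  and f :: "'p \<Rightarrow> ('k, 'p) tens2" +
  assumes cop_in_tensor_space: "f a \<in> tensor_space2 s"
    and cop_linear: "Vector_Spaces.linear (kscale s) tscale f"
    and cop_der: "f (der s a) = der_tens2 s (f a)"

locale cocomm_coassoc_conformal_coalgebra = conformal_coproduct s \<Delta>
  for s :: "'k::field_char_0 poly \<Rightarrow> 'p::ab_group_add \<Rightarrow> 'p"
  and \<Delta> :: "'p \<Rightarrow> ('k, 'p) tens2" +
  assumes coassoc: "cop_right s \<Delta> (\<Delta> a) = cop_left s \<Delta> (\<Delta> a)"
    and cocommute: "\<Delta> a = swap2 s (\<Delta> a)"

locale lie_conformal_coalgebra = conformal_coproduct s \<delta>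
  for s :: "'k::field_char_0 poly \<Rightarrow> 'p::ab_group_add \<Rightarrow> 'p"
  and \<delta> :: "'p \<Rightarrow> ('k, 'p) tens2" +
  assumes coskew: "\<delta> a = - swap2 s (\<delta> a)"
    and cojacobi: "cop_right s \<delta> (\<delta> a) - swap12 s (cop_right s \<delta> (\<delta> a)) = cop_left s \<delta> (\<delta> a)"

locale poisson_conformal_coalgebra =
  lie_conformal_coalgebra s \<delta> + cocomm_coassoc_conformal_coalgebra s \<Delta>
  for s :: "'k::field_char_0 poly \<Rightarrow> 'p::ab_group_add \<Rightarrow> 'p"
  and \<delta> \<Delta> :: "'p \<Rightarrow> ('k, 'p) tens2" +
  assumes coleibniz:
    "cop_right s \<Delta> (\<delta> a) = cop_left s \<delta> (\<Delta> a) + swap12 s (cop_right s \<delta> (\<Delta> a))"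

text \<open>
  The four compatibility conditions are identities in \<open>(P \<otimes> P)[\<lambda>]\<close>; a map of \<open>P\<close> is applied
  to an element of \<open>P[\<lambda>]\<close> coefficientwise.
\<close>

locale poisson_conformal_bialgebra =
  poisson_conformal_algebra s br mul + poisson_conformal_coalgebra s \<delta> \<Delta>
  for s :: "'k::field_char_0 poly \<Rightarrow> 'p::ab_group_add \<Rightarrow> 'p"
  and br mul :: "'p \<Rightarrow> 'p \<Rightarrow> 'p poly"
  and \<delta> \<Delta> :: "'p \<Rightarrow> ('k, 'p) tens2" +
  assumes cobracket_bracket:
    "map_poly \<delta> (br a b) =
       (lam_left s (br a) (\<delta> b) + lam_right s (br a) (\<delta> b))
       - (psubst_skew (der_tens2 s) (lam_left s (br b) (\<delta> a))
          + psubst_skew (der_tens2 s) (lam_right s (br b) (\<delta> a)))"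
    and coproduct_product:
    "map_poly \<Delta> (mul a b) =
       lam_right s (mul a) (\<Delta> b)
       + psubst_skew (der_tens2 s) (lam_left s (mul b) (\<Delta> a))"
    and cobracket_product:
    "map_poly \<delta> (mul a b) =
       lam_left s (mul a) (\<delta> b)
       + psubst_skew (der_tens2 s) (lam_left s (mul b) (\<delta> a))
       + lam_right s (br a) (\<Delta> b)
       + psubst_skew (der_tens2 s) (lam_right s (br b) (\<Delta> a))"
    and coproduct_bracket:
    "map_poly \<Delta> (br a b) =
       (lam_left s (br a) (\<Delta> b) + lam_right s (br a) (\<Delta> b))
       - psubst_skew (der_tens2 s) (lam_right s (mul b) (\<delta> a))
       + psubst_skew (der_tens2 s) (lam_left s (mul b) (\<delta> a))"


section \<open>Coboundary coproducts and the Yang-Baxter expressions\<close>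

definition coboundary_cobracket ::
  "('k::field poly \<Rightarrow> 'p::ab_group_add \<Rightarrow> 'p) \<Rightarrow> ('p \<Rightarrow> 'p \<Rightarrow> 'p poly) \<Rightarrow> ('k, 'p) tens2
   \<Rightarrow> 'p \<Rightarrow> ('k, 'p) tens2"
  where "coboundary_cobracket s br r a =
    psubst (\<lambda>t. - der_tens2 s t) (lam_left s (br a) r + lam_right s (br a) r)"

definition coboundary_coproduct ::
  "('k::field poly \<Rightarrow> 'p::ab_group_add \<Rightarrow> 'p) \<Rightarrow> ('p \<Rightarrow> 'p \<Rightarrow> 'p poly) \<Rightarrow> ('k, 'p) tens2
   \<Rightarrow> 'p \<Rightarrow> ('k, 'p) tens2"
  where "coboundary_coproduct s mul r a =
    psubst (\<lambda>t. - der_tens2 s t) (lam_right s (mul a) r - lam_left s (mul a) r)"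

text \<open>
  Below \<open>r = \<Sum>\<^sub>i r\<^sub>i \<otimes> l\<^sub>i\<close>; the outer \<open>tlift2\<close> is the sum over \<open>i\<close>, the inner one the sum over \<open>j\<close>.
\<close>

definition conformal_cybe ::
  "('k::field poly \<Rightarrow> 'p::ab_group_add \<Rightarrow> 'p) \<Rightarrow> ('p \<Rightarrow> 'p \<Rightarrow> 'p poly) \<Rightarrow> ('k, 'p) tens2
   \<Rightarrow> ('k, 'p) tens3"
  where "conformal_cybe s br r =
    tlift2 s (\<lambda>ri li. tlift2 s (\<lambda>rj lj.
        psubst (der3_2 s) (map_poly (\<lambda>x. tensor3 s x li lj) (br ri rj))
      - psubst (der3_3 s) (map_poly (\<lambda>x. tensor3 s ri x lj) (br rj li))
      - psubst (der3_2 s) (map_poly (\<lambda>x. tensor3 s ri rj x) (br lj li))) r) r"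

definition conformal_aybe ::
  "('k::field poly \<Rightarrow> 'p::ab_group_add \<Rightarrow> 'p) \<Rightarrow> ('p \<Rightarrow> 'p \<Rightarrow> 'p poly) \<Rightarrow> ('k, 'p) tens2
   \<Rightarrow> ('k, 'p) tens3"
  where "conformal_aybe s mul r =
    tlift2 s (\<lambda>ri li. tlift2 s (\<lambda>rj lj.
        psubst (der3_1 s) (map_poly (\<lambda>x. tensor3 s ri rj x) (mul li lj))
      - psubst (\<lambda>t. - (der3_1 s t + der3_2 s t)) (map_poly (\<lambda>x. tensor3 s ri x lj) (mul rj li))
      + psubst (der3_2 s) (map_poly (\<lambda>x. tensor3 s x li lj) (mul ri rj))) r) r"

end

theory Submission
  imports Defs
begin

text \<open>
  Call the value of \<open>\<partial>\<close> on a tensor factor the weight of that factor.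
  Sesquilinearity says that the parameter of \<open>a\<^sub>\<lambda> b\<close> is minus the
  weight of \<open>a\<close> and that the weights of \<open>a\<close> and \<open>b\<close> add
  up to the weight of the product. In all expressions that occur here the weights of the output
  factors determine every parameter: for instance \<open>\<lambda> = -\<partial>\<close> (total
  derivative) in \<open>\<delta>(a)\<close> gives \<open>r\<close> the total weight
  \<open>0\<close>, so that its two legs have opposite weights. Once the derivations of the
  tensor factors are treated as commuting scalars, every identity of the conformal products
  therefore becomes the corresponding identity of an ordinary Poisson algebra, and the classical
  computation for coboundary Poisson bialgebras applies.

  This is made precise by evaluation. A map \<open>F\<close> from \<open>P\<close> to a module
  over a commutative ring is a slot of weight \<open>d\<close> if it turns
  \<open>\<partial>\<close> into multiplication by \<open>d\<close>; a typical one is \<open>u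
  \<mapsto> u \<otimes> v\<close>. Pushing \<open>a\<^sub>\<lambda> b\<close> forward along
  \<open>F\<close> and putting \<open>\<lambda> = \<alpha>\<close> gives \<open>brk \<alpha> F a
  b\<close> for the bracket and \<open>prd \<alpha> F a b\<close> for the product.
  Skew-symmetry, Jacobi, associativity and Leibniz become identities between such expressions,
  with ring elements as parameters (\<open>brk_skew\<close>, \<open>brk_jacobi\<close>,
  \<open>prd_assoc\<close>, \<open>brk_leibniz\<close>).

  With \<open>r = \<Sum> x\<^sub>i \<otimes> y\<^sub>i\<close> the coproducts are
  \<open>\<delta>(a) = [a, x\<^sub>i] \<otimes> y\<^sub>i + x\<^sub>i \<otimes> [a,
  y\<^sub>i]\<close> and \<open>\<Delta>(a) = x\<^sub>i \<otimes> a y\<^sub>i - a x\<^sub>i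
  \<otimes> y\<^sub>i\<close>. The four compatibility conditions hold for every single
  \<open>x\<^sub>i \<otimes> y\<^sub>i\<close>, directly by Jacobi, associativity and Leibniz
  (\<open>cobracket_bracket_at\<close> and the three lemmas after it). Skew-symmetry of
  \<open>r\<close> makes \<open>\<delta>\<close> skew-symmetric and \<open>\<Delta>\<close>
  cocommutative. The three remaining coalgebra identities have defects that are obtained by
  letting \<open>a\<close> act on the Yang-Baxter expressions: \<open>a \<cdot> [[r,r]]\<close>
  (the action in all three factors) for co-Jacobi (\<open>cobracket_r_jacobi\<close>), \<open>(I
  \<otimes> I \<otimes> L(a) - L(a) \<otimes> I \<otimes> I)(r \<bullet> r)\<close> for
  coassociativity (\<open>coproduct_r_coassoc\<close>), and \<open>(ad(a) \<otimes> I \<otimes>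
  I)(r \<bullet> r) + (I \<otimes> I \<otimes> L(a) - I \<otimes> L(a) \<otimes>
  I)[[r,r]]\<close> for co-Leibniz (\<open>cobracket_r_coleibniz\<close>). In each of them
  \<open>a\<close> acts with parameter \<open>-\<partial>\<close>, the total derivative of
  \<open>P \<otimes> P \<otimes> P\<close>, and such an action annihilates the image of the
  total derivative. Hence it suffices that the Yang-Baxter expressions vanish modulo that image.

  These identities are transported to \<open>P \<otimes> P\<close>, \<open>(P \<otimes>
  P)[\<lambda>]\<close> and \<open>P \<otimes> P \<otimes> P\<close>, which become modules over
  \<open>k[X1, X2, X3]\<close>, the variables acting as the derivations of the factors and,
  where present, as \<open>\<lambda>\<close>. The bridge is that any map out of a tensor power
  induced by slots evaluates a coboundary coproduct to the formula above
  (\<open>represents_cobracket\<close>, \<open>represents_coproduct\<close>).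
\<close>


section \<open>Evaluation of polynomials with coefficients in a module\<close>

text \<open>
  The coefficients are first mapped from \<open>W\<close> into a module over a commutative ring,
  and then the parameter becomes an element of that ring. Substituting ring elements instead of
  operators makes their commutation automatic.
\<close>

definition ev ::
  "('r::comm_ring_1 \<Rightarrow> 'm::ab_group_add \<Rightarrow> 'm) \<Rightarrow> 'r \<Rightarrow> ('w::zero \<Rightarrow> 'm) \<Rightarrow> 'w poly \<Rightarrow> 'm"
  where "ev scl \<alpha> F p = (\<Sum>k\<le>degree p. scl (\<alpha> ^ k) (F (coeff p k)))"

context module
begin

lemma ev_bound:
  assumes "F 0 = 0" and "degree p \<le> N"
  shows "ev scale \<alpha> F p = (\<Sum>k\<le>N. scale (\<alpha> ^ k) (F (coeff p k)))"
  unfolding ev_def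
  by (rule sum.mono_neutral_left) (use assms in \<open>auto simp: coeff_eq_0\<close>)

lemma ev_0 [simp]: "F 0 = 0 \<Longrightarrow> ev scale \<alpha> F 0 = 0"
  by (simp add: ev_def)

lemma ev_const [simp]: "ev scale \<alpha> F [:x:] = F x"
  by (simp add: ev_def)

lemma ev_pCons_0:
  assumes "F 0 = 0"
  shows "ev scale \<alpha> F (pCons 0 p) = scale \<alpha> (ev scale \<alpha> F p)"
proof -
  have "ev scale \<alpha> F (pCons 0 p) = (\<Sum>k\<le>Suc (degree p). scale (\<alpha> ^ k) (F (coeff (pCons 0 p) k)))"
    using assms by (intro ev_bound) (auto simp: degree_pCons_le)
  also have "\<dots> = (\<Sum>k\<le>degree p. scale (\<alpha> ^ Suc k) (F (coeff p k)))"
    by (subst sum.atMost_Suc_shift) (simp add: assms)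
  also have "\<dots> = scale \<alpha> (ev scale \<alpha> F p)"
    by (simp add: ev_def scale_sum_right)
  finally show ?thesis .
qed

lemma ev_map_poly:
  assumes "H 0 = 0" and "G 0 = 0"
  shows "ev scale \<alpha> G (map_poly H p) = ev scale \<alpha> (\<lambda>x. G (H x)) p"
proof -
  have "ev scale \<alpha> G (map_poly H p) = (\<Sum>k\<le>degree p. scale (\<alpha> ^ k) (G (coeff (map_poly H p) k)))"
    using assms by (intro ev_bound) (auto simp: map_poly_degree_leq)
  then show ?thesis
    by (simp add: ev_def coeff_map_poly assms(1))
qed

lemma ev_cong:
  assumes "\<And>k. F (coeff p k) = G (coeff p k)"
  shows "ev scale \<alpha> F p = ev scale \<alpha> G p"
  by (simp add: ev_def assms)

lemma ev_add_on:
  assumes "F 0 = 0"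
    and "\<And>k. F (coeff p k + coeff q k) = F (coeff p k) + F (coeff q k)"
  shows "ev scale \<alpha> F (p + q) = ev scale \<alpha> F p + ev scale \<alpha> F q"
proof -
  let ?N = "max (degree p) (degree q)"
  have "ev scale \<alpha> F (p + q) = (\<Sum>k\<le>?N. scale (\<alpha> ^ k) (F (coeff (p + q) k)))"
    using assms by (intro ev_bound) (auto simp: degree_add_le)
  also have "\<dots> = (\<Sum>k\<le>?N. scale (\<alpha> ^ k) (F (coeff p k))) + (\<Sum>k\<le>?N. scale (\<alpha> ^ k) (F (coeff q k)))"
    by (simp add: assms scale_right_distrib sum.distrib)
  also have "\<dots> = ev scale \<alpha> F p + ev scale \<alpha> F q"
    using assms(1) by (simp add: ev_bound [where N = ?N])
  finally show ?thesis .
qed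

lemma additive_ev: "additive F \<Longrightarrow> additive (ev scale \<alpha> F)"
  by unfold_locales (auto intro!: ev_add_on simp: additive.zero additive.add)

lemma ev_fun_add: "ev scale \<alpha> (\<lambda>x. F x + G x) p = ev scale \<alpha> F p + ev scale \<alpha> G p"
  by (simp add: ev_def scale_right_distrib sum.distrib)

lemma ev_fun_minus: "ev scale \<alpha> (\<lambda>x. - F x) p = - ev scale \<alpha> F p"
  by (simp add: ev_def sum_negf)

lemma ev_fun_sum: "ev scale \<alpha> (\<lambda>x. \<Sum>j\<in>J. F j x) p = (\<Sum>j\<in>J. ev scale \<alpha> (F j) p)"
  unfolding ev_def by (simp add: scale_sum_right) (rule sum.swap)

lemma ev_fun_scale: "ev scale \<alpha> (\<lambda>x. scale \<beta> (F x)) p = scale \<beta> (ev scale \<alpha> F p)"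
  by (simp add: ev_def scale_sum_right mult.commute)

lemma ev_swap:
  "ev scale \<alpha> (\<lambda>x. ev scale \<beta> (\<lambda>y. F x y) q) p = ev scale \<beta> (\<lambda>y. ev scale \<alpha> (\<lambda>x. F x y) p) q"
  unfolding ev_def by (simp add: scale_sum_right mult.commute) (rule sum.swap)

text \<open>
  Substituting an operator \<open>A\<close> for the parameter becomes evaluation at a ring element \<open>\<rho>\<close> after
  applying a map \<open>G\<close> that turns \<open>A\<close> into multiplication by \<open>\<rho>\<close>.  The hypotheses are confined to a
  set \<open>S\<close> because the maps out of tensor powers are additive only on the tensor space.
\<close>

lemma ev_psubst_on:
  assumes S: "0 \<in> S" "\<And>x y. x \<in> S \<Longrightarrow> y \<in> S \<Longrightarrow> x + y \<in> S" "\<And>x. x \<in> S \<Longrightarrow> A x \<in> S"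
    and add: "\<And>x y. x \<in> S \<Longrightarrow> y \<in> S \<Longrightarrow> G (x + y) = G x + G y"
    and A: "\<And>x. x \<in> S \<Longrightarrow> G (A x) = scale \<rho> (G x)"
    and p: "\<And>k. coeff p k \<in> S"
  shows "G (psubst A p) = ev scale \<rho> G p"
proof -
  have G0: "G 0 = 0" using add [OF S(1) S(1)] by simp
  have pow: "(A ^^ k) x \<in> S \<and> G ((A ^^ k) x) = scale (\<rho> ^ k) (G x)" if "x \<in> S" for k x
    using that by (induction k) (auto simp: S A)
  have "(\<Sum>k\<in>K. (A ^^ k) (coeff p k)) \<in> S \<and>
      G (\<Sum>k\<in>K. (A ^^ k) (coeff p k)) = (\<Sum>k\<in>K. scale (\<rho> ^ k) (G (coeff p k)))"
    if "finite K" for K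
    using that by induction (auto simp: S G0 add pow p)
  then show ?thesis by (simp add: psubst_def ev_def)
qed

lemma ev_psubst:
  assumes "additive G" and "\<And>x. G (A x) = scale \<rho> (G x)"
  shows "G (psubst A p) = ev scale \<rho> G p"
  using assms by (intro ev_psubst_on [where S = UNIV]) (auto simp: additive.add)

end

lemma psubst_closed:
  assumes S: "0 \<in> S" "\<And>x y. x \<in> S \<Longrightarrow> y \<in> S \<Longrightarrow> x + y \<in> S" "\<And>x. x \<in> S \<Longrightarrow> A x \<in> S"
    and p: "\<And>k. coeff p k \<in> S"
  shows "psubst A p \<in> S"
proof -
  have pow: "(A ^^ k) x \<in> S" if "x \<in> S" for k x
    using that by (induction k) (auto simp: S)
  have "(\<Sum>k\<in>K. (A ^^ k) (coeff p k)) \<in> S" if "finite K" for K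
    using that by induction (auto simp: S pow p)
  then show ?thesis by (simp add: psubst_def)
qed


section \<open>Evaluation of nested conformal products\<close>

context module
begin

text \<open>
  \<open>W\<close> evaluates the inner variable \<open>\<lambda>\<close> at \<open>\<alpha>\<close> and the outer variable \<open>\<mu>\<close> at \<open>\<beta>\<close>.
\<close>

lemma ev2_mult:
  fixes F :: "'w::ab_group_add \<Rightarrow> 'b" and \<alpha> \<beta> :: 'a
  assumes F: "additive F"
  defines "W \<equiv> ev scale \<beta> (ev scale \<alpha> F)"
  shows "additive W" "W (mult_lam q) = scale \<alpha> (W q)" "W (mult_mu q) = scale \<beta> (W q)"
    "W (mult_lam_mu q) = scale (\<alpha> + \<beta>) (W q)" "W [:[:x:]:] = F x"
proof -
  have F0: "F 0 = 0" by (rule additive.zero [OF F])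
  show W: "additive W" unfolding W_def by (intro additive_ev F)
  show lam: "W (mult_lam q) = scale \<alpha> (W q)"
    unfolding W_def mult_lam_def
    by (subst ev_map_poly) (simp_all add: F0 ev_pCons_0 ev_fun_scale)
  show mu: "W (mult_mu q) = scale \<beta> (W q)"
    unfolding W_def mult_mu_def by (simp add: F0 ev_pCons_0)
  show "W (mult_lam_mu q) = scale (\<alpha> + \<beta>) (W q)"
    by (simp add: mult_lam_mu_def additive.add [OF W] lam mu scale_left_distrib)
  show "W [:[:x:]:] = F x" by (simp add: W_def)
qed

lemma ev2_prod_at:
  fixes F :: "'w::ab_group_add \<Rightarrow> 'b"
  assumes F: "additive F"
    and A: "\<And>q. ev scale \<beta> (ev scale \<alpha> F) (A q) = scale \<rho> (ev scale \<beta> (ev scale \<alpha> F) q)"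
  shows "ev scale \<beta> (ev scale \<alpha> F) (prod_at m A a b) = ev scale \<rho> F (m a b)"
  unfolding prod_at_def
  by (subst ev_psubst [OF ev2_mult(1) [OF F] A])
     (simp add: ev_map_poly additive.zero [OF ev2_mult(1) [OF F]] ev2_mult(5) [OF F])

text \<open>
  The operators \<open>A\<close>, \<open>B\<close> of the two parameters become scalars
  \<open>\<rho>\<close>, \<open>\<sigma>\<close>, so a nested product is evaluated one product
  at a time. All polynomial identities in \<open>P[\<lambda>,\<mu>]\<close> enter through this
  lemma.
\<close>

lemma ev2_nest:
  fixes F :: "'w::ab_group_add \<Rightarrow> 'b"
  assumes F: "additive F" and m: "\<And>c. m c 0 = 0" and m': "\<And>c. m' 0 c = 0"
    and A: "\<And>q. ev scale \<beta> (ev scale \<alpha> F) (A q) = scale \<rho> (ev scale \<beta> (ev scale \<alpha> F) q)"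
    and B: "\<And>q. ev scale \<beta> (ev scale \<alpha> F) (B q) = scale \<sigma> (ev scale \<beta> (ev scale \<alpha> F) q)"
  shows "ev scale \<beta> (ev scale \<alpha> F) (nest_left m A m' B a b c)
      = ev scale \<rho> (\<lambda>x. ev scale \<sigma> F (m' x c)) (m a b)"
    and "ev scale \<beta> (ev scale \<alpha> F) (nest_right m A m' B a b c)
      = ev scale \<sigma> (\<lambda>x. ev scale \<rho> F (m a x)) (m' b c)"
proof -
  note W = ev2_mult(1) [OF F] and F0 = additive.zero [OF F]
  have prod_at_0: "prod_at m C a 0 = 0" "prod_at m' C 0 c = 0" for C
    by (simp_all add: prod_at_def m m' psubst_def)
  show "ev scale \<beta> (ev scale \<alpha> F) (nest_left m A m' B a b c)
      = ev scale \<rho> (\<lambda>x. ev scale \<sigma> F (m' x c)) (m a b)"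
    unfolding nest_left_def
    by (simp add: ev_psubst [where \<rho> = \<rho>, OF W A] ev_map_poly additive.zero [OF W] prod_at_0
        ev2_prod_at [OF F B])
  show "ev scale \<beta> (ev scale \<alpha> F) (nest_right m A m' B a b c)
      = ev scale \<sigma> (\<lambda>x. ev scale \<rho> F (m a x)) (m' b c)"
    unfolding nest_right_def
    by (simp add: ev_psubst [where \<rho> = \<sigma>, OF W B] ev_map_poly additive.zero [OF W] prod_at_0
        ev2_prod_at [OF F A])
qed

lemma ev_psubst_skew:
  fixes F :: "'w::ab_group_add \<Rightarrow> 'b"
  assumes F: "additive F" and D: "D 0 = 0" "\<And>x. F (D x) = scale d (F x)"
  shows "ev scale \<alpha> F (psubst_skew D q) = ev scale (- \<alpha> - d) F q"
proof -
  have F0: "F 0 = 0" by (rule additive.zero [OF F])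
  note W = additive_ev [OF F]
  have "ev scale \<alpha> F (- pCons 0 q - map_poly D q) = scale (- \<alpha> - d) (ev scale \<alpha> F q)" for q
    by (simp add: additive.diff [OF W] additive.minus [OF W] ev_pCons_0 F0 ev_map_poly D ev_fun_scale
        scale_left_diff_distrib)
  then show ?thesis
    unfolding psubst_skew_def
    by (subst ev_psubst [OF W]) (simp_all add: ev_map_poly F0)
qed

end

text \<open>
  The target \<open>M\<close> is a module over a commutative ring which contains the field via
  \<open>\<kappa>\<close>. It will be \<open>P \<otimes> P\<close>, \<open>(P \<otimes>
  P)[\<lambda>]\<close> or \<open>P \<otimes> P \<otimes> P\<close> over a polynomial ring in
  three variables.
\<close>

locale conformal_evaluation =
  fg_diff_module s + M: module scl
  for s :: "'k::field_char_0 poly \<Rightarrow> 'p::ab_group_add \<Rightarrow> 'p"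
  and scl :: "'r::comm_ring_1 \<Rightarrow> 'm::ab_group_add \<Rightarrow> 'm"
  and \<kappa> :: "'k \<Rightarrow> 'r" +
  assumes vector_space_scl: "vector_space (\<lambda>c. scl (\<kappa> c))"
begin

definition k_linear :: "('p \<Rightarrow> 'm) \<Rightarrow> bool"
  where "k_linear F \<longleftrightarrow> Vector_Spaces.linear (kscale s) (\<lambda>c. scl (\<kappa> c)) F"

text \<open>
  For example, \<open>u \<mapsto> u \<otimes> v\<close> is a slot whose weight \<open>d\<close>
  is the derivation of the first factor.
\<close>

definition slot :: "'r \<Rightarrow> ('p \<Rightarrow> 'm) \<Rightarrow> bool"
  where "slot d F \<longleftrightarrow> k_linear F \<and> (\<forall>x. F (der s x) = scl d (F x))"

lemma k_linear_iff: "k_linear F \<longleftrightarrow> (\<forall>x y. F (x + y) = F x + F y) \<and> (\<forall>c x. F (kscale s c x) = scl (\<kappa> c) (F x))"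
  unfolding k_linear_def linear_iff_add_scale
  using vector_space_kscale [OF module_axioms] vector_space_scl by blast

lemma k_linear_additive: "k_linear F \<Longrightarrow> additive F"
  by (simp add: k_linear_iff additive_def)

lemma slot_k_linear [dest]: "slot d F \<Longrightarrow> k_linear F"
  by (simp add: slot_def)

lemma k_linear_sum: "(\<And>j. j \<in> J \<Longrightarrow> k_linear (F j)) \<Longrightarrow> k_linear (\<lambda>x. \<Sum>j\<in>J. F j x)"
  by (simp add: k_linear_iff sum.distrib M.scale_sum_right)

lemma k_linear_add: "k_linear F \<Longrightarrow> k_linear G \<Longrightarrow> k_linear (\<lambda>x. F x + G x)"
  by (simp add: k_linear_iff M.scale_right_distrib)

lemma k_linear_minus: "k_linear F \<Longrightarrow> k_linear (\<lambda>x. - F x)"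
  by (simp add: k_linear_iff)

lemma k_linear_diff: "k_linear F \<Longrightarrow> k_linear G \<Longrightarrow> k_linear (\<lambda>x. F x - G x)"
  by (simp add: k_linear_iff M.scale_right_diff_distrib)

lemma slot_add: "slot d F \<Longrightarrow> slot d G \<Longrightarrow> slot d (\<lambda>x. F x + G x)"
  by (simp add: slot_def k_linear_add M.scale_right_distrib)

lemma slot_minus: "slot d F \<Longrightarrow> slot d (\<lambda>x. - F x)"
  by (simp add: slot_def k_linear_minus)

lemma slot_diff: "slot d F \<Longrightarrow> slot d G \<Longrightarrow> slot d (\<lambda>x. F x - G x)"
  by (simp add: slot_def k_linear_diff M.scale_right_diff_distrib)

lemma slot_sum: "(\<And>j. j \<in> J \<Longrightarrow> slot d (F j)) \<Longrightarrow> slot d (\<lambda>x. \<Sum>j\<in>J. F j x)"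
  by (simp add: slot_def k_linear_sum M.scale_sum_right)

lemma k_linear_ev:
  assumes "\<And>y. k_linear (\<lambda>x. F x y)"
  shows "k_linear (\<lambda>x. ev scl \<alpha> (F x) p)"
  using assms by (simp add: k_linear_iff ev_def M.scale_right_distrib sum.distrib M.scale_sum_right mult.commute)

lemma slot_ev:
  assumes "\<And>y. slot d (\<lambda>x. F x y)"
  shows "slot d (\<lambda>x. ev scl \<alpha> (F x) p)"
  using assms k_linear_ev [of F] by (simp add: slot_def ev_def M.scale_sum_right mult.commute)

end

locale conformal_product_evaluation = conformal_evaluation s scl \<kappa> + conformal_product s m
  for s :: "'k::field_char_0 poly \<Rightarrow> 'p::ab_group_add \<Rightarrow> 'p"
  and scl :: "'r::comm_ring_1 \<Rightarrow> 'm::ab_group_add \<Rightarrow> 'm"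
  and \<kappa> :: "'k \<Rightarrow> 'r"
  and m :: "'p \<Rightarrow> 'p \<Rightarrow> 'p poly"
begin

text \<open>
  If \<open>F\<close> is \<open>p \<mapsto> p \<otimes> v\<close>, this is
  \<open>(a\<^sub>\<lambda> b) \<otimes> v\<close> at \<open>\<lambda> = \<alpha>\<close>.
\<close>

definition eval_prod :: "'r \<Rightarrow> ('p \<Rightarrow> 'm) \<Rightarrow> 'p \<Rightarrow> 'p \<Rightarrow> 'm"
  where "eval_prod \<alpha> F a b = ev scl \<alpha> F (m a b)"

lemma m_add: "m (a + a') b = m a b + m a' b" "m a (b + b') = m a b + m a b'"
  and m_scale: "m (kscale s c a) b = map_poly (kscale s c) (m a b)"
    "m a (kscale s c b) = map_poly (kscale s c) (m a b)"
  using bilinear by (simp_all add: bilin_def linear_iff_add_scale)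

lemma m_0: "m 0 b = 0" "m a 0 = 0"
  using m_add(1) [of 0 0 b] m_add(2) [of a 0 0] by simp_all

lemma kscale_0: "kscale s c 0 = 0" and der_0: "der s 0 = 0"
  by (simp_all add: kscale_def der_def)

lemma eval_prod_add_left: "k_linear F \<Longrightarrow> eval_prod \<alpha> F (a + a') b = eval_prod \<alpha> F a b + eval_prod \<alpha> F a' b"
  and eval_prod_add_right: "k_linear F \<Longrightarrow> eval_prod \<alpha> F a (b + b') = eval_prod \<alpha> F a b + eval_prod \<alpha> F a b'"
  by (simp_all add: eval_prod_def m_add additive.add [OF M.additive_ev [OF k_linear_additive]])

lemma k_linear_eval_prod_left:
  assumes "k_linear F" shows "k_linear (\<lambda>a. eval_prod \<alpha> F a b)"
  using assms additive.zero [OF k_linear_additive [OF assms]] eval_prod_add_left [OF assms]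
  by (simp add: k_linear_iff eval_prod_def m_scale M.ev_map_poly kscale_0 M.ev_fun_scale)

lemma k_linear_eval_prod_right:
  assumes "k_linear F" shows "k_linear (\<lambda>b. eval_prod \<alpha> F a b)"
  using assms additive.zero [OF k_linear_additive [OF assms]] eval_prod_add_right [OF assms]
  by (simp add: k_linear_iff eval_prod_def m_scale M.ev_map_poly kscale_0 M.ev_fun_scale)

text \<open>
  Sesquilinearity as conservation of weight: in a product of weight \<open>d\<close> with
  parameter \<open>\<alpha>\<close>, the left factor has weight \<open>-\<alpha>\<close> and the
  right factor has weight \<open>d + \<alpha>\<close>.
\<close>

lemma slot_eval_prod_left:
  assumes "k_linear F" shows "slot (- \<alpha>) (\<lambda>a. eval_prod \<alpha> F a b)"
  using k_linear_eval_prod_left [OF assms] additive.zero [OF k_linear_additive [OF assms]]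
  by (simp add: slot_def eval_prod_def der_left additive.minus [OF M.additive_ev [OF k_linear_additive [OF assms]]]
      M.ev_pCons_0)

lemma slot_eval_prod_right:
  assumes "slot d F" shows "slot (d + \<alpha>) (\<lambda>b. eval_prod \<alpha> F a b)"
proof -
  have F: "k_linear F" using assms by blast
  show ?thesis
    using k_linear_eval_prod_right [OF F] additive.zero [OF k_linear_additive [OF F]] assms
    by (simp add: slot_def eval_prod_def der_right additive.add [OF M.additive_ev [OF k_linear_additive [OF F]]]
      M.ev_pCons_0 M.ev_map_poly der_0 M.ev_fun_scale M.scale_left_distrib)
qed

lemma k_linear_eval_prod_arg: "(\<And>q. k_linear (\<lambda>x. F x q)) \<Longrightarrow> k_linear (\<lambda>x. eval_prod \<alpha> (F x) a b)"
  unfolding eval_prod_def by (rule k_linear_ev)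

lemma slot_eval_prod_arg: "(\<And>q. slot d (\<lambda>x. F x q)) \<Longrightarrow> slot d (\<lambda>x. eval_prod \<alpha> (F x) a b)"
  unfolding eval_prod_def by (rule slot_ev)

lemma eval_prod_fun_add: "eval_prod \<alpha> (\<lambda>x. F x + G x) a b = eval_prod \<alpha> F a b + eval_prod \<alpha> G a b"
  and eval_prod_fun_minus: "eval_prod \<alpha> (\<lambda>x. - F x) a b = - eval_prod \<alpha> F a b"
  and eval_prod_fun_sum: "eval_prod \<alpha> (\<lambda>x. \<Sum>j\<in>J. f j x) a b = (\<Sum>j\<in>J. eval_prod \<alpha> (f j) a b)"
  by (simp_all add: eval_prod_def M.ev_fun_add M.ev_fun_minus M.ev_fun_sum)

lemma eval_prod_fun_diff: "eval_prod \<alpha> (\<lambda>x. F x - G x) a b = eval_prod \<alpha> F a b - eval_prod \<alpha> G a b"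
  using eval_prod_fun_add [of \<alpha> F "\<lambda>x. - G x"] by (simp add: eval_prod_fun_minus)

end

section \<open>The identities of a Poisson conformal algebra after evaluation\<close>

locale poisson_evaluation =
  poisson_conformal_algebra s br mul + conformal_evaluation s scl \<kappa>
  for s :: "'k::field_char_0 poly \<Rightarrow> 'p::ab_group_add \<Rightarrow> 'p"
  and br mul :: "'p \<Rightarrow> 'p \<Rightarrow> 'p poly"
  and scl :: "'r::comm_ring_1 \<Rightarrow> 'm::ab_group_add \<Rightarrow> 'm"
  and \<kappa> :: "'k \<Rightarrow> 'r"
begin

sublocale B: conformal_product_evaluation s scl \<kappa> br ..
sublocale C: conformal_product_evaluation s scl \<kappa> mul ..

abbreviation "brk \<equiv> B.eval_prod"
abbreviation "prd \<equiv> C.eval_prod"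

lemmas slot_intros = B.slot_eval_prod_left B.slot_eval_prod_right B.slot_eval_prod_arg
  C.slot_eval_prod_left C.slot_eval_prod_right C.slot_eval_prod_arg slot_add slot_diff slot_minus slot_sum
lemmas k_linear_intros = B.k_linear_eval_prod_left B.k_linear_eval_prod_right B.k_linear_eval_prod_arg
  C.k_linear_eval_prod_left C.k_linear_eval_prod_right C.k_linear_eval_prod_arg k_linear_add k_linear_diff k_linear_minus k_linear_sum

lemma brk_skew:
  assumes "slot d F"
  shows "brk \<alpha> F a b = - brk (- \<alpha> - d) F b a"
proof -
  have F: "additive F" "\<And>x. F (der s x) = scl d (F x)"
    using assms by (auto simp: slot_def k_linear_additive)
  show ?thesis
    by (simp add: B.eval_prod_def skew [of a b] additive.minus [OF M.additive_ev [OF F(1)]]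
        M.ev_psubst_skew [OF F(1) B.der_0 F(2)])
qed

lemma prd_commute:
  assumes "slot d F"
  shows "prd \<alpha> F a b = prd (- \<alpha> - d) F b a"
proof -
  have F: "additive F" "\<And>x. F (der s x) = scl d (F x)"
    using assms by (auto simp: slot_def k_linear_additive)
  show ?thesis
    by (simp add: C.eval_prod_def commute [of a b] M.ev_psubst_skew [OF F(1) B.der_0 F(2)])
qed

lemma brk_jacobi:
  assumes "k_linear F"
  shows "brk \<beta> (\<lambda>x. brk \<alpha> F a x) b c
    = brk \<alpha> (\<lambda>p. brk (\<alpha> + \<beta>) F p c) a b + brk \<alpha> (\<lambda>x. brk \<beta> F b x) a c"
proof -
  note F = k_linear_additive [OF assms]
  note W = M.ev2_mult [OF F, of \<beta> \<alpha>]
  show ?thesis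
    using arg_cong [OF jacobi [of a b c], of "ev scl \<beta> (ev scl \<alpha> F)"]
    by (simp add: B.eval_prod_def additive.add [OF W(1)] B.m_0
        M.ev2_nest(1) [OF F _ _ W(2) W(4)] M.ev2_nest(2) [OF F _ _ W(2) W(3)]
        M.ev2_nest(2) [OF F _ _ W(3) W(2)])
qed

lemma prd_assoc:
  assumes "k_linear F"
  shows "prd \<alpha> (\<lambda>p. prd (\<alpha> + \<beta>) F p c) a b = prd \<beta> (\<lambda>x. prd \<alpha> F a x) b c"
proof -
  note F = k_linear_additive [OF assms]
  note W = M.ev2_mult [OF F, of \<beta> \<alpha>]
  show ?thesis
    using arg_cong [OF assoc [of a b c], of "ev scl \<beta> (ev scl \<alpha> F)"]
    by (simp add: C.eval_prod_def C.m_0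
        M.ev2_nest(1) [OF F _ _ W(2) W(4)] M.ev2_nest(2) [OF F _ _ W(2) W(3)])
qed

lemma brk_leibniz:
  assumes "k_linear F"
  shows "prd \<beta> (\<lambda>x. brk \<alpha> F a x) b c
    = brk \<alpha> (\<lambda>p. prd (\<alpha> + \<beta>) F p c) a b + brk \<alpha> (\<lambda>x. prd \<beta> F b x) a c"
proof -
  note F = k_linear_additive [OF assms]
  note W = M.ev2_mult [OF F, of \<beta> \<alpha>]
  show ?thesis
    using arg_cong [OF leibniz [of a b c], of "ev scl \<beta> (ev scl \<alpha> F)"]
    by (simp add: B.eval_prod_def C.eval_prod_def additive.add [OF W(1)] B.m_0 C.m_0
        M.ev2_nest(1) [OF F _ _ W(2) W(4)] M.ev2_nest(2) [OF F _ _ W(2) W(3)]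
        M.ev2_nest(2) [OF F _ _ W(3) W(2)])
qed

lemma brk_brk_swap: "brk \<alpha> (\<lambda>x. brk \<beta> (F x) c d) a b = brk \<beta> (\<lambda>y. brk \<alpha> (\<lambda>x. F x y) a b) c d"
  and brk_prd_swap: "brk \<alpha> (\<lambda>x. prd \<beta> (F x) c d) a b = prd \<beta> (\<lambda>y. brk \<alpha> (\<lambda>x. F x y) a b) c d"
  and prd_prd_swap: "prd \<alpha> (\<lambda>x. prd \<beta> (F x) c d) a b = prd \<beta> (\<lambda>y. prd \<alpha> (\<lambda>x. F x y) a b) c d"
  unfolding B.eval_prod_def C.eval_prod_def by (rule M.ev_swap)+

text \<open>
  The identity \<open>[[a,b],c] = [[a,c],b] + [a,[b,c]]\<close>. The parameters are forced by
  the weights: those of \<open>a\<close>, \<open>b\<close>, \<open>c\<close> are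
  \<open>-\<alpha>\<close>, \<open>\<alpha> - \<gamma>\<close> and \<open>d + \<gamma>\<close>,
  and every parameter is minus the weight of the corresponding left factor. The same weights
  occur in the next three lemmas.
\<close>

lemma brk_jacobi_flip:
  assumes F: "slot d F" and eq: "\<gamma>' = \<alpha> - d - \<gamma>" "\<beta> = \<gamma> - \<alpha>"
  shows "brk \<alpha> (\<lambda>p. brk \<gamma> F p c) a b
    = brk \<alpha> (\<lambda>p. brk \<gamma>' F p b) a c + brk \<beta> (\<lambda>z. brk \<alpha> F a z) b c"
proof -
  have "- \<beta> - d = \<gamma>'" "\<alpha> + \<beta> = \<gamma>" using eq by simp_all
  then show ?thesis
    using brk_jacobi [OF slot_k_linear [OF F], of \<beta> \<alpha> a b c] brk_skew [OF F, of \<beta> b]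
    by (simp add: B.eval_prod_fun_minus)
qed

text \<open>
  The identity \<open>(a b) c = (a c) b\<close>.
\<close>

lemma prd_assoc_flip:
  assumes F: "slot d F" and eq: "\<gamma>' = \<alpha> - d - \<gamma>"
  shows "prd \<alpha> (\<lambda>p. prd \<gamma> F p c) a b = prd \<alpha> (\<lambda>p. prd \<gamma>' F p b) a c"
proof -
  have K: "k_linear F" using F by blast
  have s: "slot (d + \<alpha>) (\<lambda>x. prd \<alpha> F a x)" by (intro slot_intros F)
  have "prd \<alpha> (\<lambda>p. prd \<gamma> F p c) a b = prd (\<gamma> - \<alpha>) (\<lambda>x. prd \<alpha> F a x) b c"
    using prd_assoc [OF K, of \<alpha> "\<gamma> - \<alpha>" c a b] by simp
  also have "\<dots> = prd (\<gamma>' - \<alpha>) (\<lambda>x. prd \<alpha> F a x) c b"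
    by (subst prd_commute [OF s]) (simp add: eq algebra_simps)
  also have "\<dots> = prd \<alpha> (\<lambda>p. prd \<gamma>' F p b) a c"
    using prd_assoc [OF K, of \<alpha> "\<gamma>' - \<alpha>" b a c] by simp
  finally show ?thesis .
qed

text \<open>
  The identity \<open>[a b, c] = a [b,c] + [a,c] b\<close>, obtained from the Leibniz rule by
  turning both brackets.
\<close>

lemma brk_product_left:
  assumes F: "slot d F" and eq: "\<gamma>' = \<alpha> - d - \<gamma>" "\<beta> = \<gamma> - \<alpha>"
  shows "prd \<alpha> (\<lambda>p. brk \<gamma> F p c) a b
    = brk \<beta> (\<lambda>z. prd \<alpha> F a z) b c + brk \<alpha> (\<lambda>p. prd \<gamma>' F p b) a c"
proof -
  have K: "k_linear F" using F by blast
  let ?\<delta> = "- \<gamma> - d"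
  have g: "?\<delta> + \<alpha> = \<gamma>'" using eq by simp
  have s1: "slot (d + \<alpha>) (\<lambda>x. prd \<alpha> F a x)" by (intro slot_intros F)
  have s2: "slot (- \<gamma>') (\<lambda>p. prd \<gamma>' F p b)" by (intro slot_intros K)
  have "prd \<alpha> (\<lambda>p. brk \<gamma> F p c) a b = - prd \<alpha> (\<lambda>p. brk ?\<delta> F c p) a b"
    by (simp add: brk_skew [OF F, of \<gamma> _ c] C.eval_prod_fun_minus)
  also have "\<dots> = - brk ?\<delta> (\<lambda>p. prd \<gamma>' F p b) c a - brk ?\<delta> (\<lambda>x. prd \<alpha> F a x) c b"
    using brk_leibniz [OF K, of \<alpha> ?\<delta> c a b] unfolding g by simp
  also have "- brk ?\<delta> (\<lambda>p. prd \<gamma>' F p b) c a = brk \<alpha> (\<lambda>p. prd \<gamma>' F p b) a c"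
    by (subst brk_skew [OF s2]) (simp add: eq)
  also have "- \<gamma> - d = - \<beta> - (d + \<alpha>)" using eq by simp
  finally show ?thesis
    by (subst brk_skew [OF s1, of \<beta>]) simp
qed

text \<open>
  The identity \<open>[a, b c] = [a b, c] + [a c, b]\<close>: both sides are \<open>[a,b] c + b
  [a,c]\<close>, since the remaining terms \<open>a [b,c]\<close> and \<open>a [c,b]\<close> of
  the right-hand side cancel.
\<close>

lemma brk_product_right:
  assumes F: "slot d F" and eq: "\<gamma>' = \<alpha> - d - \<gamma>" "\<beta> = \<gamma> - \<alpha>"
  shows "prd \<beta> (\<lambda>z. brk \<alpha> F a z) b c
    = prd \<alpha> (\<lambda>p. brk \<gamma> F p c) a b + prd \<alpha> (\<lambda>p. brk \<gamma>' F p b) a c"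
proof -
  have K: "k_linear F" using F by blast
  have s: "slot (d + \<alpha>) (\<lambda>x. prd \<alpha> F a x)" by (intro slot_intros F)
  have 1: "prd \<alpha> (\<lambda>p. brk \<gamma> F p c) a b
      = brk \<beta> (\<lambda>z. prd \<alpha> F a z) b c + brk \<alpha> (\<lambda>p. prd \<gamma>' F p b) a c"
    by (rule brk_product_left [OF F eq])
  have 2: "prd \<alpha> (\<lambda>p. brk \<gamma>' F p b) a c
      = - brk \<beta> (\<lambda>z. prd \<alpha> F a z) b c + brk \<alpha> (\<lambda>p. prd \<gamma> F p c) a b"
    using brk_product_left [OF F, of \<gamma> \<alpha> \<gamma>' "- \<beta> - (d + \<alpha>)" b a c] brk_skew [OF s, of \<beta> b c]
    by (simp add: eq algebra_simps)
  have 3: "prd \<beta> F b x = prd \<gamma>' F x b" for x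
    by (subst prd_commute [OF F]) (simp add: eq)
  have "\<alpha> + \<beta> = \<gamma>" using eq by simp
  then show ?thesis
    using brk_leibniz [OF K, of \<beta> \<alpha> a b c] by (simp add: 1 2 3)
qed


section \<open>The four compatibility conditions for a pure tensor\<close>

text \<open>
  For \<open>r = u \<otimes> v\<close> and a bilinear map \<open>t\<close> out of \<open>P
  \<otimes> P\<close>, the following two are the images of \<open>\<delta>(a)\<close> and
  \<open>\<Delta>(a)\<close> under the linear map induced by \<open>t\<close>, provided that
  \<open>t\<close> turns the total derivative of \<open>P \<otimes> P\<close> into
  multiplication by \<open>e\<close>.
\<close>

definition cobracket_at :: "'r \<Rightarrow> ('p \<Rightarrow> 'p \<Rightarrow> 'm) \<Rightarrow> 'p \<Rightarrow> 'p \<Rightarrow> 'p \<Rightarrow> 'm"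
  where "cobracket_at e t a u v = brk (- e) (\<lambda>p. t p v) a u + brk (- e) (\<lambda>p. t u p) a v"

definition coproduct_at :: "'r \<Rightarrow> ('p \<Rightarrow> 'p \<Rightarrow> 'm) \<Rightarrow> 'p \<Rightarrow> 'p \<Rightarrow> 'p \<Rightarrow> 'm"
  where "coproduct_at e t a u v = prd (- e) (\<lambda>p. t u p) a v - prd (- e) (\<lambda>p. t p v) a u"

lemmas eval_prod_linear = B.eval_prod_fun_add B.eval_prod_fun_minus B.eval_prod_fun_diff B.eval_prod_fun_sum
  C.eval_prod_fun_add C.eval_prod_fun_minus C.eval_prod_fun_diff C.eval_prod_fun_sum

context
  fixes t :: "'p \<Rightarrow> 'p \<Rightarrow> 'm" and d1 d2 \<Lambda> \<nu> :: 'r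
  assumes t1: "\<And>v. slot d1 (\<lambda>u. t u v)" and t2: "\<And>u. slot d2 (\<lambda>v. t u v)"
    and \<nu>: "\<nu> = - \<Lambda> - (d1 + d2)"
begin

text \<open>
  \<open>\<nu>\<close> is the parameter \<open>-\<lambda> - \<partial>\<close> with which \<open>b\<close> acts.  Acting by \<open>a\<close> with parameter \<open>\<Lambda>\<close> on one
  factor raises its weight by \<open>\<Lambda>\<close>, whence the total weight \<open>d1 + d2 + \<Lambda>\<close> in the lemmas below.
\<close>

lemma linear1: "k_linear (\<lambda>u. t u v)" and linear2: "k_linear (\<lambda>v. t u v)"
  using t1 t2 by blast+

text \<open>
  In each factor this is the Jacobi identity; the mixed terms such as \<open>[a,u] \<otimes>
  [b,v]\<close> cancel in pairs.
\<close>

lemma cobracket_bracket_at: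
  "brk \<Lambda> (\<lambda>z. cobracket_at (d1 + d2) t z u v) a b =
     cobracket_at (d1 + d2 + \<Lambda>) (\<lambda>p q. brk \<Lambda> (\<lambda>z. t z q) a p) b u v
   + cobracket_at (d1 + d2 + \<Lambda>) (\<lambda>p q. brk \<Lambda> (\<lambda>z. t p z) a q) b u v
   - (cobracket_at (d1 + d2 + \<nu>) (\<lambda>p q. brk \<nu> (\<lambda>z. t z q) b p) a u v
    + cobracket_at (d1 + d2 + \<nu>) (\<lambda>p q. brk \<nu> (\<lambda>z. t p z) b q) a u v)"
proof -
  have jac: "brk \<nu> (\<lambda>p. brk \<Lambda> F a p) b c = brk \<Lambda> (\<lambda>p. brk (- (d1 + d2)) F p c) a b
      + brk \<Lambda> (\<lambda>p. brk \<nu> F b p) a c" if "k_linear F" for F c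
    using brk_jacobi [OF that, of \<nu> \<Lambda> a b c] by (simp add: \<nu>)
  have p: "- (d1 + d2 + \<Lambda>) = \<nu>" "- (d1 + d2 + \<nu>) = \<Lambda>" by (simp_all add: \<nu>)
  show ?thesis
    unfolding cobracket_at_def p eval_prod_linear jac [OF linear1] jac [OF linear2]
    by (simp add: brk_brk_swap [of \<nu> \<Lambda>])
qed

text \<open>
  Both sides are \<open>u \<otimes> a b v - a b u \<otimes> v\<close>; the mixed terms \<open>b
  u \<otimes> a v\<close> cancel.
\<close>

lemma coproduct_product_at:
  "prd \<Lambda> (\<lambda>z. coproduct_at (d1 + d2) t z u v) a b =
     coproduct_at (d1 + d2 + \<Lambda>) (\<lambda>p q. prd \<Lambda> (\<lambda>z. t p z) a q) b u v
   + coproduct_at (d1 + d2 + \<nu>) (\<lambda>p q. prd \<nu> (\<lambda>z. t z q) b p) a u v"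
proof -
  have p: "- (d1 + d2 + \<Lambda>) = \<nu>" "- (d1 + d2 + \<nu>) = \<Lambda>" by (simp_all add: \<nu>)
  have 1: "prd \<Lambda> (\<lambda>z. prd (- (d1 + d2)) F z c) a b = prd \<nu> (\<lambda>p. prd \<Lambda> F a p) b c"
    if "k_linear F" for F a b c
    using prd_assoc [OF that, of \<Lambda> \<nu> c a b] by (simp add: \<nu>)
  have 2: "prd \<Lambda> (\<lambda>z. prd (- (d1 + d2)) (\<lambda>p. t p v) z u) a b = prd \<Lambda> (\<lambda>p. prd \<nu> (\<lambda>z. t z v) b p) a u"
  proof -
    have "prd \<Lambda> (\<lambda>z. prd (- (d1 + d2)) (\<lambda>p. t p v) z u) a b
        = prd \<Lambda> (\<lambda>p. prd (- \<nu> - d1) (\<lambda>z. t z v) p b) a u"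
      by (rule prd_assoc_flip [OF t1]) (simp add: \<nu>)
    then show ?thesis by (simp flip: prd_commute [OF t1])
  qed
  show ?thesis
    unfolding coproduct_at_def p eval_prod_linear 1 [OF linear2] 2
    by (simp add: prd_prd_swap [of \<nu> \<Lambda>])
qed

text \<open>
  The first factor gives \<open>[ab,u] = a[b,u] + b[a,u]\<close>. In the second factor the two
  coproduct terms give \<open>[a,bv] + [b,av] = [ab,v]\<close>, because the extra contributions
  \<open>[a,b]v\<close> and \<open>[b,a]v\<close> cancel.
\<close>

lemma cobracket_product_at:
  "prd \<Lambda> (\<lambda>z. cobracket_at (d1 + d2) t z u v) a b =
     cobracket_at (d1 + d2 + \<Lambda>) (\<lambda>p q. prd \<Lambda> (\<lambda>z. t z q) a p) b u v
   + cobracket_at (d1 + d2 + \<nu>) (\<lambda>p q. prd \<nu> (\<lambda>z. t z q) b p) a u v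
   + coproduct_at (d1 + d2 + \<Lambda>) (\<lambda>p q. brk \<Lambda> (\<lambda>z. t p z) a q) b u v
   + coproduct_at (d1 + d2 + \<nu>) (\<lambda>p q. brk \<nu> (\<lambda>z. t p z) b q) a u v"
proof -
  have p: "- (d1 + d2 + \<Lambda>) = \<nu>" "- (d1 + d2 + \<nu>) = \<Lambda>" by (simp_all add: \<nu>)
  have left: "prd \<Lambda> (\<lambda>z. brk (- (d1 + d2)) F z c) a b
      = brk \<nu> (\<lambda>z. prd \<Lambda> F a z) b c + brk \<Lambda> (\<lambda>z. prd \<nu> F b z) a c" if "slot d F" for F c d
  proof -
    have "prd \<Lambda> (\<lambda>z. brk (- (d1 + d2)) F z c) a b
        = brk \<nu> (\<lambda>z. prd \<Lambda> F a z) b c + brk \<Lambda> (\<lambda>z. prd (- \<nu> - d) F z b) a c"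
      by (rule brk_product_left [OF that]) (simp_all add: \<nu>)
    then show ?thesis by (simp flip: prd_commute [OF that])
  qed
  have right: "prd \<nu> (\<lambda>z. brk \<Lambda> F a z) b c + prd \<Lambda> (\<lambda>z. brk \<nu> F b z) a c
      = brk \<nu> (\<lambda>z. prd \<Lambda> F a z) b c + brk \<Lambda> (\<lambda>z. prd \<nu> F b z) a c" if "k_linear F" for F c
  proof -
    have s: "slot (- (\<Lambda> + \<nu>)) (\<lambda>p. prd (\<Lambda> + \<nu>) F p c)" by (intro slot_intros that)
    have "brk \<nu> (\<lambda>p. prd (\<Lambda> + \<nu>) F p c) b a = - brk \<Lambda> (\<lambda>p. prd (\<Lambda> + \<nu>) F p c) a b"
      by (subst brk_skew [OF s]) simp
    then show ?thesis
      using brk_leibniz [OF that, of \<nu> \<Lambda> a b c] brk_leibniz [OF that, of \<Lambda> \<nu> b a c]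
      by (simp add: add.commute)
  qed
  show ?thesis
    unfolding cobracket_at_def coproduct_at_def p eval_prod_linear left [OF t1] left [OF t2]
    using right [OF linear2, of u v] by (simp add: brk_prd_swap algebra_simps)
qed

text \<open>
  Both factors give the Leibniz rule for \<open>[a, b \<cdot>]\<close>; the mixed terms cancel.
\<close>

lemma coproduct_bracket_at:
  "brk \<Lambda> (\<lambda>z. coproduct_at (d1 + d2) t z u v) a b =
     coproduct_at (d1 + d2 + \<Lambda>) (\<lambda>p q. brk \<Lambda> (\<lambda>z. t z q) a p) b u v
   + coproduct_at (d1 + d2 + \<Lambda>) (\<lambda>p q. brk \<Lambda> (\<lambda>z. t p z) a q) b u v
   - cobracket_at (d1 + d2 + \<nu>) (\<lambda>p q. prd \<nu> (\<lambda>z. t p z) b q) a u v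
   + cobracket_at (d1 + d2 + \<nu>) (\<lambda>p q. prd \<nu> (\<lambda>z. t z q) b p) a u v"
proof -
  have p: "- (d1 + d2 + \<Lambda>) = \<nu>" "- (d1 + d2 + \<nu>) = \<Lambda>" by (simp_all add: \<nu>)
  have leib: "prd \<nu> (\<lambda>z. brk \<Lambda> F a z) b c
      = brk \<Lambda> (\<lambda>p. prd (- (d1 + d2)) F p c) a b + brk \<Lambda> (\<lambda>z. prd \<nu> F b z) a c" if "k_linear F" for F c
    using brk_leibniz [OF that, of \<nu> \<Lambda> a b c] by (simp add: \<nu>)
  show ?thesis
    unfolding cobracket_at_def coproduct_at_def p eval_prod_linear leib [OF linear1] leib [OF linear2]
    by (simp add: brk_prd_swap algebra_simps)
qed

end

end

section \<open>Co-Jacobi, coassociativity and co-Leibniz from the Yang-Baxter equations\<close>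

text \<open>
  The locales below are about \<open>r = \<Sum>\<^sub>i x\<^sub>i \<otimes> y\<^sub>i\<close>,
  and express what is known about \<open>r\<close> through sums over bilinear or trilinear maps
  with values in \<open>M\<close>.
\<close>

locale coboundary_evaluation = poisson_evaluation s br mul scl \<kappa>
  for s :: "'k::field_char_0 poly \<Rightarrow> 'p::ab_group_add \<Rightarrow> 'p"
  and br mul :: "'p \<Rightarrow> 'p \<Rightarrow> 'p poly"
  and scl :: "'r::comm_ring_1 \<Rightarrow> 'm::ab_group_add \<Rightarrow> 'm"
  and \<kappa> :: "'k \<Rightarrow> 'r" +
  fixes x y :: "nat \<Rightarrow> 'p" and n :: nat
begin

definition cobracket_r :: "'r \<Rightarrow> ('p \<Rightarrow> 'p \<Rightarrow> 'm) \<Rightarrow> 'p \<Rightarrow> 'm"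
  where "cobracket_r e t a = (\<Sum>i<n. cobracket_at e t a (x i) (y i))"

definition coproduct_r :: "'r \<Rightarrow> ('p \<Rightarrow> 'p \<Rightarrow> 'm) \<Rightarrow> 'p \<Rightarrow> 'm"
  where "coproduct_r e t a = (\<Sum>i<n. coproduct_at e t a (x i) (y i))"

abbreviation S :: "(nat \<Rightarrow> nat \<Rightarrow> 'm) \<Rightarrow> 'm"
  where "S f \<equiv> (\<Sum>i<n. \<Sum>j<n. f i j)"

lemma double_sum_swap: "S f = S (\<lambda>i j. f j i)"
  by (rule sum.swap)

end

text \<open>
  This is \<open>\<tau> r = -r\<close> as seen by bilinear maps into \<open>M\<close>.
\<close>

locale skew_coboundary_evaluation = coboundary_evaluation s br mul scl \<kappa> x y n
  for s :: "'k::field_char_0 poly \<Rightarrow> 'p::ab_group_add \<Rightarrow> 'p"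
  and br mul :: "'p \<Rightarrow> 'p \<Rightarrow> 'p poly"
  and scl :: "'r::comm_ring_1 \<Rightarrow> 'm::ab_group_add \<Rightarrow> 'm"
  and \<kappa> :: "'k \<Rightarrow> 'r"
  and x y :: "nat \<Rightarrow> 'p" and n :: nat +
  assumes skew_r: "\<And>f. (\<And>v. k_linear (\<lambda>u. f u v)) \<Longrightarrow> (\<And>u. k_linear (f u)) \<Longrightarrow>
      (\<Sum>i<n. f (x i) (y i)) = - (\<Sum>i<n. f (y i) (x i))"
begin

lemma double_sum_skew:
  assumes "\<And>j v. k_linear (\<lambda>u. f u v j)" "\<And>j u. k_linear (\<lambda>v. f u v j)"
  shows "S (\<lambda>i j. f (x i) (y i) j) = - S (\<lambda>i j. f (y i) (x i) j)"
  using skew_r [of "\<lambda>u v. \<Sum>j<n. f u v j"] assms by (simp add: k_linear_sum)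

context
  fixes t :: "'p \<Rightarrow> 'p \<Rightarrow> 'm" and d1 d2 :: 'r
  assumes t1: "\<And>v. k_linear (\<lambda>u. t u v)" and t2: "\<And>u. k_linear (\<lambda>v. t u v)"
begin

lemma cobracket_r_skew: "cobracket_r e t a = - cobracket_r e (\<lambda>u v. t v u) a"
proof -
  have k: "k_linear (\<lambda>u. cobracket_at e t a u v)" "k_linear (\<lambda>v. cobracket_at e t a u v)" for u v
    unfolding cobracket_at_def by (intro k_linear_intros t1 t2)+
  then show ?thesis
    unfolding cobracket_r_def
    by (subst skew_r [of "cobracket_at e t a", OF k]) (simp_all add: cobracket_at_def add.commute)
qed

lemma coproduct_r_commute: "coproduct_r e t a = coproduct_r e (\<lambda>u v. t v u) a"
proof -
  have k: "k_linear (\<lambda>u. coproduct_at e t a u v)" "k_linear (\<lambda>v. coproduct_at e t a u v)" for u v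
    unfolding coproduct_at_def by (intro k_linear_intros t1 t2)+
  then show ?thesis
    unfolding coproduct_r_def
    by (subst skew_r [of "coproduct_at e t a", OF k]) (simp_all add: coproduct_at_def flip: sum_negf)
qed

end

end

text \<open>
  A trilinear map whose slots have weights with sum \<open>0\<close> induces a linear map which
  annihilates the image of the total derivative of \<open>P \<otimes> P \<otimes> P\<close>. The
  two hypotheses state that all such maps also annihilate \<open>[[r,r]]\<close> and \<open>r
  \<bullet> r\<close>. In the middle term of the second one, the parameter \<open>-(e1 +
  e2)\<close> is written as \<open>e3\<close>.
\<close>

locale yang_baxter_evaluation = skew_coboundary_evaluation s br mul scl \<kappa> x y n
  for s :: "'k::field_char_0 poly \<Rightarrow> 'p::ab_group_add \<Rightarrow> 'p"
  and br mul :: "'p \<Rightarrow> 'p \<Rightarrow> 'p poly"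
  and scl :: "'r::comm_ring_1 \<Rightarrow> 'm::ab_group_add \<Rightarrow> 'm"
  and \<kappa> :: "'k \<Rightarrow> 'r"
  and x y :: "nat \<Rightarrow> 'p" and n :: nat +
  assumes cybe: "\<And>t e1 e2 e3. (\<And>v w. slot e1 (\<lambda>u. t u v w)) \<Longrightarrow> (\<And>u w. slot e2 (\<lambda>v. t u v w)) \<Longrightarrow>
      (\<And>u v. slot e3 (\<lambda>w. t u v w)) \<Longrightarrow> e1 + e2 + e3 = 0 \<Longrightarrow>
      (\<Sum>i<n. \<Sum>j<n. brk e2 (\<lambda>z. t z (y i) (y j)) (x i) (x j)
        - brk e3 (\<lambda>z. t (x i) z (y j)) (x j) (y i)
        - brk e2 (\<lambda>z. t (x i) (x j) z) (y j) (y i)) = 0"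
    and aybe: "\<And>t e1 e2 e3. (\<And>v w. slot e1 (\<lambda>u. t u v w)) \<Longrightarrow> (\<And>u w. slot e2 (\<lambda>v. t u v w)) \<Longrightarrow>
      (\<And>u v. slot e3 (\<lambda>w. t u v w)) \<Longrightarrow> e1 + e2 + e3 = 0 \<Longrightarrow>
      (\<Sum>i<n. \<Sum>j<n. prd e1 (\<lambda>z. t (x i) (x j) z) (y i) (y j)
        - prd e3 (\<lambda>z. t (x i) z (y j)) (x j) (y i)
        + prd e2 (\<lambda>z. t z (y i) (y j)) (x i) (x j)) = 0"
begin

context
  fixes t :: "'p \<Rightarrow> 'p \<Rightarrow> 'p \<Rightarrow> 'm" and d1 d2 d3 T :: 'r and a :: 'p
  assumes t1: "\<And>v w. slot d1 (\<lambda>u. t u v w)" and t2: "\<And>u w. slot d2 (\<lambda>v. t u v w)"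
    and t3: "\<And>u v. slot d3 (\<lambda>w. t u v w)" and T: "T = d1 + d2 + d3"
begin

lemma linear1: "k_linear (\<lambda>u. t u v w)" and linear2: "k_linear (\<lambda>v. t u v w)" and linear3: "k_linear (\<lambda>w. t u v w)"
  using t1 t2 t3 by blast+

text \<open>
  Acting by \<open>a\<close> with parameter \<open>-T\<close> on one factor lowers its weight by
  the total weight \<open>T\<close>. The sum of the weights becomes \<open>0\<close>, so the
  Yang-Baxter equations apply to the resulting trilinear maps.
\<close>

lemma acted_slots:
  "slot (d1 - T) (\<lambda>u. brk (- T) (\<lambda>q. t q v w) a u)" "slot d2 (\<lambda>v. brk (- T) (\<lambda>q. t q v w) a u)"
  "slot d3 (\<lambda>w. brk (- T) (\<lambda>q. t q v w) a u)"
  "slot d1 (\<lambda>u. brk (- T) (\<lambda>q. t u q w) a v)" "slot (d2 - T) (\<lambda>v. brk (- T) (\<lambda>q. t u q w) a v)"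
  "slot d3 (\<lambda>w. brk (- T) (\<lambda>q. t u q w) a v)"
  "slot d1 (\<lambda>u. brk (- T) (\<lambda>q. t u v q) a w)" "slot d2 (\<lambda>v. brk (- T) (\<lambda>q. t u v q) a w)"
  "slot (d3 - T) (\<lambda>w. brk (- T) (\<lambda>q. t u v q) a w)"
  "slot (d1 - T) (\<lambda>u. prd (- T) (\<lambda>q. t q v w) a u)" "slot d2 (\<lambda>v. prd (- T) (\<lambda>q. t q v w) a u)"
  "slot d3 (\<lambda>w. prd (- T) (\<lambda>q. t q v w) a u)"
  "slot d1 (\<lambda>u. prd (- T) (\<lambda>q. t u q w) a v)" "slot (d2 - T) (\<lambda>v. prd (- T) (\<lambda>q. t u q w) a v)"
  "slot d3 (\<lambda>w. prd (- T) (\<lambda>q. t u q w) a v)"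
  "slot d1 (\<lambda>u. prd (- T) (\<lambda>q. t u v q) a w)" "slot d2 (\<lambda>v. prd (- T) (\<lambda>q. t u v q) a w)"
  "slot (d3 - T) (\<lambda>w. prd (- T) (\<lambda>q. t u v q) a w)"
  using B.slot_eval_prod_right [OF t1, of "- T"] B.slot_eval_prod_right [OF t2, of "- T"] B.slot_eval_prod_right [OF t3, of "- T"]
    C.slot_eval_prod_right [OF t1, of "- T"] C.slot_eval_prod_right [OF t2, of "- T"] C.slot_eval_prod_right [OF t3, of "- T"]
  by (auto intro: slot_intros t1 t2 t3)

lemma acted_weights: "d1 - T = - (d2 + d3)" "d2 - T = - (d1 + d3)" "d3 - T = - (d1 + d2)"
  by (simp_all add: T)

lemma acted_weights_sum: "- (d2 + d3) + d2 + d3 = 0" "d1 + - (d1 + d3) + d3 = 0" "d1 + d2 + - (d1 + d2) = 0"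
  by simp_all

lemma skew_slots:
  "slot d2 F \<Longrightarrow> brk (- (d2 + d3)) F u v = - brk d3 F v u"
  "slot d3 F \<Longrightarrow> brk (- (d2 + d3)) F u v = - brk d2 F v u"
  "slot d1 F \<Longrightarrow> brk (- (d1 + d2)) F u v = - brk d2 F v u"
  "slot (d2 - T) F \<Longrightarrow> brk d1 F u v = - brk d3 F v u"
  "slot (d3 - T) F \<Longrightarrow> brk d1 F u v = - brk d2 F v u"
  by (subst brk_skew, assumption, simp add: T)+

lemma commute_slots:
  "slot d1 F \<Longrightarrow> prd (- (d1 + d2)) F u v = prd d2 F v u"
  "slot d2 F \<Longrightarrow> prd (- (d2 + d3)) F u v = prd d3 F v u"
  "slot (d1 - T) F \<Longrightarrow> prd d3 F u v = prd d2 F v u"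
  by (subst prd_commute, assumption, simp add: T)+

text \<open>
  The difference of the two sides is the sum over the three factors of the action of \<open>ad(a)\<close> on
  \<open>[[r,r]]\<close>.  It has twelve terms.  The six in which the two brackets are taken in different factors
  are six of the nine terms of the action, up to skew-symmetry of the bracket or of \<open>r\<close>; the six with
  a double bracket in one factor combine in pairs to the other three by the Jacobi identity.
\<close>

lemma cobracket_r_jacobi:
  "cobracket_r T (\<lambda>u. cobracket_r (d2 + d3) (t u)) a
     - cobracket_r T (\<lambda>u. cobracket_r (d1 + d3) (\<lambda>p. t p u)) a
   = cobracket_r T (\<lambda>u v. cobracket_r (d1 + d2) (\<lambda>p q. t p q v) u) a"
proof -
  \<comment> \<open>\<open>A\<close>, \<open>B\<close>, \<open>C\<close>: the terms of the three iterated cobrackets, in the order of the statement.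
    \<open>Kkl\<close>: term \<open>l\<close> of \<open>[[r,r]]\<close>, up to sign, with \<open>a\<close> acting on factor \<open>k\<close>.\<close>
  define A1 where
    "A1 = (\<lambda>i j. brk (- T) (\<lambda>p. brk (- (d2 + d3)) (\<lambda>q. t p q (y j)) (y i) (x j)) a (x i))"
  define A2 where
    "A2 = (\<lambda>i j. brk (- T) (\<lambda>p. brk (- (d2 + d3)) (\<lambda>q. t p (x j) q) (y i) (y j)) a (x i))"
  define A3 where
    "A3 = (\<lambda>i j. brk (- T) (\<lambda>p. brk (- (d2 + d3)) (\<lambda>q. t (x i) q (y j)) p (x j)) a (y i))"
  define A4 where
    "A4 = (\<lambda>i j. brk (- T) (\<lambda>p. brk (- (d2 + d3)) (\<lambda>q. t (x i) (x j) q) p (y j)) a (y i))"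
  define B1 where
    "B1 = (\<lambda>i j. brk (- T) (\<lambda>p. brk (- (d1 + d3)) (\<lambda>q. t q p (y j)) (y i) (x j)) a (x i))"
  define B2 where
    "B2 = (\<lambda>i j. brk (- T) (\<lambda>p. brk (- (d1 + d3)) (\<lambda>q. t (x j) p q) (y i) (y j)) a (x i))"
  define B3 where
    "B3 = (\<lambda>i j. brk (- T) (\<lambda>p. brk (- (d1 + d3)) (\<lambda>q. t q (x i) (y j)) p (x j)) a (y i))"
  define B4 where
    "B4 = (\<lambda>i j. brk (- T) (\<lambda>p. brk (- (d1 + d3)) (\<lambda>q. t (x j) (x i) q) p (y j)) a (y i))"
  define C1 where
    "C1 = (\<lambda>i j. brk (- T) (\<lambda>p. brk (- (d1 + d2)) (\<lambda>q. t q (y j) (y i)) p (x j)) a (x i))"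
  define C2 where
    "C2 = (\<lambda>i j. brk (- T) (\<lambda>p. brk (- (d1 + d2)) (\<lambda>q. t (x j) q (y i)) p (y j)) a (x i))"
  define C3 where
    "C3 = (\<lambda>i j. brk (- T) (\<lambda>p. brk (- (d1 + d2)) (\<lambda>q. t q (y j) p) (x i) (x j)) a (y i))"
  define C4 where
    "C4 = (\<lambda>i j. brk (- T) (\<lambda>p. brk (- (d1 + d2)) (\<lambda>q. t (x j) q p) (x i) (y j)) a (y i))"
  define K11 where
    "K11 = (\<lambda>i j. brk d2 (\<lambda>z. brk (- T) (\<lambda>q. t q (y i) (y j)) a z) (x i) (x j))"
  define K12 where
    "K12 = (\<lambda>i j. brk d3 (\<lambda>z. brk (- T) (\<lambda>q. t q z (y j)) a (x i)) (x j) (y i))"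
  define K13 where
    "K13 = (\<lambda>i j. brk d2 (\<lambda>z. brk (- T) (\<lambda>q. t q (x j) z) a (x i)) (y j) (y i))"
  define K21 where
    "K21 = (\<lambda>i j. brk (- (d1 + d3)) (\<lambda>z. brk (- T) (\<lambda>q. t z q (y j)) a (y i)) (x i) (x j))"
  define K22 where
    "K22 = (\<lambda>i j. brk d3 (\<lambda>z. brk (- T) (\<lambda>q. t (x i) q (y j)) a z) (x j) (y i))"
  define K23 where
    "K23 = (\<lambda>i j. brk (- (d1 + d3)) (\<lambda>z. brk (- T) (\<lambda>q. t (x i) q z) a (x j)) (y j) (y i))"
  define K31 where
    "K31 = (\<lambda>i j. brk d2 (\<lambda>z. brk (- T) (\<lambda>q. t z (y i) q) a (y j)) (x i) (x j))"
  define K32 where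
    "K32 = (\<lambda>i j. brk (- (d1 + d2)) (\<lambda>z. brk (- T) (\<lambda>q. t (x i) z q) a (y j)) (x j) (y i))"
  define K33 where
    "K33 = (\<lambda>i j. brk d2 (\<lambda>z. brk (- T) (\<lambda>q. t (x i) (x j) q) a z) (y j) (y i))"
  note defs = A1_def A2_def A3_def A4_def B1_def B2_def B3_def B4_def C1_def C2_def C3_def
    C4_def K11_def K12_def K13_def K21_def K22_def K23_def K31_def K32_def K33_def
  have K1: "S K11 - S K12 - S K13 = 0"
    using cybe [where t = "\<lambda>u v w. brk (- T) (\<lambda>q. t q v w) a u"
        and ?e1.0 = "d1 - T" and ?e2.0 = d2 and ?e3.0 = d3,
        OF acted_slots(1) acted_slots(2) acted_slots(3)]
    unfolding acted_weights by (simp add: defs acted_weights_sum sum_subtractf del: minus_add_distrib)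
  have K2: "S K21 - S K22 - S K23 = 0"
    using cybe [where t = "\<lambda>u v w. brk (- T) (\<lambda>q. t u q w) a v"
        and ?e1.0 = d1 and ?e2.0 = "d2 - T" and ?e3.0 = d3,
        OF acted_slots(4) acted_slots(5) acted_slots(6)]
    unfolding acted_weights by (simp add: defs acted_weights_sum sum_subtractf del: minus_add_distrib)
  have K3: "S K31 - S K32 - S K33 = 0"
    using cybe [where t = "\<lambda>u v w. brk (- T) (\<lambda>q. t u v q) a w"
        and ?e1.0 = d1 and ?e2.0 = d2 and ?e3.0 = "d3 - T",
        OF acted_slots(7) acted_slots(8) acted_slots(9)]
    unfolding acted_weights by (simp add: defs acted_weights_sum sum_subtractf del: minus_add_distrib)
  have A1: "A1 i j = - K12 i j" for i j
    unfolding defs skew_slots(1) [OF t2] B.eval_prod_fun_minus by (simp only: brk_brk_swap [of "- T" d3])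
  have A2: "A2 i j = - K13 i j" for i j
    unfolding defs skew_slots(2) [OF t3] B.eval_prod_fun_minus by (simp only: brk_brk_swap [of "- T" d2])
  have A3: "A3 i j = C2 j i - K22 i j" for i j
    unfolding defs diff_conv_add_uminus skew_slots(4) [OF acted_slots(5), symmetric]
    by (rule brk_jacobi_flip [OF t2]) (simp_all add: T)
  have A4: "A4 i j = B4 j i - K33 i j" for i j
    unfolding defs diff_conv_add_uminus skew_slots(5) [OF acted_slots(9), symmetric]
    by (rule brk_jacobi_flip [OF t3]) (simp_all add: T)
  have B1: "S B1 = - S K21"
  proof -
    let ?f = "\<lambda>u v j. brk (- T) (\<lambda>p. brk (- (d1 + d3)) (\<lambda>q. t q p (y j)) v (x j)) a u"
    have "S (\<lambda>i j. ?f (x i) (y i) j) = - S (\<lambda>i j. ?f (y i) (x i) j)"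
      by (rule double_sum_skew) (intro k_linear_intros linear1 linear2)+
    then show ?thesis
      unfolding defs by (simp only: brk_brk_swap [of "- T"])
  qed
  have B2: "B2 i j = K23 j i" for i j
    unfolding defs by (rule brk_brk_swap)
  have B3: "S B3 = - S C1 - S K11"
  proof -
    let ?f = "\<lambda>u v j. brk (- T) (\<lambda>p. brk (- (d1 + d3)) (\<lambda>q. t q u (y j)) p (x j)) a v"
    have "S (\<lambda>i j. ?f (x i) (y i) j) = - S (\<lambda>i j. ?f (y i) (x i) j)"
      by (rule double_sum_skew) (intro k_linear_intros linear1 linear2)+
    moreover have "?f (y i) (x i) j = C1 j i + K11 i j" for i j
      unfolding defs
      by (rule brk_jacobi_flip [OF t1]) (simp_all add: T)
    ultimately show ?thesis
      by (simp add: B3_def sum.distrib double_sum_swap [of C1])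
  qed
  have C3: "C3 j i = - K31 i j" for i j
    unfolding defs skew_slots(3) [OF t1] B.eval_prod_fun_minus by (simp only: brk_brk_swap [of "- T" d2])
  have C4: "C4 j i = K32 i j" for i j
    unfolding defs by (rule brk_brk_swap)
  have expand: "cobracket_r T (\<lambda>u. cobracket_r (d2 + d3) (t u)) a = (S A1 + S A2) + (S A3 + S A4)"
    "cobracket_r T (\<lambda>u. cobracket_r (d1 + d3) (\<lambda>p. t p u)) a = (S B1 + S B2) + (S B3 + S B4)"
    "cobracket_r T (\<lambda>u v. cobracket_r (d1 + d2) (\<lambda>p q. t p q v) u) a = (S C1 + S C2) + (S C3 + S C4)"
    by (simp_all only: cobracket_r_def cobracket_at_def eval_prod_linear sum.distrib defs)
  have sums: "S A1 = - S K12" "S A2 = - S K13" "S B2 = S K23" "S C3 = - S K31" "S C4 = S K32"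
      "S A3 = S C2 - S K22" "S A4 = S B4 - S K33"
    by (simp_all only: A1 A2 A3 A4 B2 C3 C4 sum_negf sum_subtractf
      double_sum_swap [of K23, symmetric] double_sum_swap [of K31, symmetric] double_sum_swap [of K32, symmetric]
      double_sum_swap [of C2, symmetric] double_sum_swap [of B4, symmetric])
  have "S K13 = S K11 - S K12" "S K23 = S K21 - S K22" "S K33 = S K31 - S K32"
    using K1 K2 K3 by simp_all
  then show ?thesis
    unfolding expand sums B1 B3 by simp
qed

text \<open>
  The difference of the two sides is \<open>(I \<otimes> I \<otimes> L(a) - L(a) \<otimes> I
  \<otimes> I)(r \<bullet> r)\<close>. The terms with \<open>a\<close> in the middle factor,
  \<open>A2\<close> and \<open>C3\<close> below, are equal to each other by commutativity and
  associativity.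
\<close>

lemma coproduct_r_coassoc:
  "coproduct_r T (\<lambda>u. coproduct_r (d2 + d3) (t u)) a
   = coproduct_r T (\<lambda>u v. coproduct_r (d1 + d2) (\<lambda>p q. t p q v) u) a"
proof -
  \<comment> \<open>\<open>A\<close>, \<open>C\<close>: the terms of the two iterated coproducts.
    \<open>Lkl\<close>: term \<open>l\<close> of \<open>r \<bullet> r\<close>, up to sign, with \<open>a\<close> acting on factor \<open>k\<close>.\<close>
  define A1 where
    "A1 = (\<lambda>i j. prd (- T) (\<lambda>p. prd (- (d2 + d3)) (\<lambda>q. t (x i) (x j) q) p (y j)) a (y i))"
  define A2 where
    "A2 = (\<lambda>i j. prd (- T) (\<lambda>p. prd (- (d2 + d3)) (\<lambda>q. t (x i) q (y j)) p (x j)) a (y i))"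
  define A3 where
    "A3 = (\<lambda>i j. prd (- T) (\<lambda>p. prd (- (d2 + d3)) (\<lambda>q. t p (x j) q) (y i) (y j)) a (x i))"
  define A4 where
    "A4 = (\<lambda>i j. prd (- T) (\<lambda>p. prd (- (d2 + d3)) (\<lambda>q. t p q (y j)) (y i) (x j)) a (x i))"
  define C1 where
    "C1 = (\<lambda>i j. prd (- T) (\<lambda>p. prd (- (d1 + d2)) (\<lambda>q. t (x j) q p) (x i) (y j)) a (y i))"
  define C2 where
    "C2 = (\<lambda>i j. prd (- T) (\<lambda>p. prd (- (d1 + d2)) (\<lambda>q. t q (y j) p) (x i) (x j)) a (y i))"
  define C3 where
    "C3 = (\<lambda>i j. prd (- T) (\<lambda>p. prd (- (d1 + d2)) (\<lambda>q. t (x j) q (y i)) p (y j)) a (x i))"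
  define C4 where
    "C4 = (\<lambda>i j. prd (- T) (\<lambda>p. prd (- (d1 + d2)) (\<lambda>q. t q (y j) (y i)) p (x j)) a (x i))"
  define L11 where
    "L11 = (\<lambda>i j. prd (- (d2 + d3)) (\<lambda>z. prd (- T) (\<lambda>q. t q (x j) z) a (x i)) (y i) (y j))"
  define L12 where
    "L12 = (\<lambda>i j. prd d3 (\<lambda>z. prd (- T) (\<lambda>q. t q z (y j)) a (x i)) (x j) (y i))"
  define L13 where
    "L13 = (\<lambda>i j. prd d2 (\<lambda>z. prd (- T) (\<lambda>q. t q (y i) (y j)) a z) (x i) (x j))"
  define L31 where
    "L31 = (\<lambda>i j. prd d1 (\<lambda>z. prd (- T) (\<lambda>q. t (x i) (x j) q) a z) (y i) (y j))"
  define L32 where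
    "L32 = (\<lambda>i j. prd (- (d1 + d2)) (\<lambda>z. prd (- T) (\<lambda>q. t (x i) z q) a (y j)) (x j) (y i))"
  define L33 where
    "L33 = (\<lambda>i j. prd d2 (\<lambda>z. prd (- T) (\<lambda>q. t z (y i) q) a (y j)) (x i) (x j))"
  note defs = A1_def A2_def A3_def A4_def C1_def C2_def C3_def C4_def L11_def L12_def L13_def
    L31_def L32_def L33_def
  have L1: "S L11 - S L12 + S L13 = 0"
    using aybe [where t = "\<lambda>u v w. prd (- T) (\<lambda>q. t q v w) a u"
        and ?e1.0 = "d1 - T" and ?e2.0 = d2 and ?e3.0 = d3,
        OF acted_slots(10) acted_slots(11) acted_slots(12)]
    unfolding acted_weights by (simp add: defs acted_weights_sum sum_subtractf sum.distrib del: minus_add_distrib)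
  have L3: "S L31 - S L32 + S L33 = 0"
    using aybe [where t = "\<lambda>u v w. prd (- T) (\<lambda>q. t u v q) a w"
        and ?e1.0 = d1 and ?e2.0 = d2 and ?e3.0 = "d3 - T",
        OF acted_slots(16) acted_slots(17) acted_slots(18)]
    unfolding acted_weights by (simp add: defs acted_weights_sum sum_subtractf sum.distrib del: minus_add_distrib)
  have A1: "A1 i j = L31 i j" for i j
    using prd_assoc [OF linear3, where \<alpha> = "- T" and \<beta> = d1] by (simp add: defs T)
  have C1: "C1 j i = L32 i j" for i j
    unfolding defs by (rule prd_prd_swap)
  have C2: "C2 j i = L33 i j" for i j
    unfolding defs commute_slots(1) [OF t1] by (rule prd_prd_swap)
  have A2: "A2 i j = C3 j i" for i j
    unfolding defs by (rule prd_assoc_flip [OF t2]) (simp add: T)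
  have A3: "A3 i j = L11 i j" for i j
    unfolding defs by (rule prd_prd_swap)
  have A4: "A4 i j = L12 i j" for i j
    unfolding defs commute_slots(2) [OF t2] by (rule prd_prd_swap)
  have C4: "C4 j i = L13 i j" for i j
    using prd_assoc [OF linear1, where \<alpha> = "- T" and \<beta> = d3]
    unfolding defs commute_slots(3) [OF acted_slots(10), symmetric] by (simp add: T)
  have expand: "coproduct_r T (\<lambda>u. coproduct_r (d2 + d3) (t u)) a = (S A1 - S A2) - (S A3 - S A4)"
    "coproduct_r T (\<lambda>u v. coproduct_r (d1 + d2) (\<lambda>p q. t p q v) u) a = (S C1 - S C2) - (S C3 - S C4)"
    by (simp_all only: coproduct_r_def coproduct_at_def eval_prod_linear sum_subtractf defs)
  have sums: "S A1 = S L31" "S A2 = S C3" "S A3 = S L11" "S A4 = S L12"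
      "S C1 = S L32" "S C2 = S L33" "S C4 = S L13"
    by (simp_all only: A1 A2 A3 A4 C1 C2 C4 double_sum_swap [of L32, symmetric] double_sum_swap [of L33, symmetric]
      double_sum_swap [of C3, symmetric] double_sum_swap [of L13, symmetric])
  have "S L12 = S L11 + S L13" "S L32 = S L31 + S L33"
    using L1 L3 by (simp_all add: algebra_simps)
  then show ?thesis
    unfolding expand sums by simp
qed

text \<open>
  The difference of the two sides is \<open>(ad(a) \<otimes> I \<otimes> I)(r \<bullet> r) + (I
  \<otimes> I \<otimes> L(a) - I \<otimes> L(a) \<otimes> I)[[r,r]]\<close>. Terms with two
  operations in the same factor combine by the Leibniz rule, the others match one by one.
\<close>

lemma cobracket_r_coleibniz:
  "cobracket_r T (\<lambda>u. coproduct_r (d2 + d3) (t u)) a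
   = coproduct_r T (\<lambda>u v. cobracket_r (d1 + d2) (\<lambda>p q. t p q v) u) a
     + coproduct_r T (\<lambda>u. cobracket_r (d1 + d3) (\<lambda>p. t p u)) a"
proof -
  \<comment> \<open>\<open>A\<close>, \<open>C\<close>, \<open>B\<close>: the terms of the three iterated coproducts, in the order of the statement.
    \<open>Lkl\<close>: term \<open>l\<close> of \<open>r \<bullet> r\<close>, up to sign, with \<open>ad(a)\<close> acting on factor \<open>k\<close>;
    \<open>Kkl\<close>: term \<open>l\<close> of \<open>[[r,r]]\<close>, up to sign, with \<open>L(a)\<close> acting on factor \<open>k\<close>.\<close>
  define A1 where
    "A1 = (\<lambda>i j. brk (- T) (\<lambda>p. prd (- (d2 + d3)) (\<lambda>q. t p (x j) q) (y i) (y j)) a (x i))"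
  define A2 where
    "A2 = (\<lambda>i j. brk (- T) (\<lambda>p. prd (- (d2 + d3)) (\<lambda>q. t p q (y j)) (y i) (x j)) a (x i))"
  define A3 where
    "A3 = (\<lambda>i j. brk (- T) (\<lambda>p. prd (- (d2 + d3)) (\<lambda>q. t (x i) (x j) q) p (y j)) a (y i))"
  define A4 where
    "A4 = (\<lambda>i j. brk (- T) (\<lambda>p. prd (- (d2 + d3)) (\<lambda>q. t (x i) q (y j)) p (x j)) a (y i))"
  define B1 where
    "B1 = (\<lambda>i j. prd (- T) (\<lambda>p. brk (- (d1 + d3)) (\<lambda>q. t q (x i) (y j)) p (x j)) a (y i))"
  define B2 where
    "B2 = (\<lambda>i j. prd (- T) (\<lambda>p. brk (- (d1 + d3)) (\<lambda>q. t (x j) (x i) q) p (y j)) a (y i))"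
  define B3 where
    "B3 = (\<lambda>i j. prd (- T) (\<lambda>p. brk (- (d1 + d3)) (\<lambda>q. t q p (y j)) (y i) (x j)) a (x i))"
  define B4 where
    "B4 = (\<lambda>i j. prd (- T) (\<lambda>p. brk (- (d1 + d3)) (\<lambda>q. t (x j) p q) (y i) (y j)) a (x i))"
  define C1 where
    "C1 = (\<lambda>i j. prd (- T) (\<lambda>p. brk (- (d1 + d2)) (\<lambda>q. t q (y j) p) (x i) (x j)) a (y i))"
  define C2 where
    "C2 = (\<lambda>i j. prd (- T) (\<lambda>p. brk (- (d1 + d2)) (\<lambda>q. t (x j) q p) (x i) (y j)) a (y i))"
  define C3 where
    "C3 = (\<lambda>i j. prd (- T) (\<lambda>p. brk (- (d1 + d2)) (\<lambda>q. t q (y j) (y i)) p (x j)) a (x i))"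
  define C4 where
    "C4 = (\<lambda>i j. prd (- T) (\<lambda>p. brk (- (d1 + d2)) (\<lambda>q. t (x j) q (y i)) p (y j)) a (x i))"
  define L11 where
    "L11 = (\<lambda>i j. prd (- (d2 + d3)) (\<lambda>z. brk (- T) (\<lambda>q. t q (x j) z) a (x i)) (y i) (y j))"
  define L12 where
    "L12 = (\<lambda>i j. prd d3 (\<lambda>z. brk (- T) (\<lambda>q. t q z (y j)) a (x i)) (x j) (y i))"
  define L13 where
    "L13 = (\<lambda>i j. prd d2 (\<lambda>z. brk (- T) (\<lambda>q. t q (y i) (y j)) a z) (x i) (x j))"
  define K21 where
    "K21 = (\<lambda>i j. brk (- (d1 + d3)) (\<lambda>z. prd (- T) (\<lambda>q. t z q (y j)) a (y i)) (x i) (x j))"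
  define K22 where
    "K22 = (\<lambda>i j. brk d3 (\<lambda>z. prd (- T) (\<lambda>q. t (x i) q (y j)) a z) (x j) (y i))"
  define K23 where
    "K23 = (\<lambda>i j. brk (- (d1 + d3)) (\<lambda>z. prd (- T) (\<lambda>q. t (x i) q z) a (x j)) (y j) (y i))"
  define K31 where
    "K31 = (\<lambda>i j. brk d2 (\<lambda>z. prd (- T) (\<lambda>q. t z (y i) q) a (y j)) (x i) (x j))"
  define K32 where
    "K32 = (\<lambda>i j. brk (- (d1 + d2)) (\<lambda>z. prd (- T) (\<lambda>q. t (x i) z q) a (y j)) (x j) (y i))"
  define K33 where
    "K33 = (\<lambda>i j. brk d2 (\<lambda>z. prd (- T) (\<lambda>q. t (x i) (x j) q) a z) (y j) (y i))"
  note defs = A1_def A2_def A3_def A4_def B1_def B2_def B3_def B4_def C1_def C2_def C3_def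
    C4_def L11_def L12_def L13_def K21_def K22_def K23_def K31_def K32_def K33_def
  have L1: "S L11 - S L12 + S L13 = 0"
    using aybe [where t = "\<lambda>u v w. brk (- T) (\<lambda>q. t q v w) a u"
        and ?e1.0 = "d1 - T" and ?e2.0 = d2 and ?e3.0 = d3,
        OF acted_slots(1) acted_slots(2) acted_slots(3)]
    unfolding acted_weights by (simp add: defs acted_weights_sum sum_subtractf sum.distrib del: minus_add_distrib)
  have K2: "S K21 - S K22 - S K23 = 0"
    using cybe [where t = "\<lambda>u v w. prd (- T) (\<lambda>q. t u q w) a v"
        and ?e1.0 = d1 and ?e2.0 = "d2 - T" and ?e3.0 = d3,
        OF acted_slots(13) acted_slots(14) acted_slots(15)]
    unfolding acted_weights by (simp add: defs acted_weights_sum sum_subtractf del: minus_add_distrib)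
  have K3: "S K31 - S K32 - S K33 = 0"
    using cybe [where t = "\<lambda>u v w. prd (- T) (\<lambda>q. t u v q) a w"
        and ?e1.0 = d1 and ?e2.0 = d2 and ?e3.0 = "d3 - T",
        OF acted_slots(16) acted_slots(17) acted_slots(18)]
    unfolding acted_weights by (simp add: defs acted_weights_sum sum_subtractf del: minus_add_distrib)
  have A1: "A1 i j = L11 i j" for i j
    unfolding defs by (rule brk_prd_swap)
  have A2: "A2 i j = L12 i j" for i j
    unfolding defs commute_slots(2) [OF t2] by (rule brk_prd_swap)
  have C1: "C1 j i = - K31 i j" for i j
    unfolding defs skew_slots(3) [OF t1] C.eval_prod_fun_minus brk_prd_swap by (rule refl)
  have C2: "C2 j i = K32 i j" for i j
    unfolding defs by (rule brk_prd_swap [symmetric])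
  have B3: "S B3 = - S K21"
  proof -
    let ?f = "\<lambda>u v j. prd (- T) (\<lambda>p. brk (- (d1 + d3)) (\<lambda>q. t q p (y j)) v (x j)) a u"
    have "S (\<lambda>i j. ?f (x i) (y i) j) = - S (\<lambda>i j. ?f (y i) (x i) j)"
      by (rule double_sum_skew) (intro k_linear_intros linear1 linear2)+
    then show ?thesis
      unfolding defs by (simp only: brk_prd_swap)
  qed
  have B4: "B4 j i = K23 i j" for i j
    unfolding defs by (rule brk_prd_swap [symmetric])
  have B1: "S B1 = S C3 - S L13"
  proof -
    let ?f = "\<lambda>u v j. prd (- T) (\<lambda>p. brk (- (d1 + d3)) (\<lambda>q. t q u (y j)) p (x j)) a v"
    have "S (\<lambda>i j. ?f (x i) (y i) j) = - S (\<lambda>i j. ?f (y i) (x i) j)"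
      by (rule double_sum_skew) (intro k_linear_intros linear1 linear2)+
    moreover have "L13 i j = ?f (y i) (x i) j + C3 j i" for i j
      unfolding defs by (rule brk_product_right [OF t1]) (simp_all add: T)
    ultimately show ?thesis
      by (simp add: B1_def sum.distrib double_sum_swap [of C3])
  qed
  have C4: "C4 j i = K22 i j + A4 i j" for i j
    unfolding defs by (rule brk_product_left [OF t2]) (simp_all add: T)
  have B2: "B2 j i = K33 i j + A3 i j" for i j
    unfolding defs by (rule brk_product_left [OF t3]) (simp_all add: T)
  have expand: "cobracket_r T (\<lambda>u. coproduct_r (d2 + d3) (t u)) a = (S A1 - S A2) + (S A3 - S A4)"
    "coproduct_r T (\<lambda>u v. cobracket_r (d1 + d2) (\<lambda>p q. t p q v) u) a = (S C1 + S C2) - (S C3 + S C4)"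
    "coproduct_r T (\<lambda>u. cobracket_r (d1 + d3) (\<lambda>p. t p u)) a = (S B1 + S B2) - (S B3 + S B4)"
    by (simp_all only: cobracket_r_def cobracket_at_def coproduct_r_def coproduct_at_def eval_prod_linear
        sum.distrib sum_subtractf defs)
  have sums: "S A1 = S L11" "S A2 = S L12" "S C1 = - S K31" "S C2 = S K32" "S B4 = S K23"
      "S C4 = S K22 + S A4" "S B2 = S K33 + S A3"
    by (simp_all only: A1 A2 C1 C2 B4 C4 B2 sum_negf sum.distrib
      double_sum_swap [of K31, symmetric] double_sum_swap [of K32, symmetric] double_sum_swap [of K23, symmetric]
      double_sum_swap [of K22, symmetric] double_sum_swap [of A4, symmetric] double_sum_swap [of K33, symmetric]
      double_sum_swap [of A3, symmetric])
  have "S L12 = S L11 + S L13" "S K23 = S K21 - S K22" "S K33 = S K31 - S K32"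
    using L1 K2 K3 by (simp_all add: algebra_simps)
  then show ?thesis
    unfolding expand sums B1 B3 by simp
qed

end

end

section \<open>Commuting operators as a polynomial action\<close>

text \<open>
  The \<open>R[X]\<close>-module structure extending an \<open>R\<close>-module structure, in
  which \<open>X\<close> acts as the operator \<open>A\<close>.
\<close>

definition poly_act ::
  "('a::comm_ring_1 \<Rightarrow> 'm::ab_group_add \<Rightarrow> 'm) \<Rightarrow> ('m \<Rightarrow> 'm) \<Rightarrow> 'a poly \<Rightarrow> 'm \<Rightarrow> 'm"
  where "poly_act scl A p = fold_coeffs (\<lambda>c f m. scl c m + A (f m)) p (\<lambda>m. 0)"

locale poly_action = module scl
  for scl :: "'a::comm_ring_1 \<Rightarrow> 'm::ab_group_add \<Rightarrow> 'm" +
  fixes A :: "'m \<Rightarrow> 'm"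
  assumes A_add: "A (x + y) = A x + A y" and A_scale: "A (scl c x) = scl c (A x)"
begin

lemma A_0: "A 0 = 0"
  using A_add [of 0 0] by simp

lemma poly_act_0: "poly_act scl A 0 m = 0"
  by (simp add: poly_act_def)

lemma poly_act_pCons: "poly_act scl A (pCons c p) m = scl c m + A (poly_act scl A p m)"
  by (cases "p = 0 \<and> c = 0") (auto simp: poly_act_def A_0)

lemma poly_act_const: "poly_act scl A [:c:] m = scl c m"
  by (simp add: poly_act_pCons poly_act_0 A_0)

lemma poly_act_X: "poly_act scl A [:0, 1:] m = A m"
  by (simp add: poly_act_pCons poly_act_0 A_0)

lemma poly_act_commute:
  assumes B: "\<And>x y. B (x + y) = B x + B y" "\<And>c x. B (scl c x) = scl c (B x)"
    "\<And>x. B (A x) = A (B x)"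
  shows "B (poly_act scl A p m) = poly_act scl A p (B m)"
proof -
  have "B 0 = 0" using B(1) [of 0 0] by simp
  then show ?thesis by (induction p) (simp_all add: poly_act_0 poly_act_pCons B)
qed

lemma module_poly_act: "module (poly_act scl A)"
proof
  show add_right: "poly_act scl A p (x + y) = poly_act scl A p x + poly_act scl A p y" for p x y
    by (induction p) (simp_all add: poly_act_0 poly_act_pCons scale_right_distrib A_add algebra_simps)
  show add_left: "poly_act scl A (p + q) x = poly_act scl A p x + poly_act scl A q x" for p q x
    by (induction p q rule: poly_induct2)
       (simp_all add: poly_act_0 poly_act_pCons scale_left_distrib A_add algebra_simps)
  show "poly_act scl A 1 x = x" for x
    using poly_act_const [of 1] by (simp flip: one_pCons)
  have smult: "poly_act scl A (smult c q) x = scl c (poly_act scl A q x)" for c q x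
    by (induction q) (simp_all add: poly_act_0 poly_act_pCons scale_right_distrib A_scale)
  show "poly_act scl A p (poly_act scl A q x) = poly_act scl A (p * q) x" for p q x
    by (induction p)
       (simp_all add: poly_act_0 poly_act_pCons mult_pCons_left add_left smult)
qed

end

definition poly_act3 ::
  "('k::comm_ring_1 \<Rightarrow> 'm::ab_group_add \<Rightarrow> 'm) \<Rightarrow> ('m \<Rightarrow> 'm) \<Rightarrow> ('m \<Rightarrow> 'm) \<Rightarrow> ('m \<Rightarrow> 'm)
    \<Rightarrow> 'k poly poly poly \<Rightarrow> 'm \<Rightarrow> 'm"
  where "poly_act3 sk A1 A2 A3 = poly_act (poly_act (poly_act sk A1) A2) A3"

definition X1 :: "'k::comm_ring_1 poly poly poly" where "X1 = [:[:[:0, 1:]:]:]"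
definition X2 :: "'k::comm_ring_1 poly poly poly" where "X2 = [:[:0, 1:]:]"
definition X3 :: "'k::comm_ring_1 poly poly poly" where "X3 = [:0, 1:]"
definition const3 :: "'k::comm_ring_1 \<Rightarrow> 'k poly poly poly" where "const3 c = [:[:[:c:]:]:]"

lemma poly_act3:
  assumes sk: "module sk"
    and A1: "\<And>x y. A1 (x + y) = A1 x + A1 y" "\<And>c x. A1 (sk c x) = sk c (A1 x)"
    and A2: "\<And>x y. A2 (x + y) = A2 x + A2 y" "\<And>c x. A2 (sk c x) = sk c (A2 x)"
    and A3: "\<And>x y. A3 (x + y) = A3 x + A3 y" "\<And>c x. A3 (sk c x) = sk c (A3 x)"
    and comm: "\<And>x. A2 (A1 x) = A1 (A2 x)" "\<And>x. A3 (A1 x) = A1 (A3 x)" "\<And>x. A3 (A2 x) = A2 (A3 x)"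
  shows "module (poly_act3 sk A1 A2 A3)"
    "poly_act3 sk A1 A2 A3 X1 m = A1 m" "poly_act3 sk A1 A2 A3 X2 m = A2 m"
    "poly_act3 sk A1 A2 A3 X3 m = A3 m" "poly_act3 sk A1 A2 A3 (const3 c) m = sk c m"
proof -
  interpret P1: poly_action sk A1
    using sk A1 by (simp add: poly_action_def poly_action_axioms_def)
  interpret P2: poly_action "poly_act sk A1" A2
    using P1.module_poly_act A2 P1.poly_act_commute [of A2] comm
    by (simp add: poly_action_def poly_action_axioms_def)
  interpret P3: poly_action "poly_act (poly_act sk A1) A2" A3
    using P2.module_poly_act A3 P1.poly_act_commute [of A3] P2.poly_act_commute [of A3] comm
    by (simp add: poly_action_def poly_action_axioms_def)
  show "module (poly_act3 sk A1 A2 A3)"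
    unfolding poly_act3_def by (rule P3.module_poly_act)
  show "poly_act3 sk A1 A2 A3 X1 m = A1 m" "poly_act3 sk A1 A2 A3 X2 m = A2 m"
    "poly_act3 sk A1 A2 A3 X3 m = A3 m" "poly_act3 sk A1 A2 A3 (const3 c) m = sk c m"
    by (simp_all add: poly_act3_def X1_def X2_def X3_def const3_def P1.poly_act_X P2.poly_act_X
        P3.poly_act_X P1.poly_act_const P2.poly_act_const P3.poly_act_const)
qed


section \<open>Derivations of tensor factors on the whole function space\<close>

text \<open>
  The derivations of the factors in \<open>der_tens2\<close>, \<open>der3_1\<close>,
  \<open>der3_2\<close>, \<open>der3_3\<close> are linear only on the tensor space. Elements of
  tensor powers being functionals on multilinear forms, precomposition with \<open>\<phi> B =
  B(\<partial> \<cdot>, \<cdot>)\<close> and its analogues gives operators that are linear and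
  commute on all functionals. The guard \<open>Q\<close> (multilinearity) is needed for
  agreement on pure tensors, which vanish outside multilinear forms: \<open>\<phi> B\<close> may
  be multilinear although \<open>B\<close> is not.
\<close>

definition guarded_precomp :: "('b \<Rightarrow> bool) \<Rightarrow> ('b \<Rightarrow> 'b) \<Rightarrow> ('b \<Rightarrow> 'k::field) \<Rightarrow> 'b \<Rightarrow> 'k"
  where "guarded_precomp Q \<phi> t = (\<lambda>B. if Q B then t (\<phi> B) else 0)"

lemma guarded_precomp_add: "guarded_precomp Q \<phi> (t + t') = guarded_precomp Q \<phi> t + guarded_precomp Q \<phi> t'"
  by (simp add: guarded_precomp_def fun_eq_iff)

lemma guarded_precomp_0: "guarded_precomp Q \<phi> 0 = 0"
  by (simp add: guarded_precomp_def fun_eq_iff)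

lemma guarded_precomp_tscale: "guarded_precomp Q \<phi> (tscale c t) = tscale c (guarded_precomp Q \<phi> t)"
  by (simp add: guarded_precomp_def tscale_def fun_eq_iff)

lemma guarded_precomp_commute:
  assumes "\<And>B. Q B \<Longrightarrow> Q (\<phi> B)" "\<And>B. Q B \<Longrightarrow> Q (\<psi> B)" "\<And>B. \<phi> (\<psi> B) = \<psi> (\<phi> B)"
  shows "guarded_precomp Q \<phi> (guarded_precomp Q \<psi> t) = guarded_precomp Q \<psi> (guarded_precomp Q \<phi> t)"
  using assms by (simp add: guarded_precomp_def fun_eq_iff)

text \<open>
  The flag here and the index in the next definition select the factor to be differentiated.
\<close>

definition der2_ext :: "('k::field poly \<Rightarrow> 'p::ab_group_add \<Rightarrow> 'p) \<Rightarrow> bool \<Rightarrow> ('k, 'p) tens2 \<Rightarrow> ('k, 'p) tens2"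
  where "der2_ext s first = guarded_precomp (bilin (kscale s) (kscale s) (*))
    (\<lambda>B u v. if first then B (der s u) v else B u (der s v))"

definition der3_ext :: "('k::field poly \<Rightarrow> 'p::ab_group_add \<Rightarrow> 'p) \<Rightarrow> nat \<Rightarrow> ('k, 'p) tens3 \<Rightarrow> ('k, 'p) tens3"
  where "der3_ext s i = guarded_precomp (trilin (kscale s) (kscale s) (kscale s) (*))
    (\<lambda>B u v w. if i = 1 then B (der s u) v w else if i = 2 then B u (der s v) w else B u v (der s w))"

context fg_diff_module
begin

lemma der_linear: "Vector_Spaces.linear (kscale s) (kscale s) (der s)"
  unfolding linear_iff_add_scale
  using vector_space_kscale [OF module_axioms]
  by (simp add: der_def kscale_def scale_right_distrib mult.commute)

lemma der_add: "der s (u + v) = der s u + der s v"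
  and der_kscale: "der s (kscale s c u) = kscale s c (der s u)"
  using der_linear by (simp_all add: linear_iff_add_scale)

lemma der2_ext_tensor2: "der2_ext s True (tensor2 s u v) = tensor2 s (der s u) v"
    "der2_ext s False (tensor2 s u v) = tensor2 s u (der s v)"
  and der2_ext_commute: "der2_ext s i (der2_ext s j t) = der2_ext s j (der2_ext s i t)"
proof -
  have closed: "bilin (kscale s) (kscale s) (*) (\<lambda>u v. if i then B (der s u) v else B u (der s v))"
    if "bilin (kscale s) (kscale s) (*) B" for B :: "'p \<Rightarrow> 'p \<Rightarrow> 'k" and i
    using that by (auto simp: bilin_def linear_iff_add_scale der_add der_kscale)
  show "der2_ext s True (tensor2 s u v) = tensor2 s (der s u) v"
    "der2_ext s False (tensor2 s u v) = tensor2 s u (der s v)"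
    using closed [of _ True] closed [of _ False] by (auto simp: der2_ext_def guarded_precomp_def tensor2_def fun_eq_iff)
  show "der2_ext s i (der2_ext s j t) = der2_ext s j (der2_ext s i t)"
    unfolding der2_ext_def by (rule guarded_precomp_commute) (auto simp: fun_eq_iff closed)
qed

lemma der3_ext_tensor3: "der3_ext s 1 (tensor3 s u v w) = tensor3 s (der s u) v w"
    "der3_ext s 2 (tensor3 s u v w) = tensor3 s u (der s v) w"
    "der3_ext s 3 (tensor3 s u v w) = tensor3 s u v (der s w)"
  and der3_ext_commute: "der3_ext s i (der3_ext s j t) = der3_ext s j (der3_ext s i t)"
proof -
  let ?\<phi> = "\<lambda>i B u v w. if i = (1 :: nat) then B (der s u) v w
     else if i = 2 then B u (der s v) w else B u v (der s w)"
  have closed: "trilin (kscale s) (kscale s) (kscale s) (*) (?\<phi> i B)"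
    if "trilin (kscale s) (kscale s) (kscale s) (*) B" for B :: "'p \<Rightarrow> 'p \<Rightarrow> 'p \<Rightarrow> 'k" and i
    using that by (auto simp: trilin_def linear_iff_add_scale der_add der_kscale)
  show "der3_ext s 1 (tensor3 s u v w) = tensor3 s (der s u) v w"
    "der3_ext s 2 (tensor3 s u v w) = tensor3 s u (der s v) w"
    "der3_ext s 3 (tensor3 s u v w) = tensor3 s u v (der s w)"
    using closed [of _ 1] closed [of _ 2] closed [of _ 3]
    by (auto simp: der3_ext_def guarded_precomp_def tensor3_def fun_eq_iff)
  show "der3_ext s i (der3_ext s j t) = der3_ext s j (der3_ext s i t)"
    unfolding der3_ext_def
    by (rule guarded_precomp_commute) (rule closed, assumption, rule closed, assumption, simp add: fun_eq_iff)
qed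

end

section \<open>Linear maps out of tensor powers\<close>

lemma interval_sum_list: "(\<Sum>i\<leftarrow>[0..<n]. f i) = (\<Sum>i<n. f i)" for f :: "nat \<Rightarrow> 'a::comm_monoid_add"
  by (simp add: interv_sum_list_conv_sum_set_nat atLeast0LessThan)

lemma tensor_space2E:
  assumes "t \<in> tensor_space2 s"
  obtains x y and n :: nat where "t = (\<Sum>i<n. tensor2 s (x i) (y i))"
proof -
  from assms obtain xs where t: "t = (\<Sum>(u, v)\<leftarrow>xs. tensor2 s u v)"
    unfolding tensor_space2_def by blast
  have "t = (\<Sum>i<length xs. tensor2 s (fst (xs ! i)) (snd (xs ! i)))"
    unfolding t by (subst sum_list_sum_nth) (simp add: case_prod_unfold atLeast0LessThan)
  then show ?thesis by (rule that)
qed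

lemma tensor_space3E:
  assumes "t \<in> tensor_space3 s"
  obtains x y z and n :: nat where "t = (\<Sum>i<n. tensor3 s (x i) (y i) (z i))"
proof -
  from assms obtain xs where t: "t = (\<Sum>(u, v, w)\<leftarrow>xs. tensor3 s u v w)"
    unfolding tensor_space3_def by blast
  have "t = (\<Sum>i<length xs. tensor3 s (fst (xs ! i)) (fst (snd (xs ! i))) (snd (snd (xs ! i))))"
    unfolding t by (subst sum_list_sum_nth) (simp add: case_prod_unfold atLeast0LessThan)
  then show ?thesis by (rule that)
qed

lemma tensor2_mem: "tensor2 s u v \<in> tensor_space2 s"
  unfolding tensor_space2_def by (rule range_eqI [of _ _ "[(u, v)]"]) simp

lemma tensor3_mem: "tensor3 s u v w \<in> tensor_space3 s"
  unfolding tensor_space3_def by (rule range_eqI [of _ _ "[(u, v, w)]"]) simp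

lemma tensor_space2_0: "0 \<in> tensor_space2 s"
  unfolding tensor_space2_def by (rule range_eqI [of _ _ "[]"]) simp

lemma tensor_space3_0: "0 \<in> tensor_space3 s"
  unfolding tensor_space3_def by (rule range_eqI [of _ _ "[]"]) simp

lemma tensor_space2_add:
  assumes "t \<in> tensor_space2 s" "t' \<in> tensor_space2 s"
  shows "t + t' \<in> tensor_space2 s"
proof -
  from assms obtain xs ys where "t = (\<Sum>(u, v)\<leftarrow>xs. tensor2 s u v)" "t' = (\<Sum>(u, v)\<leftarrow>ys. tensor2 s u v)"
    unfolding tensor_space2_def by auto
  then show ?thesis
    unfolding tensor_space2_def by (intro range_eqI [of _ _ "xs @ ys"]) simp
qed

lemma tensor_space3_add:
  assumes "t \<in> tensor_space3 s" "t' \<in> tensor_space3 s"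
  shows "t + t' \<in> tensor_space3 s"
proof -
  from assms obtain xs ys where
    "t = (\<Sum>(u, v, w)\<leftarrow>xs. tensor3 s u v w)" "t' = (\<Sum>(u, v, w)\<leftarrow>ys. tensor3 s u v w)"
    unfolding tensor_space3_def by auto
  then show ?thesis
    unfolding tensor_space3_def by (intro range_eqI [of _ _ "xs @ ys"]) simp
qed

lemma tlift2_sum_lessThan:
  fixes n :: nat
  assumes "bilin (kscale s) (kscale s) sw f"
  shows "tlift2 s f (\<Sum>i<n. tensor2 s (x i) (y i)) = (\<Sum>i<n. f (x i) (y i))"
  using tlift2_sum [OF assms, of "map (\<lambda>i. (x i, y i)) [0..<n]"]
  by (simp add: interval_sum_list comp_def)

lemma tlift3_sum_lessThan:
  fixes n :: nat
  assumes "trilin (kscale s) (kscale s) (kscale s) sw f"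
  shows "tlift3 s f (\<Sum>i<n. tensor3 s (x i) (y i) (z i)) = (\<Sum>i<n. f (x i) (y i) (z i))"
  using tlift3_sum [OF assms, of "map (\<lambda>i. (x i, y i, z i)) [0..<n]"]
  by (simp add: interval_sum_list comp_def)

lemma sum_closed:
  assumes "0 \<in> S" "\<And>x y. x \<in> S \<Longrightarrow> y \<in> S \<Longrightarrow> x + y \<in> S" "\<And>i. f i \<in> S"
  shows "(\<Sum>i\<in>I. f i) \<in> S"
  using assms by (induction I rule: infinite_finite_induct) auto

lemma additive_on_sum:
  assumes S: "0 \<in> S" "\<And>x y. x \<in> S \<Longrightarrow> y \<in> S \<Longrightarrow> x + y \<in> S"
    and G: "\<And>x y. x \<in> S \<Longrightarrow> y \<in> S \<Longrightarrow> G (x + y) = (G x + G y :: 'b::ab_group_add)"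
    and f: "\<And>i. f i \<in> S"
  shows "G (\<Sum>i\<in>I. f i) = (\<Sum>i\<in>I. G (f i))"
proof -
  have "G 0 = 0" using G [OF S(1) S(1)] by simp
  then show ?thesis
    by (induction I rule: infinite_finite_induct) (simp_all add: G f sum_closed [OF S f])
qed

lemma tlift2_mem:
  assumes f: "bilin (kscale s) (kscale s) sw f"
    and S: "0 \<in> S" "\<And>x y. x \<in> S \<Longrightarrow> y \<in> S \<Longrightarrow> x + y \<in> S" "\<And>u v. f u v \<in> S"
    and w: "w \<in> tensor_space2 s"
  shows "tlift2 s f w \<in> S"
proof -
  from w obtain x y and n :: nat where w: "w = (\<Sum>i<n. tensor2 s (x i) (y i))" by (rule tensor_space2E)
  show ?thesis unfolding w tlift2_sum_lessThan [OF f] by (rule sum_closed [OF S])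
qed

lemma tlift3_mem:
  assumes f: "trilin (kscale s) (kscale s) (kscale s) sw f"
    and S: "0 \<in> S" "\<And>x y. x \<in> S \<Longrightarrow> y \<in> S \<Longrightarrow> x + y \<in> S" "\<And>u v w. f u v w \<in> S"
    and t: "t \<in> tensor_space3 s"
  shows "tlift3 s f t \<in> S"
proof -
  from t obtain x y z and n :: nat where t: "t = (\<Sum>i<n. tensor3 s (x i) (y i) (z i))"
    by (rule tensor_space3E)
  show ?thesis unfolding t tlift3_sum_lessThan [OF f] by (rule sum_closed [OF S])
qed

text \<open>
  Linear maps out of \<open>P \<otimes> P\<close> can be composed with a map \<open>G\<close>
  that is additive merely on a set containing the values.
\<close>

lemma tlift2_compose:
  assumes f: "bilin (kscale s) (kscale s) sw f"
    and Gf: "bilin (kscale s) (kscale s) sw' (\<lambda>u v. G (f u v))"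
    and S: "0 \<in> S" "\<And>x y. x \<in> S \<Longrightarrow> y \<in> S \<Longrightarrow> x + y \<in> S"
    and G: "\<And>x y. x \<in> S \<Longrightarrow> y \<in> S \<Longrightarrow> G (x + y) = G x + G y"
    and mem: "\<And>u v. f u v \<in> S" and w: "w \<in> tensor_space2 s"
  shows "G (tlift2 s f w) = tlift2 s (\<lambda>u v. G (f u v)) w"
proof -
  from w obtain x y and n :: nat where w: "w = (\<Sum>i<n. tensor2 s (x i) (y i))" by (rule tensor_space2E)
  show ?thesis
    unfolding w tlift2_sum_lessThan [OF f] tlift2_sum_lessThan [OF Gf]
    by (rule additive_on_sum [OF S G mem])
qed

context fg_diff_module
begin

lemma tensor2_linear:
  "tensor2 s (u + u') v = tensor2 s u v + tensor2 s u' v"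
  "tensor2 s u (v + v') = tensor2 s u v + tensor2 s u v'"
  "tensor2 s (kscale s c u) v = tscale c (tensor2 s u v)"
  "tensor2 s u (kscale s c v) = tscale c (tensor2 s u v)"
  using bilin_tensor2 [OF module_axioms] by (simp_all add: bilin_def linear_iff_add_scale)

lemma tensor3_linear:
  "tensor3 s (u + u') v w = tensor3 s u v w + tensor3 s u' v w"
  "tensor3 s u (v + v') w = tensor3 s u v w + tensor3 s u v' w"
  "tensor3 s u v (w + w') = tensor3 s u v w + tensor3 s u v w'"
  "tensor3 s (kscale s c u) v w = tscale c (tensor3 s u v w)"
  "tensor3 s u (kscale s c v) w = tscale c (tensor3 s u v w)"
  "tensor3 s u v (kscale s c w) = tscale c (tensor3 s u v w)"
  using trilin_tensor3 [OF module_axioms] by (simp_all add: trilin_def linear_iff_add_scale)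

lemma tensor2_0: "tensor2 s 0 v = 0" "tensor2 s u 0 = 0"
  using tensor2_linear(1) [of 0 0 v] tensor2_linear(2) [of u 0 0] by simp_all

lemma tensor3_0: "tensor3 s 0 v w = 0" "tensor3 s u 0 w = 0" "tensor3 s u v 0 = 0"
  using tensor3_linear(1) [of 0 0 v w] tensor3_linear(2) [of u 0 0 w] tensor3_linear(3) [of u v 0 0]
  by simp_all

lemma tscale_add: "tscale c (t + t') = tscale c t + tscale c t'"
  by (simp add: tscale_def fun_eq_iff algebra_simps)

lemma tscale_minus_1: "- t = tscale (-1 :: 'k) t"
  by (simp add: tscale_def fun_eq_iff)

lemma tensor_space2_minus: "t \<in> tensor_space2 s \<Longrightarrow> - t \<in> tensor_space2 s"
  unfolding tscale_minus_1
  using tensor2_universal(3) [OF bilin_tensor2 [OF module_axioms] module_axioms] by blast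

lemma tensor_space3_minus: "t \<in> tensor_space3 s \<Longrightarrow> - t \<in> tensor_space3 s"
  unfolding tscale_minus_1
  using tensor3_universal(3) [OF trilin_tensor3 [OF module_axioms] module_axioms] by blast

lemma bilin_der_tens2:
  "bilin (kscale s) (kscale s) tscale (\<lambda>u v. tensor2 s (der s u) v + tensor2 s u (der s v))"
  unfolding bilin_def linear_iff_add_scale
  using vector_space_kscale [OF module_axioms] vector_space_tscale
  by (simp add: tensor2_linear der_add der_kscale tscale_add algebra_simps)

lemma trilin_der3:
  "trilin (kscale s) (kscale s) (kscale s) tscale (\<lambda>u v w. tensor3 s (der s u) v w)"
  "trilin (kscale s) (kscale s) (kscale s) tscale (\<lambda>u v w. tensor3 s u (der s v) w)"
  "trilin (kscale s) (kscale s) (kscale s) tscale (\<lambda>u v w. tensor3 s u v (der s w))"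
  "trilin (kscale s) (kscale s) (kscale s) tscale (\<lambda>u v w. tensor3 s v u w)"
  unfolding trilin_def linear_iff_add_scale
  using vector_space_kscale [OF module_axioms] vector_space_tscale
  by (simp_all add: tensor3_linear der_add der_kscale)

lemma der_tens2_mem: "t \<in> tensor_space2 s \<Longrightarrow> der_tens2 s t \<in> tensor_space2 s"
  unfolding der_tens2_def
  by (rule tlift2_mem [OF bilin_der_tens2]) (auto intro: tensor_space2_0 tensor_space2_add tensor2_mem)

lemma der3_mem:
  assumes "t \<in> tensor_space3 s"
  shows "der3_1 s t \<in> tensor_space3 s" "der3_2 s t \<in> tensor_space3 s" "der3_3 s t \<in> tensor_space3 s"
  unfolding der3_1_def der3_2_def der3_3_def
  by (rule tlift3_mem [OF trilin_der3(1)] tlift3_mem [OF trilin_der3(2)] tlift3_mem [OF trilin_der3(3)];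
      intro tensor_space3_0 tensor_space3_add tensor3_mem assms; assumption)+

end

context conformal_evaluation
begin

lemma bilinI: "(\<And>v. k_linear (\<lambda>u. f u v)) \<Longrightarrow> (\<And>u. k_linear (f u)) \<Longrightarrow>
    bilin (kscale s) (kscale s) (\<lambda>c. scl (\<kappa> c)) f"
  by (simp add: bilin_def k_linear_def)

lemma trilinI: "(\<And>v w. k_linear (\<lambda>u. f u v w)) \<Longrightarrow> (\<And>u w. k_linear (\<lambda>v. f u v w)) \<Longrightarrow>
    (\<And>u v. k_linear (f u v)) \<Longrightarrow>
    trilin (kscale s) (kscale s) (kscale s) (\<lambda>c. scl (\<kappa> c)) f"
  by (simp add: trilin_def k_linear_def)

context
  fixes t :: "'p \<Rightarrow> 'p \<Rightarrow> 'm" and d1 d2 :: 'r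
  assumes t1: "\<And>v. slot d1 (\<lambda>u. t u v)" and t2: "\<And>u. slot d2 (t u)"
begin

lemma bilin_slots: "bilin (kscale s) (kscale s) (\<lambda>c. scl (\<kappa> c)) t"
  using t1 t2 by (intro bilinI) blast+

lemma tlift2_der_tens2:
  assumes "w \<in> tensor_space2 s"
  shows "tlift2 s t (der_tens2 s w) = scl (d1 + d2) (tlift2 s t w)"
proof -
  from assms obtain x y and n :: nat where w: "w = (\<Sum>i<n. tensor2 s (x i) (y i))" by (rule tensor_space2E)
  have *: "tlift2 s t (tensor2 s (der s u) v + tensor2 s u (der s v)) = scl (d1 + d2) (t u v)" for u v
    using t1 t2 tensor2_universal(1,2) [OF bilin_slots]
    by (simp add: tensor2_mem slot_def M.scale_left_distrib)
  show ?thesis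
    unfolding w der_tens2_def tlift2_sum_lessThan [OF bilin_der_tens2] tlift2_sum_lessThan [OF bilin_slots]
    by (subst additive_on_sum [where S = "tensor_space2 s"])
       (auto simp: * M.scale_sum_right tensor2_universal(2) [OF bilin_slots]
         intro: tensor_space2_0 tensor_space2_add tensor2_mem)
qed

end

context
  fixes t :: "'p \<Rightarrow> 'p \<Rightarrow> 'p \<Rightarrow> 'm" and d1 d2 d3 :: 'r
  assumes t1: "\<And>v w. slot d1 (\<lambda>u. t u v w)" and t2: "\<And>u w. slot d2 (\<lambda>v. t u v w)"
    and t3: "\<And>u v. slot d3 (\<lambda>w. t u v w)"
begin

lemma trilin_slots: "trilin (kscale s) (kscale s) (kscale s) (\<lambda>c. scl (\<kappa> c)) t"
  using t1 t2 t3 by (intro trilinI) blast+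

lemma tlift3_der3:
  assumes "w \<in> tensor_space3 s"
  shows "tlift3 s t (der3_1 s w) = scl d1 (tlift3 s t w)"
    "tlift3 s t (der3_2 s w) = scl d2 (tlift3 s t w)"
    "tlift3 s t (der3_3 s w) = scl d3 (tlift3 s t w)"
    "tlift3 s t (der_tens3 s w) = scl (d1 + d2 + d3) (tlift3 s t w)"
proof -
  from assms obtain x y z and n :: nat where w: "w = (\<Sum>i<n. tensor3 s (x i) (y i) (z i))" by (rule tensor_space3E)
  note add = tensor3_universal(2) [OF trilin_slots]
  have lift: "tlift3 s t (\<Sum>i<n. tensor3 s (f i) (g i) (h i)) = (\<Sum>i<n. t (f i) (g i) (h i))" for f g h
    by (rule tlift3_sum_lessThan [OF trilin_slots])
  show 1: "tlift3 s t (der3_1 s w) = scl d1 (tlift3 s t w)"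
    using t1 unfolding w der3_1_def tlift3_sum_lessThan [OF trilin_der3(1)] lift
    by (simp add: slot_def M.scale_sum_right)
  show 2: "tlift3 s t (der3_2 s w) = scl d2 (tlift3 s t w)"
    using t2 unfolding w der3_2_def tlift3_sum_lessThan [OF trilin_der3(2)] lift
    by (simp add: slot_def M.scale_sum_right)
  show 3: "tlift3 s t (der3_3 s w) = scl d3 (tlift3 s t w)"
    using t3 unfolding w der3_3_def tlift3_sum_lessThan [OF trilin_der3(3)] lift
    by (simp add: slot_def M.scale_sum_right)
  show "tlift3 s t (der_tens3 s w) = scl (d1 + d2 + d3) (tlift3 s t w)"
    unfolding der_tens3_def
    by (simp add: add der3_mem assms tensor_space3_add 1 2 3 M.scale_left_distrib)
qed

end

end

section \<open>Linear maps applied to the coboundary coproducts\<close>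

lemma vector_space_map_tscale:
  "vector_space (\<lambda>c. map_poly (tscale c) :: ('b \<Rightarrow> 'k::field) poly \<Rightarrow> ('b \<Rightarrow> 'k) poly)"
proof -
  interpret V: vector_space "tscale :: 'k \<Rightarrow> ('b \<Rightarrow> 'k) \<Rightarrow> 'b \<Rightarrow> 'k" by (rule vector_space_tscale)
  show ?thesis
    by unfold_locales
       (simp_all add: poly_eq_iff coeff_map_poly V.scale_right_distrib V.scale_left_distrib)
qed

context fg_diff_module
begin

definition tensor_polys :: "('k, 'p) tens2 poly set"
  where "tensor_polys = {q. \<forall>k. coeff q k \<in> tensor_space2 s}"

lemma tensor_polys_closed: "0 \<in> tensor_polys" "p \<in> tensor_polys \<Longrightarrow> q \<in> tensor_polys \<Longrightarrow> p + q \<in> tensor_polys"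
  by (simp_all add: tensor_polys_def tensor_space2_0 tensor_space2_add)

lemma psubst_der_mem:
  assumes "q \<in> tensor_polys"
  shows "psubst (\<lambda>w. - der_tens2 s w) q \<in> tensor_space2 s"
proof (rule psubst_closed)
  show "coeff q k \<in> tensor_space2 s" for k
    using assms by (simp add: tensor_polys_def)
qed (intro tensor_space2_0 tensor_space2_add tensor_space2_minus der_tens2_mem; assumption)+

lemma tensor_polys_minus: "q \<in> tensor_polys \<Longrightarrow> - q \<in> tensor_polys"
  using tensor_space2_minus by (simp only: tensor_polys_def coeff_minus mem_Collect_eq) blast

end

context conformal_evaluation
begin

lemma ev_tlift2_add:
  assumes t: "\<And>v. k_linear (\<lambda>u. t u v)" "\<And>u. k_linear (t u)" and pq: "p \<in> tensor_polys" "q \<in> tensor_polys"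
  shows "ev scl \<alpha> (tlift2 s t) (p + q) = ev scl \<alpha> (tlift2 s t) p + ev scl \<alpha> (tlift2 s t) q"
proof (rule M.ev_add_on)
  note add = tensor2_universal(2) [OF bilinI [OF t]]
  show "tlift2 s t 0 = 0" using add [OF tensor_space2_0 tensor_space2_0] by simp
  show "tlift2 s t (coeff p k + coeff q k) = tlift2 s t (coeff p k) + tlift2 s t (coeff q k)" for k
    using pq by (intro add) (simp_all add: tensor_polys_def)
qed

lemma tlift2_minus:
  assumes t: "\<And>v. k_linear (\<lambda>u. t u v)" "\<And>u. k_linear (t u)" and w: "w \<in> tensor_space2 s"
  shows "tlift2 s t (- w) = - tlift2 s t w"
proof -
  note add = tensor2_universal(2) [OF bilinI [OF t]]
  have "tlift2 s t 0 = 0" using add [OF tensor_space2_0 tensor_space2_0] by simp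
  then show ?thesis
    using add [OF w tensor_space2_minus [OF w]] by (simp add: eq_neg_iff_add_eq_0 add.commute)
qed

end

context conformal_product_evaluation
begin

lemma bilin_lam:
  "bilin (kscale s) (kscale s) (\<lambda>c. map_poly (tscale c)) (\<lambda>u v. map_poly (\<lambda>x. tensor2 s x v) (m a u))"
  "bilin (kscale s) (kscale s) (\<lambda>c. map_poly (tscale c)) (\<lambda>u v. map_poly (\<lambda>x. tensor2 s u x) (m a v))"
proof -
  have 0: "tscale c (0 :: ('k, 'p) tens2) = 0" for c
    by (simp add: tscale_def fun_eq_iff)
  show
    "bilin (kscale s) (kscale s) (\<lambda>c. map_poly (tscale c)) (\<lambda>u v. map_poly (\<lambda>x. tensor2 s x v) (m a u))"
    "bilin (kscale s) (kscale s) (\<lambda>c. map_poly (tscale c)) (\<lambda>u v. map_poly (\<lambda>x. tensor2 s u x) (m a v))"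
    unfolding bilin_def linear_iff_add_scale
    using vector_space_kscale [OF module_axioms] vector_space_map_tscale
    by (simp_all add: m_add m_scale poly_eq_iff coeff_map_poly tensor2_linear tensor2_0 kscale_0 0)
qed

lemma lam_mem:
  assumes "w \<in> tensor_space2 s"
  shows "lam_left s (m a) w \<in> tensor_polys" "lam_right s (m a) w \<in> tensor_polys"
proof -
  have mem: "map_poly (\<lambda>x. tensor2 s x v) p \<in> tensor_polys" "map_poly (tensor2 s u) p \<in> tensor_polys" for u v p
    by (simp_all add: tensor_polys_def coeff_map_poly tensor2_0 tensor2_mem)
  show "lam_left s (m a) w \<in> tensor_polys"
    unfolding lam_left_def by (rule tlift2_mem [OF bilin_lam(1)]) (simp_all add: tensor_polys_closed mem assms)
  show "lam_right s (m a) w \<in> tensor_polys"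
    unfolding lam_right_def by (rule tlift2_mem [OF bilin_lam(2)]) (simp_all add: tensor_polys_closed mem assms)
qed

context
  fixes t :: "'p \<Rightarrow> 'p \<Rightarrow> 'm"
  assumes t1: "\<And>v. k_linear (\<lambda>u. t u v)" and t2: "\<And>u. k_linear (t u)"
begin

text \<open>
  For \<open>T\<^sub>\<lambda>\<close> the left multiplication by \<open>a\<close>, evaluating
  \<open>T\<^sub>\<lambda> \<otimes> I\<close> or \<open>I \<otimes> T\<^sub>\<lambda>\<close>
  through \<open>t\<close> amounts to replacing \<open>t\<close> by the bilinear map in which
  \<open>a\<close> acts on one of the arguments.
\<close>

lemma ev_lam:
  assumes w: "w \<in> tensor_space2 s"
  shows "ev scl \<alpha> (tlift2 s t) (lam_left s (m a) w) = tlift2 s (\<lambda>u v. eval_prod \<alpha> (\<lambda>x. t x v) a u) w"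
    "ev scl \<alpha> (tlift2 s t) (lam_right s (m a) w) = tlift2 s (\<lambda>u v. eval_prod \<alpha> (\<lambda>x. t u x) a v) w"
proof -
  note bil = bilinI [OF t1 t2]
  have t0: "tlift2 s t 0 = 0"
    using tensor2_universal(2) [OF bil tensor_space2_0 tensor_space2_0] by simp
  have l: "ev scl \<alpha> (tlift2 s t) (map_poly (\<lambda>x. tensor2 s x v) (m a u)) = eval_prod \<alpha> (\<lambda>x. t x v) a u" for u v
    by (simp add: M.ev_map_poly tensor2_0 t0 tensor2_universal(1) [OF bil] eval_prod_def)
  have r: "ev scl \<alpha> (tlift2 s t) (map_poly (\<lambda>x. tensor2 s u x) (m a v)) = eval_prod \<alpha> (\<lambda>x. t u x) a v" for u v
    by (simp add: M.ev_map_poly tensor2_0 t0 tensor2_universal(1) [OF bil] eval_prod_def)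
  have mem: "map_poly (\<lambda>x. tensor2 s x v) p \<in> tensor_polys" "map_poly (tensor2 s u) p \<in> tensor_polys" for u v p
    by (simp_all add: tensor_polys_def coeff_map_poly tensor2_0 tensor2_mem)
  have "bilin (kscale s) (kscale s) (\<lambda>c. scl (\<kappa> c)) (\<lambda>u v. eval_prod \<alpha> (\<lambda>x. t x v) a u)"
    by (intro bilinI k_linear_eval_prod_right k_linear_eval_prod_arg t1 t2)
  then show "ev scl \<alpha> (tlift2 s t) (lam_left s (m a) w) = tlift2 s (\<lambda>u v. eval_prod \<alpha> (\<lambda>x. t x v) a u) w"
    unfolding lam_left_def
    by (subst tlift2_compose [OF bilin_lam(1), where S = tensor_polys]) (simp_all add: l tensor_polys_closed ev_tlift2_add [OF t1 t2] mem w)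
  have "bilin (kscale s) (kscale s) (\<lambda>c. scl (\<kappa> c)) (\<lambda>u v. eval_prod \<alpha> (t u) a v)"
    by (intro bilinI k_linear_eval_prod_right k_linear_eval_prod_arg t1 t2)
  then show "ev scl \<alpha> (tlift2 s t) (lam_right s (m a) w) = tlift2 s (\<lambda>u v. eval_prod \<alpha> (\<lambda>x. t u x) a v) w"
    unfolding lam_right_def
    by (subst tlift2_compose [OF bilin_lam(2), where S = tensor_polys]) (simp_all add: r tensor_polys_closed ev_tlift2_add [OF t1 t2] mem w)
qed

end

lemma tlift2_psubst_der:
  assumes t1: "\<And>v. slot d1 (\<lambda>u. t u v)" and t2: "\<And>u. slot d2 (t u)" and q: "q \<in> tensor_polys"
  shows "tlift2 s t (psubst (\<lambda>w. - der_tens2 s w) q) = ev scl (- (d1 + d2)) (tlift2 s t) q"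
proof (rule M.ev_psubst_on [where S = "tensor_space2 s"])
  have k: "k_linear (\<lambda>u. t u v)" "k_linear (t u)" for u v using t1 t2 by blast+
  show "tlift2 s t (- der_tens2 s w) = scl (- (d1 + d2)) (tlift2 s t w)" if "w \<in> tensor_space2 s" for w
    by (simp only: tlift2_minus [OF k der_tens2_mem [OF that]] tlift2_der_tens2 [OF t1 t2 that]
        M.scale_minus_left)
  show "tlift2 s t (w + w') = tlift2 s t w + tlift2 s t w'"
    if "w \<in> tensor_space2 s" "w' \<in> tensor_space2 s" for w w'
    using that by (rule tensor2_universal(2) [OF bilinI [OF k]])
  show "coeff q k \<in> tensor_space2 s" for k
    using q by (simp add: tensor_polys_def)
qed (intro tensor_space2_0 tensor_space2_add tensor_space2_minus der_tens2_mem; assumption)+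

end

context coboundary_evaluation
begin

abbreviation r :: "('k, 'p) tens2"
  where "r \<equiv> \<Sum>i<n. tensor2 s (x i) (y i)"

lemma r_mem: "r \<in> tensor_space2 s"
  by (intro sum_closed tensor_space2_0 tensor_space2_add tensor2_mem)

lemma coboundary_mem:
  "coboundary_cobracket s br r a \<in> tensor_space2 s" "coboundary_coproduct s mul r a \<in> tensor_space2 s"
  unfolding coboundary_cobracket_def coboundary_coproduct_def diff_conv_add_uminus
  by (intro psubst_der_mem tensor_polys_closed tensor_polys_minus B.lam_mem C.lam_mem r_mem)+

text \<open>
  A coproduct \<open>f\<close> is represented by \<open>F\<close> if the linear map induced by a
  bilinear \<open>t\<close> of total weight \<open>e\<close> takes \<open>f(a)\<close> to
  \<open>F e t a\<close>. The last two conditions say that \<open>F e t a\<close> has weight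
  \<open>e\<close> in \<open>a\<close> and inherits the weight of any parameter of
  \<open>t\<close>, which is what is needed to represent iterated coproducts.
\<close>

definition represents ::
  "('p \<Rightarrow> ('k, 'p) tens2) \<Rightarrow> ('r \<Rightarrow> ('p \<Rightarrow> 'p \<Rightarrow> 'm) \<Rightarrow> 'p \<Rightarrow> 'm) \<Rightarrow> bool"
  where "represents f F \<longleftrightarrow>
    (\<forall>t d1 d2 a. (\<forall>v. slot d1 (\<lambda>u. t u v)) \<longrightarrow> (\<forall>u. slot d2 (t u)) \<longrightarrow>
       tlift2 s t (f a) = F (d1 + d2) t a) \<and>
    (\<forall>t e. (\<forall>v. k_linear (\<lambda>u. t u v)) \<longrightarrow> (\<forall>u. k_linear (t u)) \<longrightarrow> slot e (F e t)) \<and>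
    (\<forall>t d e a. (\<forall>u v. slot d (\<lambda>w. t w u v)) \<longrightarrow> slot d (\<lambda>w. F e (t w) a))"

lemma representsD:
  assumes "represents f F"
  shows "(\<And>v. slot d1 (\<lambda>u. t u v)) \<Longrightarrow> (\<And>u. slot d2 (t u)) \<Longrightarrow> tlift2 s t (f a) = F (d1 + d2) t a"
    "(\<And>v. k_linear (\<lambda>u. t u v)) \<Longrightarrow> (\<And>u. k_linear (t u)) \<Longrightarrow> slot e (F e t)"
    "(\<And>u v. slot d (\<lambda>w. t' w u v)) \<Longrightarrow> slot d (\<lambda>w. F e (t' w) a)"
  using assms unfolding represents_def by simp_all

lemma represents_cobracket: "represents (coboundary_cobracket s br r) cobracket_r"
  unfolding represents_def
proof (intro conjI allI impI)
  fix t :: "'p \<Rightarrow> 'p \<Rightarrow> 'm" and d1 d2 a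
  assume t1: "\<forall>v. slot d1 (\<lambda>u. t u v)" and t2: "\<forall>u. slot d2 (t u)"
  then have k: "k_linear (\<lambda>u. t u v)" "k_linear (t u)" for u v by blast+
  have mem: "lam_left s (br a) r \<in> tensor_polys" "lam_right s (br a) r \<in> tensor_polys"
    by (intro B.lam_mem r_mem)+
  have bil': "bilin (kscale s) (kscale s) (\<lambda>c. scl (\<kappa> c)) (\<lambda>u v. brk \<alpha> (\<lambda>x. t x v) a u)"
    "bilin (kscale s) (kscale s) (\<lambda>c. scl (\<kappa> c)) (\<lambda>u v. brk \<alpha> (\<lambda>x. t u x) a v)" for \<alpha>
    by (intro bilinI k_linear_intros k)+
  have "tlift2 s t (coboundary_cobracket s br r a)
      = ev scl (- (d1 + d2)) (tlift2 s t) (lam_left s (br a) r + lam_right s (br a) r)"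
    unfolding coboundary_cobracket_def using t1 t2 mem
    by (intro B.tlift2_psubst_der tensor_polys_closed) auto
  also have "\<dots> = ev scl (- (d1 + d2)) (tlift2 s t) (lam_left s (br a) r)
      + ev scl (- (d1 + d2)) (tlift2 s t) (lam_right s (br a) r)"
    by (rule ev_tlift2_add [OF k mem])
  also have "\<dots> = cobracket_r (d1 + d2) t a"
    by (simp only: B.ev_lam [OF k r_mem] tlift2_sum_lessThan [OF bil'(1)] tlift2_sum_lessThan [OF bil'(2)]
        cobracket_r_def cobracket_at_def sum.distrib)
  finally show "tlift2 s t (coboundary_cobracket s br r a) = cobracket_r (d1 + d2) t a" .
next
  fix t :: "'p \<Rightarrow> 'p \<Rightarrow> 'm" and e
  assume "\<forall>v. k_linear (\<lambda>u. t u v)" "\<forall>u. k_linear (t u)"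
  then have "slot (- (- e)) (\<lambda>a. cobracket_r e t a)"
    unfolding cobracket_r_def cobracket_at_def by (intro slot_intros) auto
  then show "slot e (cobracket_r e t)" by simp
next
  fix t :: "'p \<Rightarrow> 'p \<Rightarrow> 'p \<Rightarrow> 'm" and d e a
  assume "\<forall>u v. slot d (\<lambda>w. t w u v)"
  then show "slot d (\<lambda>w. cobracket_r e (t w) a)"
    unfolding cobracket_r_def cobracket_at_def by (intro slot_intros) auto
qed

lemma represents_coproduct: "represents (coboundary_coproduct s mul r) coproduct_r"
  unfolding represents_def
proof (intro conjI allI impI)
  fix t :: "'p \<Rightarrow> 'p \<Rightarrow> 'm" and d1 d2 a
  assume t1: "\<forall>v. slot d1 (\<lambda>u. t u v)" and t2: "\<forall>u. slot d2 (t u)"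
  then have k: "k_linear (\<lambda>u. t u v)" "k_linear (t u)" for u v by blast+
  have mem: "lam_left s (mul a) r \<in> tensor_polys" "lam_right s (mul a) r \<in> tensor_polys"
    by (intro C.lam_mem r_mem)+
  from mem(1) have mem': "- lam_left s (mul a) r \<in> tensor_polys"
    by (rule tensor_polys_minus)
  have bil': "bilin (kscale s) (kscale s) (\<lambda>c. scl (\<kappa> c)) (\<lambda>u v. prd \<alpha> (\<lambda>x. t x v) a u)"
    "bilin (kscale s) (kscale s) (\<lambda>c. scl (\<kappa> c)) (\<lambda>u v. prd \<alpha> (\<lambda>x. t u x) a v)" for \<alpha>
    by (intro bilinI k_linear_intros k)+
  have "tlift2 s t (coboundary_coproduct s mul r a)
      = ev scl (- (d1 + d2)) (tlift2 s t) (lam_right s (mul a) r + - lam_left s (mul a) r)"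
    unfolding coboundary_coproduct_def diff_conv_add_uminus using t1 t2 mem mem'
    by (intro C.tlift2_psubst_der tensor_polys_closed) auto
  also have "\<dots> = ev scl (- (d1 + d2)) (tlift2 s t) (lam_right s (mul a) r)
      + ev scl (- (d1 + d2)) (tlift2 s t) (- lam_left s (mul a) r)"
    by (rule ev_tlift2_add [OF k mem(2) mem'])
  also have "ev scl (- (d1 + d2)) (tlift2 s t) (- lam_left s (mul a) r)
      = - ev scl (- (d1 + d2)) (tlift2 s t) (lam_left s (mul a) r)"
    using mem(1) by (simp add: ev_def tensor_polys_def tlift2_minus [OF k] sum_negf)
  also have "ev scl (- (d1 + d2)) (tlift2 s t) (lam_right s (mul a) r)
      + - ev scl (- (d1 + d2)) (tlift2 s t) (lam_left s (mul a) r) = coproduct_r (d1 + d2) t a"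
    by (simp only: C.ev_lam [OF k r_mem] tlift2_sum_lessThan [OF bil'(1)] tlift2_sum_lessThan [OF bil'(2)]
        coproduct_r_def coproduct_at_def sum_subtractf diff_conv_add_uminus sum.distrib sum_negf)
  finally show "tlift2 s t (coboundary_coproduct s mul r a) = coproduct_r (d1 + d2) t a" .
next
  fix t :: "'p \<Rightarrow> 'p \<Rightarrow> 'm" and e
  assume "\<forall>v. k_linear (\<lambda>u. t u v)" "\<forall>u. k_linear (t u)"
  then have "slot (- (- e)) (\<lambda>a. coproduct_r e t a)"
    unfolding coproduct_r_def coproduct_at_def by (intro slot_intros) auto
  then show "slot e (coproduct_r e t)" by simp
next
  fix t :: "'p \<Rightarrow> 'p \<Rightarrow> 'p \<Rightarrow> 'm" and d e a
  assume "\<forall>u v. slot d (\<lambda>w. t w u v)"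
  then show "slot d (\<lambda>w. coproduct_r e (t w) a)"
    unfolding coproduct_r_def coproduct_at_def by (intro slot_intros) auto
qed

context
  fixes f g :: "'p \<Rightarrow> ('k, 'p) tens2" and F G :: "'r \<Rightarrow> ('p \<Rightarrow> 'p \<Rightarrow> 'm) \<Rightarrow> 'p \<Rightarrow> 'm"
    and t :: "'p \<Rightarrow> 'p \<Rightarrow> 'p \<Rightarrow> 'm" and d1 d2 d3 :: 'r
  assumes f: "represents f F" and g: "represents g G"
    and t1: "\<And>v w. slot d1 (\<lambda>u. t u v w)" and t2: "\<And>u w. slot d2 (\<lambda>v. t u v w)"
    and t3: "\<And>u v. slot d3 (t u v)"
begin

text \<open>
  The maps \<open>(g \<otimes> I) f\<close> and \<open>(I \<otimes> g) f\<close>: the inner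
  coproduct is represented with the weight of two factors, the outer one with the total weight
  of all three.
\<close>

lemma tlift2_nested_left:
  "tlift2 s (\<lambda>u v. tlift2 s (\<lambda>p q. t p q v) (g u)) (f a)
    = F (d1 + d2 + d3) (\<lambda>u v. G (d1 + d2) (\<lambda>p q. t p q v) u) a"
proof -
  have "tlift2 s (\<lambda>p q. t p q v) (g u) = G (d1 + d2) (\<lambda>p q. t p q v) u" for u v
    by (rule representsD(1) [OF g t1 t2])
  moreover have "slot (d1 + d2) (\<lambda>u. G (d1 + d2) (\<lambda>p q. t p q v) u)" for v
    by (rule representsD(2) [OF g]) (use t1 t2 in blast)+
  moreover have "slot d3 (\<lambda>v. G (d1 + d2) (\<lambda>p q. t p q v) u)" for u
    by (rule representsD(3) [OF g t3])
  ultimately show ?thesis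
    by (simp add: representsD(1) [OF f])
qed

lemma tlift2_nested_right:
  "tlift2 s (\<lambda>u v. tlift2 s (t u) (g v)) (f a)
    = F (d1 + d2 + d3) (\<lambda>u. G (d2 + d3) (t u)) a"
proof -
  have "tlift2 s (t u) (g v) = G (d2 + d3) (t u) v" for u v
    by (rule representsD(1) [OF g t2 t3])
  moreover have "slot (d2 + d3) (G (d2 + d3) (t u))" for u
    by (rule representsD(2) [OF g]) (use t2 t3 in blast)+
  moreover have "slot d1 (\<lambda>u. G (d2 + d3) (t u) v)" for v
    by (rule representsD(3) [OF g t1])
  ultimately show ?thesis
    using representsD(1) [OF f, of d1 "\<lambda>u. G (d2 + d3) (t u)" "d2 + d3" a] by (simp add: add.assoc)
qed

end

end

section \<open>Linear maps applied to the Yang-Baxter expressions\<close>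

text \<open>
  \<open>P \<otimes> P \<otimes> P\<close> as a module over \<open>k[X1, X2, X3]\<close>, the
  variables acting as the derivations of the three factors.
\<close>

definition act3 :: "('k::field_char_0 poly \<Rightarrow> 'p::ab_group_add \<Rightarrow> 'p) \<Rightarrow> 'k poly poly poly
    \<Rightarrow> ('k, 'p) tens3 \<Rightarrow> ('k, 'p) tens3"
  where "act3 s = poly_act3 tscale (der3_ext s 1) (der3_ext s 2) (der3_ext s 3)"

context fg_diff_module
begin

lemma act3:
  "module (act3 s)" "act3 s X1 w = der3_ext s 1 w" "act3 s X2 w = der3_ext s 2 w" "act3 s X3 w = der3_ext s 3 w"
  "act3 s (const3 c) w = tscale c w"
proof -
  have "module (tscale :: 'k \<Rightarrow> ('k, 'p) tens3 \<Rightarrow> ('k, 'p) tens3)"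
    using vector_space_tscale by (simp add: module_iff_vector_space)
  moreover have "der3_ext s i (w + w') = der3_ext s i w + der3_ext s i w'" "der3_ext s i (tscale c w) = tscale c (der3_ext s i w)"
    for i w w' c
    by (simp_all add: der3_ext_def guarded_precomp_add guarded_precomp_tscale)
  ultimately show
    "module (act3 s)" "act3 s X1 w = der3_ext s 1 w" "act3 s X2 w = der3_ext s 2 w" "act3 s X3 w = der3_ext s 3 w"
    "act3 s (const3 c) w = tscale c w"
    unfolding act3_def by (intro poly_act3; simp add: der3_ext_commute)+
qed

lemma conformal_evaluation_tens3: "conformal_evaluation s (act3 s) const3"
proof -
  have "(\<lambda>c. act3 s (const3 c)) = tscale"
    by (intro ext) (simp add: act3(5))
  then show ?thesis
    using act3(1) fg_diff_module_axioms vector_space_tscale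
    by (simp add: conformal_evaluation_def conformal_evaluation_axioms_def)
qed

lemma slot_tensor3:
  "conformal_evaluation.slot s (act3 s) const3 X1 (\<lambda>u. tensor3 s u v w)"
  "conformal_evaluation.slot s (act3 s) const3 X2 (\<lambda>v. tensor3 s u v w)"
  "conformal_evaluation.slot s (act3 s) const3 X3 (tensor3 s u v)"
proof -
  interpret T: conformal_evaluation s "act3 s" const3 by (rule conformal_evaluation_tens3)
  show "T.slot X1 (\<lambda>u. tensor3 s u v w)" "T.slot X2 (\<lambda>v. tensor3 s u v w)" "T.slot X3 (tensor3 s u v)"
    by (simp_all add: T.slot_def T.k_linear_iff tensor3_linear act3 der3_ext_tensor3 del: One_nat_def)
qed

lemma tlift3_tensor3: "w \<in> tensor_space3 s \<Longrightarrow> tlift3 s (tensor3 s) w = w"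
  using tlift3_sum_lessThan [OF trilin_tensor3 [OF module_axioms]] by (auto elim!: tensor_space3E)

lemma der3_act3:
  assumes "w \<in> tensor_space3 s"
  shows "der3_1 s w = act3 s X1 w" "der3_2 s w = act3 s X2 w" "der3_3 s w = act3 s X3 w"
proof -
  interpret T: conformal_evaluation s "act3 s" const3 by (rule conformal_evaluation_tens3)
  show "der3_1 s w = act3 s X1 w" "der3_2 s w = act3 s X2 w" "der3_3 s w = act3 s X3 w"
    using T.tlift3_der3(1-3) [OF slot_tensor3 assms] by (simp_all add: tlift3_tensor3 der3_mem assms)
qed

lemma psubst_act3:
  assumes A: "\<And>w. w \<in> tensor_space3 s \<Longrightarrow> A w \<in> tensor_space3 s"
      "\<And>w. w \<in> tensor_space3 s \<Longrightarrow> A w = act3 s \<rho> w"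
    and f: "f 0 = 0" "\<And>x. f x \<in> tensor_space3 s"
  shows "psubst A (map_poly f p) = ev (act3 s) \<rho> f p"
proof -
  interpret N: module "act3 s" by (rule act3(1))
  have "psubst A (map_poly f p) = ev (act3 s) \<rho> (\<lambda>w. w) (map_poly f p)"
    by (rule N.ev_psubst_on [where G = "\<lambda>w. w" and S = "tensor_space3 s"])
       (simp_all add: tensor_space3_0 tensor_space3_add A(1) A(2) [symmetric] coeff_map_poly f)
  then show ?thesis by (simp add: N.ev_map_poly f)
qed

end

context conformal_evaluation
begin

lemma tlift3_psubst:
  assumes t: "\<And>v w. k_linear (\<lambda>u. t u v w)" "\<And>u w. k_linear (\<lambda>v. t u v w)" "\<And>u v. k_linear (t u v)"
    and A: "\<And>w. w \<in> tensor_space3 s \<Longrightarrow> A w \<in> tensor_space3 s"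
      "\<And>w. w \<in> tensor_space3 s \<Longrightarrow> tlift3 s t (A w) = scl \<rho> (tlift3 s t w)"
    and f: "f 0 = 0" "\<And>x. f x \<in> tensor_space3 s"
  shows "tlift3 s t (psubst A (map_poly f p)) = ev scl \<rho> (\<lambda>x. tlift3 s t (f x)) p"
    and "psubst A (map_poly f p) \<in> tensor_space3 s"
proof -
  note add = tensor3_universal(2) [OF trilinI [OF t]]
  have mem: "coeff (map_poly f p) k \<in> tensor_space3 s" for k
    by (simp add: coeff_map_poly f)
  have "tlift3 s t 0 = 0" using add [OF tensor_space3_0 tensor_space3_0] by simp
  then show "tlift3 s t (psubst A (map_poly f p)) = ev scl \<rho> (\<lambda>x. tlift3 s t (f x)) p"
    using M.ev_psubst_on [where G = "tlift3 s t", OF tensor_space3_0 tensor_space3_add A(1) add A(2) mem]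
    by (simp add: M.ev_map_poly f)
  show "psubst A (map_poly f p) \<in> tensor_space3 s"
    by (rule psubst_closed [OF tensor_space3_0 tensor_space3_add A(1) mem])
qed

lemma tlift3_minus:
  assumes t: "\<And>v w. k_linear (\<lambda>u. t u v w)" "\<And>u w. k_linear (\<lambda>v. t u v w)" "\<And>u v. k_linear (t u v)"
    and w: "w \<in> tensor_space3 s"
  shows "tlift3 s t (- w) = - tlift3 s t w"
proof -
  note add = tensor3_universal(2) [OF trilinI [OF t]]
  have "tlift3 s t 0 = 0" using add [OF tensor_space3_0 tensor_space3_0] by simp
  then show ?thesis
    using add [OF w tensor_space3_minus [OF w]] by (simp add: eq_neg_iff_add_eq_0 add.commute)
qed

end

context poisson_conformal_algebra
begin

abbreviation cybe_summand :: "'p \<Rightarrow> 'p \<Rightarrow> 'p \<Rightarrow> 'p \<Rightarrow> ('k, 'p) tens3"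
  where "cybe_summand ri li rj lj \<equiv>
        psubst (der3_2 s) (map_poly (\<lambda>x. tensor3 s x li lj) (br ri rj))
      - psubst (der3_3 s) (map_poly (\<lambda>x. tensor3 s ri x lj) (br rj li))
      - psubst (der3_2 s) (map_poly (\<lambda>x. tensor3 s ri rj x) (br lj li))"

abbreviation aybe_summand :: "'p \<Rightarrow> 'p \<Rightarrow> 'p \<Rightarrow> 'p \<Rightarrow> ('k, 'p) tens3"
  where "aybe_summand ri li rj lj \<equiv>
        psubst (der3_1 s) (map_poly (\<lambda>x. tensor3 s ri rj x) (mul li lj))
      - psubst (\<lambda>t. - (der3_1 s t + der3_2 s t)) (map_poly (\<lambda>x. tensor3 s ri x lj) (mul rj li))
      + psubst (der3_2 s) (map_poly (\<lambda>x. tensor3 s x li lj) (mul ri rj))"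

text \<open>
  The double \<open>tlift2\<close> expands to a double sum because the summands are bilinear in
  each copy of \<open>r\<close>. This is seen by rewriting them as evaluated products with
  values in \<open>P \<otimes> P \<otimes> P\<close> itself.
\<close>

lemma yang_baxter_sums:
  fixes n :: nat
  shows "conformal_cybe s br (\<Sum>i<n. tensor2 s (x i) (y i))
      = (\<Sum>i<n. \<Sum>j<n. cybe_summand (x i) (y i) (x j) (y j))"
    "conformal_aybe s mul (\<Sum>i<n. tensor2 s (x i) (y i))
      = (\<Sum>i<n. \<Sum>j<n. aybe_summand (x i) (y i) (x j) (y j))"
proof -
  interpret T: poisson_evaluation s br mul "act3 s" const3
    using conformal_evaluation_tens3 poisson_conformal_algebra_axioms by (simp add: poisson_evaluation_def)
  have k: "T.k_linear (\<lambda>u. tensor3 s u v w)" "T.k_linear (\<lambda>v. tensor3 s u v w)" "T.k_linear (tensor3 s u v)" for u v w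
    by (rule slot_tensor3 [THEN T.slot_k_linear])+
  have A: "- (der3_1 s w + der3_2 s w) \<in> tensor_space3 s"
      "- (der3_1 s w + der3_2 s w) = act3 s (- (X1 + X2)) w" if "w \<in> tensor_space3 s" for w
    subgoal by (rule tensor_space3_minus [OF tensor_space3_add [OF der3_mem(1) [OF that] der3_mem(2) [OF that]]])
    subgoal by (simp only: der3_act3 [OF that] T.M.scale_left_distrib T.M.scale_minus_left)
    done
  note psubst = psubst_act3 [OF der3_mem(1) der3_act3(1)] psubst_act3 [OF der3_mem(2) der3_act3(2)]
    psubst_act3 [OF der3_mem(3) der3_act3(3)] psubst_act3 [OF A]
  have cybe: "cybe_summand ri li rj lj = T.brk X2 (\<lambda>x. tensor3 s x li lj) ri rj
      - T.brk X3 (\<lambda>x. tensor3 s ri x lj) rj li - T.brk X2 (\<lambda>x. tensor3 s ri rj x) lj li" for ri li rj lj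
    by (simp add: psubst tensor3_0 tensor3_mem T.B.eval_prod_def)
  have aybe: "aybe_summand ri li rj lj = T.prd X1 (\<lambda>x. tensor3 s ri rj x) li lj
      - T.prd (- (X1 + X2)) (\<lambda>x. tensor3 s ri x lj) rj li + T.prd X2 (\<lambda>x. tensor3 s x li lj) ri rj" for ri li rj lj
    by (simp add: psubst tensor3_0 tensor3_mem T.C.eval_prod_def del: minus_add_distrib)
  have lin: "T.k_linear (\<lambda>u. cybe_summand ri li u lj)" "T.k_linear (\<lambda>u. cybe_summand ri li rj u)"
    "T.k_linear (\<lambda>u. cybe_summand u li rj lj)" "T.k_linear (\<lambda>u. cybe_summand ri u rj lj)" for ri li rj lj
    unfolding cybe by (intro T.k_linear_intros k)+
  have "tlift2 s (cybe_summand ri li) (\<Sum>j<n. tensor2 s (x j) (y j))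
      = (\<Sum>j<n. cybe_summand ri li (x j) (y j))" for ri li
    by (rule tlift2_sum_lessThan [OF T.bilinI]) (rule lin)+
  moreover have "tlift2 s (\<lambda>ri li. \<Sum>j<n. cybe_summand ri li (x j) (y j)) (\<Sum>i<n. tensor2 s (x i) (y i))
      = (\<Sum>i<n. \<Sum>j<n. cybe_summand (x i) (y i) (x j) (y j))"
    by (rule tlift2_sum_lessThan [OF T.bilinI]) (rule T.k_linear_sum, rule lin)+
  ultimately show "conformal_cybe s br (\<Sum>i<n. tensor2 s (x i) (y i))
      = (\<Sum>i<n. \<Sum>j<n. cybe_summand (x i) (y i) (x j) (y j))"
    unfolding conformal_cybe_def by (simp only:)
  have lin: "T.k_linear (\<lambda>u. aybe_summand ri li u lj)" "T.k_linear (\<lambda>u. aybe_summand ri li rj u)"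
    "T.k_linear (\<lambda>u. aybe_summand u li rj lj)" "T.k_linear (\<lambda>u. aybe_summand ri u rj lj)" for ri li rj lj
    unfolding aybe by (intro T.k_linear_intros k)+
  have "tlift2 s (aybe_summand ri li) (\<Sum>j<n. tensor2 s (x j) (y j))
      = (\<Sum>j<n. aybe_summand ri li (x j) (y j))" for ri li
    by (rule tlift2_sum_lessThan [OF T.bilinI]) (rule lin)+
  moreover have "tlift2 s (\<lambda>ri li. \<Sum>j<n. aybe_summand ri li (x j) (y j)) (\<Sum>i<n. tensor2 s (x i) (y i))
      = (\<Sum>i<n. \<Sum>j<n. aybe_summand (x i) (y i) (x j) (y j))"
    by (rule tlift2_sum_lessThan [OF T.bilinI]) (rule T.k_linear_sum, rule lin)+
  ultimately show "conformal_aybe s mul (\<Sum>i<n. tensor2 s (x i) (y i))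
      = (\<Sum>i<n. \<Sum>j<n. aybe_summand (x i) (y i) (x j) (y j))"
    unfolding conformal_aybe_def by (simp only:)
qed

end

context poisson_evaluation
begin

context
  fixes t :: "'p \<Rightarrow> 'p \<Rightarrow> 'p \<Rightarrow> 'm" and d1 d2 d3 :: 'r and n :: nat
  assumes t1: "\<And>v w. slot d1 (\<lambda>u. t u v w)" and t2: "\<And>u w. slot d2 (\<lambda>v. t u v w)"
    and t3: "\<And>u v. slot d3 (t u v)"
begin

text \<open>
  The operators substituted for the parameters in \<open>[[r,r]]\<close> and \<open>r \<bullet>
  r\<close> turn into the weights of \<open>t\<close>.
\<close>

lemma tlift3_yang_baxter:
  "tlift3 s t (conformal_cybe s br (\<Sum>i<n. tensor2 s (x i) (y i)))
    = (\<Sum>i<n. \<Sum>j<n. brk d2 (\<lambda>z. t z (y i) (y j)) (x i) (x j)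
        - brk d3 (\<lambda>z. t (x i) z (y j)) (x j) (y i)
        - brk d2 (\<lambda>z. t (x i) (x j) z) (y j) (y i))"
  "tlift3 s t (conformal_aybe s mul (\<Sum>i<n. tensor2 s (x i) (y i)))
    = (\<Sum>i<n. \<Sum>j<n. prd d1 (\<lambda>z. t (x i) (x j) z) (y i) (y j)
        - prd (- (d1 + d2)) (\<lambda>z. t (x i) z (y j)) (x j) (y i)
        + prd d2 (\<lambda>z. t z (y i) (y j)) (x i) (x j))"
proof -
  have k: "k_linear (\<lambda>u. t u v w)" "k_linear (\<lambda>v. t u v w)" "k_linear (t u v)" for u v w
    using t1 t2 t3 by blast+
  note tri = trilinI [OF k]
  note add = tensor3_universal(2) [OF tri] and minus = tlift3_minus [OF k]
  note der = tlift3_der3 [OF t1 t2 t3]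
  have A: "- (der3_1 s w + der3_2 s w) \<in> tensor_space3 s"
      "tlift3 s t (- (der3_1 s w + der3_2 s w)) = scl (- (d1 + d2)) (tlift3 s t w)"
    if "w \<in> tensor_space3 s" for w
    subgoal by (rule tensor_space3_minus [OF tensor_space3_add [OF der3_mem(1) [OF that] der3_mem(2) [OF that]]])
    subgoal by (simp only: minus [OF tensor_space3_add [OF der3_mem(1) [OF that] der3_mem(2) [OF that]]]
      add [OF der3_mem(1) [OF that] der3_mem(2) [OF that]] der [OF that] M.scale_left_distrib M.scale_minus_left)
    done
  note ps = tlift3_psubst [OF k der3_mem(1) der(1)] tlift3_psubst [OF k der3_mem(2) der(2)]
    tlift3_psubst [OF k der3_mem(3) der(3)] tlift3_psubst [OF k A]
  have mem: "cybe_summand ri li rj lj \<in> tensor_space3 s" "aybe_summand ri li rj lj \<in> tensor_space3 s"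
    for ri li rj lj
    unfolding diff_conv_add_uminus
    by (intro tensor_space3_add tensor_space3_minus ps tensor3_0 tensor3_mem; assumption)+
  have cybe: "tlift3 s t (cybe_summand ri li rj lj) = brk d2 (\<lambda>z. t z li lj) ri rj
      - brk d3 (\<lambda>z. t ri z lj) rj li - brk d2 (\<lambda>z. t ri rj z) lj li" for ri li rj lj
    unfolding diff_conv_add_uminus
    by (simp add: add minus tensor_space3_add tensor_space3_minus ps tensor3_0 tensor3_mem
        tensor3_universal(1) [OF tri] B.eval_prod_def del: add_uminus_conv_diff)
  have aybe: "tlift3 s t (aybe_summand ri li rj lj) = prd d1 (\<lambda>z. t ri rj z) li lj
      - prd (- (d1 + d2)) (\<lambda>z. t ri z lj) rj li + prd d2 (\<lambda>z. t z li lj) ri rj" for ri li rj lj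
    unfolding diff_conv_add_uminus
    by (simp add: add minus tensor_space3_add tensor_space3_minus ps tensor3_0 tensor3_mem
        tensor3_universal(1) [OF tri] C.eval_prod_def del: add_uminus_conv_diff minus_add_distrib)
  note sum = additive_on_sum [where G = "tlift3 s t", OF tensor_space3_0 tensor_space3_add add]
    and sum_mem = sum_closed [OF tensor_space3_0 tensor_space3_add]
  show "tlift3 s t (conformal_cybe s br (\<Sum>i<n. tensor2 s (x i) (y i)))
    = (\<Sum>i<n. \<Sum>j<n. brk d2 (\<lambda>z. t z (y i) (y j)) (x i) (x j)
        - brk d3 (\<lambda>z. t (x i) z (y j)) (x j) (y i)
        - brk d2 (\<lambda>z. t (x i) (x j) z) (y j) (y i))"
    unfolding yang_baxter_sums by (simp only: sum sum_mem mem cybe)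
  show "tlift3 s t (conformal_aybe s mul (\<Sum>i<n. tensor2 s (x i) (y i)))
    = (\<Sum>i<n. \<Sum>j<n. prd d1 (\<lambda>z. t (x i) (x j) z) (y i) (y j)
        - prd (- (d1 + d2)) (\<lambda>z. t (x i) z (y j)) (x j) (y i)
        + prd d2 (\<lambda>z. t z (y i) (y j)) (x i) (x j))"
    unfolding yang_baxter_sums by (simp only: sum sum_mem mem aybe)
qed

lemma tlift3_der_tens3_image:
  assumes "d1 + d2 + d3 = 0" and "w \<in> der_tens3 s ` tensor_space3 s"
  shows "tlift3 s t w = 0"
  using assms tlift3_der3(4) [OF t1 t2 t3] by auto

end

end

section \<open>Evaluation in the tensor square and in its polynomials\<close>

context coboundary_evaluation
begin

lemma skew_from_swap:
  assumes swap: "swap2 s r = - r" and f: "\<And>v. k_linear (\<lambda>u. f u v)" "\<And>u. k_linear (f u)"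
  shows "(\<Sum>i<n. f (x i) (y i)) = - (\<Sum>i<n. f (y i) (x i))"
proof -
  have "bilin (kscale s) (kscale s) tscale (\<lambda>u v. tensor2 s v u)"
    using bilin_tensor2 [OF module_axioms] by (simp add: bilin_def)
  then have "swap2 s r = (\<Sum>i<n. tensor2 s (y i) (x i))"
    unfolding swap2_def by (rule tlift2_sum_lessThan)
  then have "(\<Sum>i<n. f (y i) (x i)) = tlift2 s f (- r)"
    by (simp only: tlift2_sum_lessThan [OF bilinI [OF f]] swap [symmetric])
  then show ?thesis
    by (simp only: tlift2_minus [OF f r_mem] tlift2_sum_lessThan [OF bilinI [OF f]] minus_minus)
qed

end

text \<open>
  \<open>P \<otimes> P\<close> with \<open>X1\<close>, \<open>X2\<close> acting as the
  derivations of the two factors and \<open>X3\<close> as zero, and \<open>(P \<otimes>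
  P)[\<lambda>]\<close> with \<open>X3\<close> acting as multiplication by
  \<open>\<lambda>\<close>.
\<close>

definition act2 :: "('k::field_char_0 poly \<Rightarrow> 'p::ab_group_add \<Rightarrow> 'p) \<Rightarrow> 'k poly poly poly
    \<Rightarrow> ('k, 'p) tens2 \<Rightarrow> ('k, 'p) tens2"
  where "act2 s = poly_act3 tscale (der2_ext s True) (der2_ext s False) (\<lambda>_. 0)"

definition act2_poly :: "('k::field_char_0 poly \<Rightarrow> 'p::ab_group_add \<Rightarrow> 'p) \<Rightarrow> 'k poly poly poly
    \<Rightarrow> ('k, 'p) tens2 poly \<Rightarrow> ('k, 'p) tens2 poly"
  where "act2_poly s = poly_act3 (\<lambda>c. map_poly (tscale c)) (map_poly (der2_ext s True))
    (map_poly (der2_ext s False)) (pCons 0)"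

context fg_diff_module
begin

lemma der2_ext_linear: "der2_ext s i (w + w') = der2_ext s i w + der2_ext s i w'" "der2_ext s i (tscale c w) = tscale c (der2_ext s i w)"
    "der2_ext s i 0 = 0"
  by (simp_all add: der2_ext_def guarded_precomp_add guarded_precomp_tscale guarded_precomp_0)

lemma tscale_0_right: "tscale c (0 :: ('k, 'p) tens2) = 0"
  by (simp add: tscale_def fun_eq_iff)

lemma act2:
  "module (act2 s)" "act2 s X1 w = der2_ext s True w" "act2 s X2 w = der2_ext s False w"
  "act2 s (const3 c) w = tscale c w"
proof -
  have "module (tscale :: 'k \<Rightarrow> ('k, 'p) tens2 \<Rightarrow> ('k, 'p) tens2)"
    using vector_space_tscale by (simp add: module_iff_vector_space)
  then show "module (act2 s)" "act2 s X1 w = der2_ext s True w" "act2 s X2 w = der2_ext s False w"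
    "act2 s (const3 c) w = tscale c w"
    unfolding act2_def by (intro poly_act3; simp add: der2_ext_linear der2_ext_commute tscale_0_right)+
qed

lemma act2_poly:
  "module (act2_poly s)" "act2_poly s X1 q = map_poly (der2_ext s True) q"
  "act2_poly s X2 q = map_poly (der2_ext s False) q" "act2_poly s X3 q = pCons 0 q"
  "act2_poly s (const3 c) q = map_poly (tscale c) q"
proof -
  have "module (\<lambda>c. map_poly (tscale c) :: ('k, 'p) tens2 poly \<Rightarrow> ('k, 'p) tens2 poly)"
    using vector_space_map_tscale by (simp add: module_iff_vector_space)
  then show "module (act2_poly s)" "act2_poly s X1 q = map_poly (der2_ext s True) q"
    "act2_poly s X2 q = map_poly (der2_ext s False) q" "act2_poly s X3 q = pCons 0 q"
    "act2_poly s (const3 c) q = map_poly (tscale c) q"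
    unfolding act2_poly_def
    by (intro poly_act3; simp add: poly_eq_iff coeff_map_poly coeff_pCons der2_ext_linear der2_ext_commute
        tscale_0_right split: nat.split)+
qed

lemma conformal_evaluation_tens2: "conformal_evaluation s (act2 s) const3"
proof -
  have "(\<lambda>c. act2 s (const3 c)) = tscale"
    by (intro ext) (simp add: act2(4))
  then show ?thesis
    using act2(1) fg_diff_module_axioms vector_space_tscale
    by (simp add: conformal_evaluation_def conformal_evaluation_axioms_def)
qed

lemma conformal_evaluation_tens2_poly: "conformal_evaluation s (act2_poly s) const3"
proof -
  have "(\<lambda>c. act2_poly s (const3 c)) = (\<lambda>c. map_poly (tscale c))"
    by (intro ext) (simp add: act2_poly(5))
  then show ?thesis
    using act2_poly(1) fg_diff_module_axioms vector_space_map_tscale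
    by (simp add: conformal_evaluation_def conformal_evaluation_axioms_def)
qed

lemma slot_tensor2:
  "conformal_evaluation.slot s (act2 s) const3 X1 (\<lambda>u. tensor2 s u v)"
  "conformal_evaluation.slot s (act2 s) const3 X2 (tensor2 s u)"
proof -
  interpret T: conformal_evaluation s "act2 s" const3 by (rule conformal_evaluation_tens2)
  show "T.slot X1 (\<lambda>u. tensor2 s u v)" "T.slot X2 (tensor2 s u)"
    by (simp_all add: T.slot_def T.k_linear_iff tensor2_linear act2 der2_ext_tensor2)
qed

lemma slot_tensor2_poly:
  "conformal_evaluation.slot s (act2_poly s) const3 X1 (\<lambda>u. [:tensor2 s u v:])"
  "conformal_evaluation.slot s (act2_poly s) const3 X2 (\<lambda>v. [:tensor2 s u v:])"
proof -
  interpret T: conformal_evaluation s "act2_poly s" const3 by (rule conformal_evaluation_tens2_poly)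
  show "T.slot X1 (\<lambda>u. [:tensor2 s u v:])" "T.slot X2 (\<lambda>v. [:tensor2 s u v:])"
    by (simp_all add: T.slot_def T.k_linear_iff tensor2_linear act2_poly der2_ext_tensor2 der2_ext_linear
        tscale_0_right map_poly_pCons)
qed

lemma tlift2_tensor2: "w \<in> tensor_space2 s \<Longrightarrow> tlift2 s (tensor2 s) w = w"
  by (elim tensor_space2E) (simp only: tlift2_sum_lessThan [OF bilin_tensor2 [OF module_axioms]])

lemma der_tens2_act2:
  assumes "w \<in> tensor_space2 s"
  shows "der_tens2 s w = act2 s (X1 + X2) w"
proof -
  interpret T: conformal_evaluation s "act2 s" const3 by (rule conformal_evaluation_tens2)
  show ?thesis
    using T.tlift2_der_tens2 [OF slot_tensor2 assms] by (simp add: tlift2_tensor2 der_tens2_mem assms)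
qed

lemma tlift2_tensor2_poly:
  assumes "w \<in> tensor_space2 s"
  shows "tlift2 s (\<lambda>u v. [:tensor2 s u v:]) w = [:w:]"
proof -
  interpret T: conformal_evaluation s "act2_poly s" const3 by (rule conformal_evaluation_tens2_poly)
  from assms obtain x y and n :: nat where w: "w = (\<Sum>i<n. tensor2 s (x i) (y i))"
    by (rule tensor_space2E)
  have "[:\<Sum>i<m. tensor2 s (x i) (y i):] = (\<Sum>i<m. [:tensor2 s (x i) (y i):])" for m :: nat
    by (rule additive_on_sum [where G = "\<lambda>z. [:z:]" and S = UNIV]) simp_all
  then show ?thesis
    using tlift2_sum_lessThan [OF T.bilin_slots [OF slot_tensor2_poly]] unfolding w by simp
qed

text \<open>
  Evaluation of \<open>(P \<otimes> P)[\<lambda>]\<close> in itself: at \<open>\<lambda> =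
  X3\<close> it is the identity, and at \<open>\<lambda> = -X3 - (X1 + X2)\<close> it is the
  substitution \<open>\<lambda> \<mapsto> -\<lambda> - \<partial>\<close>. So both kinds of
  terms in the compatibility conditions are evaluations.
\<close>

lemma
  assumes q: "q \<in> tensor_polys"
  shows tensor_polys_as_ev: "q = ev (act2_poly s) X3 (tlift2 s (\<lambda>u v. [:tensor2 s u v:])) q"
    and psubst_skew_as_ev: "psubst_skew (der_tens2 s) q
      = ev (act2_poly s) (- X3 - (X1 + X2)) (tlift2 s (\<lambda>u v. [:tensor2 s u v:])) q"
proof -
  interpret N: module "act2_poly s" by (rule act2_poly(1))
  have lift: "tlift2 s (\<lambda>u v. [:tensor2 s u v:]) (coeff q k) = [:coeff q k:]" for k
    using q by (intro tlift2_tensor2_poly) (simp add: tensor_polys_def)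
  have add: "additive (\<lambda>z :: ('k, 'p) tens2. [:z:])"
    by unfold_locales simp
  have "ev (act2_poly s) X3 (\<lambda>z. [:z:]) p = p" for p :: "('k, 'p) tens2 poly"
  proof (induction p)
    case (pCons c p)
    have "ev (act2_poly s) X3 (\<lambda>z. [:z:]) (pCons c p) = ev (act2_poly s) X3 (\<lambda>z. [:z:]) ([:c:] + pCons 0 p)"
      by simp
    also have "\<dots> = pCons c p"
      by (simp only: additive.add [OF N.additive_ev [OF add]] N.ev_pCons_0 [of "\<lambda>z. [:z:]", simplified]
          N.ev_const pCons.IH act2_poly(4)) simp
    finally show ?case .
  qed simp
  then show "q = ev (act2_poly s) X3 (tlift2 s (\<lambda>u v. [:tensor2 s u v:])) q"
    using N.ev_cong [of "tlift2 s (\<lambda>u v. [:tensor2 s u v:])" q "\<lambda>z. [:z:]"] by (simp add: lift)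
  have der: "map_poly (der_tens2 s) p = act2_poly s (X1 + X2) p" if "p \<in> tensor_polys" for p
  proof -
    interpret N2: module "act2 s" by (rule act2(1))
    have "der_tens2 s 0 = 0" by (simp add: der_tens2_act2 tensor_space2_0)
    then show ?thesis
      using that
      by (simp add: poly_eq_iff coeff_map_poly N.scale_left_distrib act2_poly der2_ext_linear
          tensor_polys_def der_tens2_act2 N2.scale_left_distrib act2)
  qed
  have der_mem: "map_poly (der_tens2 s) p \<in> tensor_polys" if "p \<in> tensor_polys" for p
  proof -
    interpret N2: module "act2 s" by (rule act2(1))
    have "der_tens2 s 0 = 0" by (simp add: der_tens2_act2 tensor_space2_0)
    then show ?thesis using that by (simp add: tensor_polys_def coeff_map_poly der_tens2_mem)
  qed
  have "psubst_skew (der_tens2 s) q = ev (act2_poly s) (- X3 - (X1 + X2)) (\<lambda>p. p) (map_poly (\<lambda>z. [:z:]) q)"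
    unfolding psubst_skew_def
  proof (rule N.ev_psubst_on [where G = "\<lambda>p. p" and S = tensor_polys])
    show "- pCons 0 p - map_poly (der_tens2 s) p = act2_poly s (- X3 - (X1 + X2)) p"
      if "p \<in> tensor_polys" for p
      by (simp only: der [OF that] N.scale_left_diff_distrib N.scale_minus_left act2_poly(4))
    show "- pCons 0 p - map_poly (der_tens2 s) p \<in> tensor_polys" if "p \<in> tensor_polys" for p
      unfolding diff_conv_add_uminus
      by (intro tensor_polys_closed tensor_polys_minus der_mem that)
         (use that in \<open>simp add: tensor_polys_def coeff_pCons tensor_space2_0 split: nat.split\<close>)
    show "coeff (map_poly (\<lambda>z. [:z:]) q) k \<in> tensor_polys" for k
      using q by (simp add: tensor_polys_def coeff_map_poly coeff_pCons tensor_space2_0 split: nat.split)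
  qed (simp_all add: tensor_polys_closed)
  also have "\<dots> = ev (act2_poly s) (- X3 - (X1 + X2)) (\<lambda>z. [:z:]) q"
    by (simp add: N.ev_map_poly)
  also have "\<dots> = ev (act2_poly s) (- X3 - (X1 + X2)) (tlift2 s (\<lambda>u v. [:tensor2 s u v:])) q"
    by (rule N.ev_cong) (simp add: lift)
  finally show "psubst_skew (der_tens2 s) q
      = ev (act2_poly s) (- X3 - (X1 + X2)) (tlift2 s (\<lambda>u v. [:tensor2 s u v:])) q" .
qed

end

section \<open>The coboundary Poisson conformal bialgebra\<close>

context coboundary_evaluation
begin

context
  fixes t :: "'p \<Rightarrow> 'p \<Rightarrow> 'm" and d1 d2 \<Lambda> \<nu> :: 'r
  assumes t1: "\<And>v. slot d1 (\<lambda>u. t u v)" and t2: "\<And>u. slot d2 (\<lambda>v. t u v)"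
    and \<nu>: "\<nu> = - \<Lambda> - (d1 + d2)"
begin

text \<open>
  Summation of the identities for the pure tensors \<open>x\<^sub>i \<otimes> y\<^sub>i\<close>.
\<close>

lemma coboundary_compatibility_ev:
  "brk \<Lambda> (cobracket_r (d1 + d2) t) a b =
     cobracket_r (d1 + d2 + \<Lambda>) (\<lambda>p q. brk \<Lambda> (\<lambda>z. t z q) a p) b
   + cobracket_r (d1 + d2 + \<Lambda>) (\<lambda>p q. brk \<Lambda> (\<lambda>z. t p z) a q) b
   - (cobracket_r (d1 + d2 + \<nu>) (\<lambda>p q. brk \<nu> (\<lambda>z. t z q) b p) a
    + cobracket_r (d1 + d2 + \<nu>) (\<lambda>p q. brk \<nu> (\<lambda>z. t p z) b q) a)"
  "prd \<Lambda> (coproduct_r (d1 + d2) t) a b =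
     coproduct_r (d1 + d2 + \<Lambda>) (\<lambda>p q. prd \<Lambda> (\<lambda>z. t p z) a q) b
   + coproduct_r (d1 + d2 + \<nu>) (\<lambda>p q. prd \<nu> (\<lambda>z. t z q) b p) a"
  "prd \<Lambda> (cobracket_r (d1 + d2) t) a b =
     cobracket_r (d1 + d2 + \<Lambda>) (\<lambda>p q. prd \<Lambda> (\<lambda>z. t z q) a p) b
   + cobracket_r (d1 + d2 + \<nu>) (\<lambda>p q. prd \<nu> (\<lambda>z. t z q) b p) a
   + coproduct_r (d1 + d2 + \<Lambda>) (\<lambda>p q. brk \<Lambda> (\<lambda>z. t p z) a q) b
   + coproduct_r (d1 + d2 + \<nu>) (\<lambda>p q. brk \<nu> (\<lambda>z. t p z) b q) a"
  "brk \<Lambda> (coproduct_r (d1 + d2) t) a b =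
     coproduct_r (d1 + d2 + \<Lambda>) (\<lambda>p q. brk \<Lambda> (\<lambda>z. t z q) a p) b
   + coproduct_r (d1 + d2 + \<Lambda>) (\<lambda>p q. brk \<Lambda> (\<lambda>z. t p z) a q) b
   - cobracket_r (d1 + d2 + \<nu>) (\<lambda>p q. prd \<nu> (\<lambda>z. t p z) b q) a
   + cobracket_r (d1 + d2 + \<nu>) (\<lambda>p q. prd \<nu> (\<lambda>z. t z q) b p) a"
  unfolding cobracket_r_def coproduct_r_def B.eval_prod_fun_sum C.eval_prod_fun_sum
  by (simp_all only: cobracket_bracket_at [OF t1 t2 \<nu>] coproduct_product_at [OF t1 t2 \<nu>]
      cobracket_product_at [OF t1 t2 \<nu>] coproduct_bracket_at [OF t1 t2 \<nu>] sum.distrib sum_subtractf)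

end

end

context poisson_conformal_algebra
begin

context
  fixes x y :: "nat \<Rightarrow> 'p" and n :: nat
    and r :: "('k, 'p) tens2" and \<delta> \<Delta> :: "'p \<Rightarrow> ('k, 'p) tens2"
  defines r: "r \<equiv> \<Sum>i<n. tensor2 s (x i) (y i)"
    and \<delta>: "\<delta> \<equiv> coboundary_cobracket s br r" and \<Delta>: "\<Delta> \<equiv> coboundary_coproduct s mul r"
begin

text \<open>
  Evaluation in \<open>M = (P \<otimes> P)[\<lambda>]\<close> along \<open>t(u,v) = u \<otimes>
  v\<close>, a constant polynomial, turns the four conditions into the identities
  \<open>coboundary_compatibility_ev\<close> with \<open>\<Lambda> = X3\<close>.
\<close>

lemma coboundary_compatibility:
    "map_poly \<delta> (br a b) =
       (lam_left s (br a) (\<delta> b) + lam_right s (br a) (\<delta> b))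
       - (psubst_skew (der_tens2 s) (lam_left s (br b) (\<delta> a))
          + psubst_skew (der_tens2 s) (lam_right s (br b) (\<delta> a)))"
    "map_poly \<Delta> (mul a b) =
       lam_right s (mul a) (\<Delta> b)
       + psubst_skew (der_tens2 s) (lam_left s (mul b) (\<Delta> a))"
    "map_poly \<delta> (mul a b) =
       lam_left s (mul a) (\<delta> b)
       + psubst_skew (der_tens2 s) (lam_left s (mul b) (\<delta> a))
       + lam_right s (br a) (\<Delta> b)
       + psubst_skew (der_tens2 s) (lam_right s (br b) (\<Delta> a))"
    "map_poly \<Delta> (br a b) =
       (lam_left s (br a) (\<Delta> b) + lam_right s (br a) (\<Delta> b))
       - psubst_skew (der_tens2 s) (lam_right s (mul b) (\<delta> a))
       + psubst_skew (der_tens2 s) (lam_left s (mul b) (\<delta> a))"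
proof -
  interpret L: coboundary_evaluation s br mul "act2_poly s" const3 x y n
    using conformal_evaluation_tens2_poly poisson_conformal_algebra_axioms
    by (simp add: coboundary_evaluation_def poisson_evaluation_def)
  let ?t = "\<lambda>u v. [:tensor2 s u v:]" and ?\<nu> = "- X3 - (X1 + X2) :: 'k poly poly poly"
  note t = slot_tensor2_poly
  have k: "L.k_linear (\<lambda>u. ?t u v)" "L.k_linear (?t u)" for u v
    by (rule L.slot_k_linear [OF t(1)], rule L.slot_k_linear [OF t(2)])
  note rep = L.represents_cobracket [folded r, folded \<delta>] L.represents_coproduct [folded r, folded \<Delta>]
  note mem = L.coboundary_mem [folded r, folded \<delta> \<Delta>]
  have map_eq: "map_poly f q = ev (act2_poly s) X3 (F (X1 + X2) ?t) q"
    if "L.represents f F" and f: "\<And>z. f z \<in> tensor_space2 s" for f F q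
  proof -
    have eq: "tlift2 s ?t (f z) = F (X1 + X2) ?t z" for z
      by (rule L.representsD(1) [OF that(1) t])
    have "L.k_linear (F (X1 + X2) ?t)"
      by (rule L.slot_k_linear [OF L.representsD(2) [OF that(1) k]])
    then have "[:f 0:] = 0"
      using additive.zero [OF L.k_linear_additive] by (simp add: tlift2_tensor2_poly [OF f, symmetric] eq)
    then have f0: "f 0 = 0" by simp
    have "map_poly f q = ev (act2_poly s) X3 (tlift2 s ?t) (map_poly f q)"
      by (rule tensor_polys_as_ev) (simp add: tensor_polys_def coeff_map_poly f0 f)
    also have "\<dots> = ev (act2_poly s) X3 (F (X1 + X2) ?t) q"
      using tlift2_tensor2_poly [OF tensor_space2_0] by (simp add: L.M.ev_map_poly f0 eq)
    finally show ?thesis .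
  qed
  have slots: "L.slot (X1 + \<alpha>) (\<lambda>u. L.brk \<alpha> (\<lambda>z. ?t z v) a u)" "L.slot X2 (\<lambda>v. L.brk \<alpha> (\<lambda>z. ?t z v) a u)"
    "L.slot X1 (\<lambda>u. L.brk \<alpha> (\<lambda>z. ?t u z) a v)" "L.slot (X2 + \<alpha>) (\<lambda>v. L.brk \<alpha> (\<lambda>z. ?t u z) a v)"
    "L.slot (X1 + \<alpha>) (\<lambda>u. L.prd \<alpha> (\<lambda>z. ?t z v) a u)" "L.slot X2 (\<lambda>v. L.prd \<alpha> (\<lambda>z. ?t z v) a u)"
    "L.slot X1 (\<lambda>u. L.prd \<alpha> (\<lambda>z. ?t u z) a v)" "L.slot (X2 + \<alpha>) (\<lambda>v. L.prd \<alpha> (\<lambda>z. ?t u z) a v)"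
    for \<alpha> a u v
    by (intro L.slot_intros t)+
  have e: "X1 + \<alpha> + X2 = X1 + X2 + \<alpha>" "X1 + (X2 + \<alpha>) = X1 + X2 + \<alpha>" for \<alpha> :: "'k poly poly poly"
    by (simp_all add: algebra_simps)
  have lam: "lam_left s (br a) (f b) = F (X1 + X2 + X3) (\<lambda>u v. L.brk X3 (\<lambda>z. ?t z v) a u) b"
      "lam_right s (br a) (f b) = F (X1 + X2 + X3) (\<lambda>u v. L.brk X3 (\<lambda>z. ?t u z) a v) b"
      "lam_left s (mul a) (f b) = F (X1 + X2 + X3) (\<lambda>u v. L.prd X3 (\<lambda>z. ?t z v) a u) b"
      "lam_right s (mul a) (f b) = F (X1 + X2 + X3) (\<lambda>u v. L.prd X3 (\<lambda>z. ?t u z) a v) b"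
      "psubst_skew (der_tens2 s) (lam_left s (br a) (f b))
        = F (X1 + X2 + ?\<nu>) (\<lambda>u v. L.brk ?\<nu> (\<lambda>z. ?t z v) a u) b"
      "psubst_skew (der_tens2 s) (lam_right s (br a) (f b))
        = F (X1 + X2 + ?\<nu>) (\<lambda>u v. L.brk ?\<nu> (\<lambda>z. ?t u z) a v) b"
      "psubst_skew (der_tens2 s) (lam_left s (mul a) (f b))
        = F (X1 + X2 + ?\<nu>) (\<lambda>u v. L.prd ?\<nu> (\<lambda>z. ?t z v) a u) b"
      "psubst_skew (der_tens2 s) (lam_right s (mul a) (f b))
        = F (X1 + X2 + ?\<nu>) (\<lambda>u v. L.prd ?\<nu> (\<lambda>z. ?t u z) a v) b"
    if F: "L.represents f F" and f: "f b \<in> tensor_space2 s" for f F a b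
  proof -
    note lam_mem = L.B.lam_mem [OF f, of a] L.C.lam_mem [OF f, of a]
    show "lam_left s (br a) (f b) = F (X1 + X2 + X3) (\<lambda>u v. L.brk X3 (\<lambda>z. ?t z v) a u) b"
      by (subst tensor_polys_as_ev [OF lam_mem(1)])
         (simp only: L.B.ev_lam(1) [OF k f] L.representsD(1) [OF F slots(1,2)] e)
    show "lam_right s (br a) (f b) = F (X1 + X2 + X3) (\<lambda>u v. L.brk X3 (\<lambda>z. ?t u z) a v) b"
      by (subst tensor_polys_as_ev [OF lam_mem(2)])
         (simp only: L.B.ev_lam(2) [OF k f] L.representsD(1) [OF F slots(3,4)] e)
    show "lam_left s (mul a) (f b) = F (X1 + X2 + X3) (\<lambda>u v. L.prd X3 (\<lambda>z. ?t z v) a u) b"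
      by (subst tensor_polys_as_ev [OF lam_mem(3)])
         (simp only: L.C.ev_lam(1) [OF k f] L.representsD(1) [OF F slots(5,6)] e)
    show "lam_right s (mul a) (f b) = F (X1 + X2 + X3) (\<lambda>u v. L.prd X3 (\<lambda>z. ?t u z) a v) b"
      by (subst tensor_polys_as_ev [OF lam_mem(4)])
         (simp only: L.C.ev_lam(2) [OF k f] L.representsD(1) [OF F slots(7,8)] e)
    show "psubst_skew (der_tens2 s) (lam_left s (br a) (f b))
        = F (X1 + X2 + ?\<nu>) (\<lambda>u v. L.brk ?\<nu> (\<lambda>z. ?t z v) a u) b"
      by (simp only: psubst_skew_as_ev [OF lam_mem(1)] L.B.ev_lam(1) [OF k f]
          L.representsD(1) [OF F slots(1,2)] e)
    show "psubst_skew (der_tens2 s) (lam_right s (br a) (f b))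
        = F (X1 + X2 + ?\<nu>) (\<lambda>u v. L.brk ?\<nu> (\<lambda>z. ?t u z) a v) b"
      by (simp only: psubst_skew_as_ev [OF lam_mem(2)] L.B.ev_lam(2) [OF k f]
          L.representsD(1) [OF F slots(3,4)] e)
    show "psubst_skew (der_tens2 s) (lam_left s (mul a) (f b))
        = F (X1 + X2 + ?\<nu>) (\<lambda>u v. L.prd ?\<nu> (\<lambda>z. ?t z v) a u) b"
      by (simp only: psubst_skew_as_ev [OF lam_mem(3)] L.C.ev_lam(1) [OF k f]
          L.representsD(1) [OF F slots(5,6)] e)
    show "psubst_skew (der_tens2 s) (lam_right s (mul a) (f b))
        = F (X1 + X2 + ?\<nu>) (\<lambda>u v. L.prd ?\<nu> (\<lambda>z. ?t u z) a v) b"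
      by (simp only: psubst_skew_as_ev [OF lam_mem(4)] L.C.ev_lam(2) [OF k f]
          L.representsD(1) [OF F slots(7,8)] e)
  qed
  note lam\<delta> = lam [OF rep(1) mem(1)] and lam\<Delta> = lam [OF rep(2) mem(2)]
  note map\<delta> = map_eq [OF rep(1) mem(1)] and map\<Delta> = map_eq [OF rep(2) mem(2)]
  note compat = L.coboundary_compatibility_ev [OF t refl]
  show "map_poly \<delta> (br a b) =
       (lam_left s (br a) (\<delta> b) + lam_right s (br a) (\<delta> b))
       - (psubst_skew (der_tens2 s) (lam_left s (br b) (\<delta> a))
          + psubst_skew (der_tens2 s) (lam_right s (br b) (\<delta> a)))"
    unfolding lam\<delta>(5-8) unfolding lam\<delta>(1-4) map\<delta> by (rule compat(1) [unfolded L.B.eval_prod_def [of _ "L.cobracket_r _ _"]])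
  show "map_poly \<Delta> (mul a b) =
       lam_right s (mul a) (\<Delta> b)
       + psubst_skew (der_tens2 s) (lam_left s (mul b) (\<Delta> a))"
    unfolding lam\<Delta>(5-8) unfolding lam\<Delta>(1-4) map\<Delta> by (rule compat(2) [unfolded L.C.eval_prod_def [of _ "L.coproduct_r _ _"]])
  show "map_poly \<delta> (mul a b) =
       lam_left s (mul a) (\<delta> b)
       + psubst_skew (der_tens2 s) (lam_left s (mul b) (\<delta> a))
       + lam_right s (br a) (\<Delta> b)
       + psubst_skew (der_tens2 s) (lam_right s (br b) (\<Delta> a))"
    unfolding lam\<Delta>(5-8) lam\<delta>(5-8) unfolding lam\<Delta>(1-4) lam\<delta>(1-4) map\<delta> by (rule compat(3) [unfolded L.C.eval_prod_def [of _ "L.cobracket_r _ _"]])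
  show "map_poly \<Delta> (br a b) =
       (lam_left s (br a) (\<Delta> b) + lam_right s (br a) (\<Delta> b))
       - psubst_skew (der_tens2 s) (lam_right s (mul b) (\<delta> a))
       + psubst_skew (der_tens2 s) (lam_left s (mul b) (\<delta> a))"
    unfolding lam\<Delta>(5-8) lam\<delta>(5-8) unfolding lam\<Delta>(1-4) lam\<delta>(1-4) map\<Delta> by (rule compat(4) [unfolded L.B.eval_prod_def [of _ "L.coproduct_r _ _"]])
qed

text \<open>
  Here \<open>M = P \<otimes> P\<close> and \<open>t(u,v) = u \<otimes> v\<close>:
  \<open>\<partial>\<close>-linearity of a coproduct is the statement that it is a slot whose
  weight is the total derivative.
\<close>

lemma coboundary_coproducts:
  shows "conformal_coproduct s \<delta>" "conformal_coproduct s \<Delta>"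
    and "swap2 s r = - r \<Longrightarrow> \<delta> a = - swap2 s (\<delta> a)"
    and "swap2 s r = - r \<Longrightarrow> \<Delta> a = swap2 s (\<Delta> a)"
proof -
  interpret T: coboundary_evaluation s br mul "act2 s" const3 x y n
    using conformal_evaluation_tens2 poisson_conformal_algebra_axioms
    by (simp add: coboundary_evaluation_def poisson_evaluation_def)
  note t = slot_tensor2
  have k: "T.k_linear (\<lambda>u. tensor2 s u v)" "T.k_linear (tensor2 s u)" for u v
    by (rule T.slot_k_linear [OF t(1)], rule T.slot_k_linear [OF t(2)])
  note rep = T.represents_cobracket [folded r, folded \<delta>] T.represents_coproduct [folded r, folded \<Delta>]
  note mem = T.coboundary_mem [folded r, folded \<delta> \<Delta>]
  have eq: "f = F (X1 + X2) (tensor2 s)" if "T.represents f F" "\<And>z. f z \<in> tensor_space2 s" for f F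
    using T.representsD(1) [OF that(1) t] by (intro ext [of f]) (simp add: tlift2_tensor2 [OF that(2)])
  have cop: "conformal_coproduct s f" if "T.represents f F" and f: "\<And>z. f z \<in> tensor_space2 s" for f F
  proof -
    have "T.slot (X1 + X2) f"
      by (subst eq [OF that]) (rule T.representsD(2) [OF that(1) k])
    then have "(\<forall>u v. f (u + v) = f u + f v) \<and> (\<forall>c u. f (kscale s c u) = tscale c (f u))"
        "\<forall>u. f (der s u) = der_tens2 s (f u)"
      by (auto simp: T.slot_def T.k_linear_iff act2(4) der_tens2_act2 f)
    then show ?thesis
      using vector_space_kscale [OF module_axioms] vector_space_tscale f fg_diff_module_axioms
      by (simp add: conformal_coproduct_def conformal_coproduct_axioms_def linear_iff_add_scale)
  qed
  show "conformal_coproduct s \<delta>" "conformal_coproduct s \<Delta>"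
    by (rule cop [OF rep(1) mem(1)], rule cop [OF rep(2) mem(2)])
  assume swap: "swap2 s r = - r"
  interpret K: skew_coboundary_evaluation s br mul "act2 s" const3 x y n
    by unfold_locales (rule T.skew_from_swap [OF swap [unfolded r]])
  have "swap2 s (f a) = F (X1 + X2) (\<lambda>u v. tensor2 s v u) a" if "T.represents f F" for f F
    unfolding swap2_def using T.representsD(1) [OF that t(2) t(1)] by (simp add: add.commute)
  from this [OF rep(1)] this [OF rep(2)]
  show "\<delta> a = - swap2 s (\<delta> a)" "\<Delta> a = swap2 s (\<Delta> a)"
    using K.cobracket_r_skew [OF k, of "X1 + X2" a] K.coproduct_r_commute [OF k, of "X1 + X2" a]
      fun_cong [OF eq [OF rep(1) mem(1)], of a] fun_cong [OF eq [OF rep(2) mem(2)], of a] by simp_all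
qed

text \<open>
  Here \<open>M = P \<otimes> P \<otimes> P\<close> and \<open>t(u,v,w) = u \<otimes> v
  \<otimes> w\<close>. The permutation \<open>\<tau> \<otimes> I\<close> of an iterated
  coproduct is represented by permuting the arguments of \<open>t\<close>.
\<close>

lemma coboundary_coalgebra:
  assumes "swap2 s r = - r"
    and "conformal_cybe s br r \<in> der_tens3 s ` tensor_space3 s"
    and "conformal_aybe s mul r \<in> der_tens3 s ` tensor_space3 s"
  shows "cop_right s \<delta> (\<delta> a) - swap12 s (cop_right s \<delta> (\<delta> a)) = cop_left s \<delta> (\<delta> a)"
    "cop_right s \<Delta> (\<Delta> a) = cop_left s \<Delta> (\<Delta> a)"
    "cop_right s \<Delta> (\<delta> a) = cop_left s \<delta> (\<Delta> a) + swap12 s (cop_right s \<delta> (\<Delta> a))"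
proof -
  interpret T: coboundary_evaluation s br mul "act3 s" const3 x y n
    using conformal_evaluation_tens3 poisson_conformal_algebra_axioms
    by (simp add: coboundary_evaluation_def poisson_evaluation_def)
  interpret Y: yang_baxter_evaluation s br mul "act3 s" const3 x y n
  proof unfold_locales
    fix f :: "'p \<Rightarrow> 'p \<Rightarrow> ('k, 'p) tens3"
    assume "\<And>v. T.k_linear (\<lambda>u. f u v)" "\<And>u. T.k_linear (f u)"
    then show "(\<Sum>i<n. f (x i) (y i)) = - (\<Sum>i<n. f (y i) (x i))"
      by (rule T.skew_from_swap [OF assms(1) [unfolded r]])
  next
    fix t :: "'p \<Rightarrow> 'p \<Rightarrow> 'p \<Rightarrow> ('k, 'p) tens3" and e1 e2 e3
    assume t: "\<And>v w. T.slot e1 (\<lambda>u. t u v w)" "\<And>u w. T.slot e2 (\<lambda>v. t u v w)" "\<And>u v. T.slot e3 (t u v)"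
      and e: "e1 + e2 + e3 = 0"
    show "(\<Sum>i<n. \<Sum>j<n. T.brk e2 (\<lambda>z. t z (y i) (y j)) (x i) (x j)
        - T.brk e3 (\<lambda>z. t (x i) z (y j)) (x j) (y i)
        - T.brk e2 (\<lambda>z. t (x i) (x j) z) (y j) (y i)) = 0"
      using T.tlift3_der_tens3_image [OF t e assms(2)] by (simp add: T.tlift3_yang_baxter(1) [OF t] r)
    have "- (e1 + e2) = e3" using e by (rule minus_unique)
    then show "(\<Sum>i<n. \<Sum>j<n. T.prd e1 (\<lambda>z. t (x i) (x j) z) (y i) (y j)
        - T.prd e3 (\<lambda>z. t (x i) z (y j)) (x j) (y i)
        + T.prd e2 (\<lambda>z. t z (y i) (y j)) (x i) (x j)) = 0"
      using T.tlift3_der_tens3_image [OF t e assms(3)] T.tlift3_yang_baxter(2) [OF t, where n = n and x = x and y = y]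
      by (simp only: r)
  qed
  note t = slot_tensor3
  note rep = T.represents_cobracket [folded r, folded \<delta>] T.represents_coproduct [folded r, folded \<Delta>]
  note mem = T.coboundary_mem [folded r, folded \<delta> \<Delta>]
  have left: "cop_left s g (f a) = F (X1 + X2 + X3) (\<lambda>u v. G (X1 + X2) (\<lambda>p q. tensor3 s p q v) u) a"
    if "T.represents f F" "T.represents g G" for f g F G
    unfolding cop_left_def by (rule T.tlift2_nested_left [OF that t])
  have right: "cop_right s g (f a) = F (X1 + X2 + X3) (\<lambda>u. G (X2 + X3) (tensor3 s u)) a"
    if "T.represents f F" "T.represents g G" for f g F G
    unfolding cop_right_def by (rule T.tlift2_nested_right [OF that t])
  have swap: "swap12 s (cop_right s g (f a)) = F (X1 + X2 + X3) (\<lambda>u. G (X1 + X3) (\<lambda>p. tensor3 s p u)) a"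
    if F: "T.represents f F" and G: "T.represents g G"
      and f: "f a \<in> tensor_space2 s" and g: "\<And>z. g z \<in> tensor_space2 s" for f g F G
  proof -
    have k: "T.k_linear (\<lambda>u. tensor3 s u v w)" "T.k_linear (\<lambda>v. tensor3 s u v w)" "T.k_linear (tensor3 s u v)" for u v w
      by (rule t [THEN T.slot_k_linear])+
    note univ = tensor3_universal [OF trilin_der3(4)]
    have sw3: "swap12 s (tensor3 s u v w) = tensor3 s v u w" for u v w
      unfolding swap12_def by (rule univ(1))
    have sw_add: "swap12 s (w + w') = swap12 s w + swap12 s w'"
      if "w \<in> tensor_space3 s" "w' \<in> tensor_space3 s" for w w'
      unfolding swap12_def using that by (rule univ(2))
    have inner: "swap12 s (tlift2 s (tensor3 s u) (g v)) = tlift2 s (\<lambda>p q. tensor3 s p u q) (g v)" for u v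
      using tlift2_compose [where G = "swap12 s" and S = "tensor_space3 s",
          OF T.bilinI [OF k(2,3)] _ tensor_space3_0 tensor_space3_add sw_add tensor3_mem g,
          unfolded sw3, OF T.bilinI [OF k(1,3)]] .
    have nested: "tlift2 s (tensor3 s u) (g v) = G (X2 + X3) (tensor3 s u) v" for u v
      by (rule T.representsD(1) [OF G t(2,3)])
    have nested': "tlift2 s (\<lambda>p q. tensor3 s p u q) (g v) = G (X1 + X3) (\<lambda>p q. tensor3 s p u q) v" for u v
      by (rule T.representsD(1) [OF G t(1,3)])
    have k_linear: "T.k_linear (\<lambda>u. G (X2 + X3) (tensor3 s u) v)" "T.k_linear (G (X2 + X3) (tensor3 s u))"
      "T.k_linear (\<lambda>u. G (X1 + X3) (\<lambda>p q. tensor3 s p u q) v)" "T.k_linear (G (X1 + X3) (\<lambda>p q. tensor3 s p u q))"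
      for u v
      by (rule T.slot_k_linear [OF T.representsD(3) [OF G t(1)]] T.slot_k_linear [OF T.representsD(2) [OF G k(2,3)]]
        T.slot_k_linear [OF T.representsD(3) [OF G t(2)]] T.slot_k_linear [OF T.representsD(2) [OF G k(1,3)]])+
    have inner': "swap12 s (G (X2 + X3) (tensor3 s u) v) = G (X1 + X3) (\<lambda>p q. tensor3 s p u q) v" for u v
      using inner [of u v] unfolding nested nested' .
    have mem3: "G (X2 + X3) (tensor3 s u) v \<in> tensor_space3 s" for u v
      using tlift2_mem [OF T.bilinI [OF k(2,3)] tensor_space3_0 tensor_space3_add tensor3_mem g]
      unfolding nested .
    have "swap12 s (cop_right s g (f a)) = tlift2 s (\<lambda>u v. tlift2 s (\<lambda>p q. tensor3 s p u q) (g v)) (f a)"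
      unfolding cop_right_def nested nested'
      by (rule tlift2_compose [where G = "swap12 s" and S = "tensor_space3 s",
          OF T.bilinI [OF k_linear(1,2)] _ tensor_space3_0 tensor_space3_add sw_add mem3 f,
          unfolded inner', OF T.bilinI [OF k_linear(3,4)]])
    also have "\<dots> = F (X2 + X1 + X3) (\<lambda>u. G (X1 + X3) (\<lambda>p q. tensor3 s p u q)) a"
      by (rule T.tlift2_nested_right [OF F G t(2,1,3)])
    finally show ?thesis by (simp add: add.commute [of X2])
  qed
  show "cop_right s \<delta> (\<delta> a) - swap12 s (cop_right s \<delta> (\<delta> a)) = cop_left s \<delta> (\<delta> a)"
    unfolding swap [OF rep(1,1) mem(1,1)] unfolding left [OF rep(1,1)] right [OF rep(1,1)]
    by (rule Y.cobracket_r_jacobi [OF t refl])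
  show "cop_right s \<Delta> (\<Delta> a) = cop_left s \<Delta> (\<Delta> a)"
    unfolding left [OF rep(2,2)] right [OF rep(2,2)]
    by (rule Y.coproduct_r_coassoc [OF t refl])
  show "cop_right s \<Delta> (\<delta> a) = cop_left s \<delta> (\<Delta> a) + swap12 s (cop_right s \<delta> (\<Delta> a))"
    unfolding swap [OF rep(2,1) mem(2,1)] unfolding left [OF rep(2,1)] right [OF rep(1,2)]
    by (rule Y.cobracket_r_coleibniz [OF t refl])
qed

end

end

theorem corollary3p11:
  fixes s :: "'k::field_char_0 poly \<Rightarrow> 'p::ab_group_add \<Rightarrow> 'p"
    and br mul :: "'p \<Rightarrow> 'p \<Rightarrow> 'p poly"
    and r :: "('k, 'p) tens2"
  assumes "poisson_conformal_algebra s br mul"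
    and "r \<in> tensor_space2 s"
    and "swap2 s r = - r"
    and "conformal_cybe s br r \<in> der_tens3 s ` tensor_space3 s"
    and "conformal_aybe s mul r \<in> der_tens3 s ` tensor_space3 s"
  shows "poisson_conformal_coalgebra s (coboundary_cobracket s br r) (coboundary_coproduct s mul r)
    \<and> poisson_conformal_bialgebra s br mul
        (coboundary_cobracket s br r) (coboundary_coproduct s mul r)"
proof -
  interpret P: poisson_conformal_algebra s br mul by fact
  from assms(2) obtain x y and n :: nat where r: "r = (\<Sum>i<n. tensor2 s (x i) (y i))"
    by (rule tensor_space2E)
  let ?\<delta> = "coboundary_cobracket s br r" and ?\<Delta> = "coboundary_coproduct s mul r"
  note skew = assms(3) [unfolded r]
  interpret d: conformal_coproduct s ?\<delta>
    unfolding r by (rule P.coboundary_coproducts)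
  interpret D: conformal_coproduct s ?\<Delta>
    unfolding r by (rule P.coboundary_coproducts)
  note coalgebra = P.coboundary_coalgebra [OF assms(3-5) [unfolded r], folded r]
  have co: "poisson_conformal_coalgebra s ?\<delta> ?\<Delta>"
    by unfold_locales
       (rule P.coboundary_coproducts(3,4) [OF skew, folded r] coalgebra)+
  moreover have "poisson_conformal_bialgebra s br mul ?\<delta> ?\<Delta>"
    using co assms(1) P.coboundary_compatibility [of x y n, folded r]
    by (simp add: poisson_conformal_bialgebra_def poisson_conformal_bialgebra_axioms_def)
  ultimately show ?thesis by blast
qed

end
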